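(* Let $Z$ be a random measure on $\mathbb R$ with cumulant $K$. Then $Z$ is superposable if and only if there exist a constant $c\ge0$ and a measure $\Delta$ on $\mathcal M^*$ satisfying $$\int_{\mathbb R}e^x\int_0^\infty(1-e^{-y})\,\Delta(\mu(A+x)\in dy)\,dx<\infty\quad\text{for every bounded Borel set }A\subset\mathbb R,$$ such that for every measurable function $f:\mathbb R\to\mathbb R_+$, $$K(f)=c\int_{\mathbb R}e^{-x}f(x)\,dx+\int_{\mathbb R}e^{-x}\int_{\mathcal M^*}\big[1-\exp(-\langle\mu,f\rangle)\big]\,T_x\Delta(d\mu)\,dx.$$ Moreover, $\Delta$ can be chosen such that $\Delta(M(\mu)\ne0)=0$, and as such it is unique unless $Z=0$ almost surely.
   Context: $\mathcal M$ is the space of measures on $\mathbb R$ assigning finite mass to every bounded Borel set, with the vague topology (a Polish space) and its Borel $\sigma$-field; $\mathcal M^*=\mathcal M\setminus\{0\}$. A random measure is a random variable $Z$ with values in $\mathcal M$. For $x\in\mathbb R$, the translation $T_x:\mathcal M\to\mathcal M$ is $(T_x\mu)(A)=\mu(A-x)$, and for a measure $\Delta$ on $\mathcal M^*$, $T_x\Delta$ denotes the image of $\Delta$ under $T_x$. For $\mu\in\mathcal M^*$, $$M(\mu)=\inf\{x\in\mathbb R:\mu((x,\infty))<\min(1,\mu(\mathbb R)/2)\}$$ (with $\inf\emptyset=+\infty$). $\langle\mu,f\rangle=\int f\,d\mu$. The cumulant of $Z$ is $K(f)=-\log E[\exp(-\langle Z,f\rangle)]\in[0,\infty]$ for measurable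 $f\ge0$. $Z$ is called superposable if, for all $\alpha,\beta\in\mathbb R$ with $e^\alpha+e^\beta=1$, $Z$ is equal in law to $T_\alpha Z+T_\beta Z'$, where $Z'$ is an independent copy of $Z$. *)

theory Defs
  imports "HOL-Probability.Probability"
begin

text \<open>
  The space of measures on the real line with finite mass on bounded Borel sets, as a type, so
  that \<^term>\<open>borel\<close> on this type is the Borel $\sigma$-field of the vague topology.
\<close>

typedef locfin_measure =
  "{\<mu> :: real measure. sets \<mu> = sets borel \<and> (\<forall>A\<in>sets borel. bounded A \<longrightarrow> emeasure \<mu> A < \<infinity>)}"
  morphisms to_measure of_measure
  by (rule exI[of _ "null_measure borel"]) simp

setup_lifting type_definition_locfin_measure

lemma sets_to_measure [simp, measurable_cong]: "sets (to_measure \<mu>) = sets borel"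
  using to_measure[of \<mu>] by simp

lemma space_to_measure [simp]: "space (to_measure \<mu>) = UNIV"
  using sets_eq_imp_space_eq[OF sets_to_measure[of \<mu>]] by simp

lemma emeasure_to_measure_bounded:
  "A \<in> sets borel \<Longrightarrow> bounded A \<Longrightarrow> emeasure (to_measure \<mu>) A < \<infinity>"
  using to_measure[of \<mu>] by simp

text \<open>
  The vague topology: the coarsest one making \<open>\<mu> \<mapsto> \<integral>f d\<mu>\<close> continuous for every continuous
  \<open>f\<close> with compact support (such \<open>f\<close> are integrable with respect to every \<open>\<mu>\<close> of this type).
\<close>

instantiation locfin_measure :: topological_space
begin

definition open_locfin_measure :: "locfin_measure set \<Rightarrow> bool" where
  "open_locfin_measure = generate_topology
     {{\<mu>. integral\<^sup>L (to_measure \<mu>) f \<in> U} | (f :: real \<Rightarrow> real) (U :: real set).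
        continuous_on UNIV f \<and> compact (closure {x. f x \<noteq> 0}) \<and> open U}"

instance
  by standard
     (auto simp: open_locfin_measure_def intro: generate_topology.intros)

end

instantiation locfin_measure :: "{zero, plus}"
begin

lift_definition zero_locfin_measure :: locfin_measure is "null_measure borel"
  by simp

definition plus_measure :: "real measure \<Rightarrow> real measure \<Rightarrow> real measure" where
  "plus_measure \<mu> \<nu> = measure_of UNIV (sets borel) (\<lambda>A. emeasure \<mu> A + emeasure \<nu> A)"

lemma sets_plus_measure [simp]: "sets (plus_measure \<mu> \<nu>) = sets borel"
  unfolding plus_measure_def using sets.sigma_sets_eq[of "borel :: real measure"]
  by (simp add: sets_measure_of_conv)

lemma emeasure_plus_measure:
  assumes "sets \<mu> = sets borel" "sets \<nu> = sets borel" "A \<in> sets borel"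
  shows "emeasure (plus_measure \<mu> \<nu>) A = emeasure \<mu> A + emeasure \<nu> A"
proof (rule emeasure_measure_of[OF plus_measure_def])
  show "countably_additive (sets (plus_measure \<mu> \<nu>)) (\<lambda>A. emeasure \<mu> A + emeasure \<nu> A)"
  proof (rule countably_additiveI)
    fix F :: "nat \<Rightarrow> real set"
    assume "range F \<subseteq> sets (plus_measure \<mu> \<nu>)" "disjoint_family F"
    then show "(\<Sum>i. emeasure \<mu> (F i) + emeasure \<nu> (F i)) = emeasure \<mu> (\<Union>(range F)) + emeasure \<nu> (\<Union>(range F))"
      using assms by (simp add: suminf_add[symmetric] suminf_emeasure)
  qed
qed (use assms in \<open>auto simp: positive_def\<close>)

lift_definition plus_locfin_measure :: "locfin_measure \<Rightarrow> locfin_measure \<Rightarrow> locfin_measure"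
  is plus_measure
  by (simp add: emeasure_plus_measure)

instance ..

end

lift_definition translate :: "real \<Rightarrow> locfin_measure \<Rightarrow> locfin_measure"
  is "\<lambda>x \<mu>. distr \<mu> borel (\<lambda>y. y + x)"
proof safe
  fix x :: real and \<mu> :: "real measure" and A :: "real set"
  assume s: "sets \<mu> = sets borel" and fin: "\<forall>A\<in>sets borel. bounded A \<longrightarrow> emeasure \<mu> A < \<infinity>"
    and A: "A \<in> sets borel" "bounded A"
  have sp: "space \<mu> = UNIV" using sets_eq_imp_space_eq[OF s] by simp
  have m: "(\<lambda>y. y + x) \<in> measurable \<mu> borel"
    using s by (simp add: measurable_cong_sets[OF s refl])
  have eq: "(\<lambda>y. y + x) -` A = (\<lambda>y. - x + y) ` A"
    by (force simp: image_iff)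
  have "(\<lambda>y. y + x) -` A \<in> sets borel"
    using measurable_sets[OF m A(1)] by (simp add: s sp)
  moreover have "bounded ((\<lambda>y. y + x) -` A)"
    unfolding eq by (rule bounded_translation[OF A(2)])
  ultimately show "emeasure (distr \<mu> borel (\<lambda>y. y + x)) A < \<infinity>"
    using fin by (simp add: emeasure_distr[OF m A(1)] sp)
qed simp_all

lemma emeasure_plus_locfin:
  "A \<in> sets borel \<Longrightarrow> emeasure (to_measure (\<mu> + \<nu>)) A = emeasure (to_measure \<mu>) A + emeasure (to_measure \<nu>) A"
  by (simp add: plus_locfin_measure.rep_eq emeasure_plus_measure)

lemma emeasure_zero_locfin: "emeasure (to_measure 0) A = 0"
  by (simp add: zero_locfin_measure.rep_eq)

lemma emeasure_translate:
  assumes A: "A \<in> sets borel"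
  shows "emeasure (to_measure (translate x \<mu>)) A = emeasure (to_measure \<mu>) ((\<lambda>a. a - x) ` A)"
proof -
  have eq: "(\<lambda>y. y + x) -` A = (\<lambda>a. a - x) ` A"
    by (force simp: image_iff)
  have m: "(\<lambda>y. y + x) \<in> measurable (to_measure \<mu>) borel"
    by simp
  show ?thesis
    using A by (simp add: translate.rep_eq emeasure_distr[OF m] eq)
qed

definition borel_nonzero :: "locfin_measure measure" where
  "borel_nonzero = restrict_space borel (- {0})"

definition translate_law :: "real \<Rightarrow> locfin_measure measure \<Rightarrow> locfin_measure measure" where
  "translate_law x \<Delta> = distr \<Delta> borel_nonzero (translate x)"

definition pairing :: "locfin_measure \<Rightarrow> (real \<Rightarrow> real) \<Rightarrow> ennreal" where
  "pairing \<mu> f = (\<integral>\<^sup>+ y. ennreal (f y) \<partial>to_measure \<mu>)"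

text \<open>The functions $e^{-t}$ on $[0,\infty]$ and $-\log p$ on $[0,1]$, with
  $e^{-\infty} = 0$ and $-\log 0 = \infty$ (whereas \<^term>\<open>ln (0::real) = 0\<close>).\<close>

definition exp_neg :: "ennreal \<Rightarrow> real" where
  "exp_neg t = (if t = \<infinity> then 0 else exp (- enn2real t))"

definition neg_log :: "real \<Rightarrow> ennreal" where
  "neg_log p = (if p = 0 then \<infinity> else ennreal (- ln p))"

definition cumulant :: "'a measure \<Rightarrow> ('a \<Rightarrow> locfin_measure) \<Rightarrow> (real \<Rightarrow> real) \<Rightarrow> ennreal" where
  "cumulant P Z f = neg_log (\<integral>\<omega>. exp_neg (pairing (Z \<omega>) f) \<partial>P)"

text \<open>The independent copy is realised on the product space: \<open>Z\<close> and \<open>Z'\<close> are the two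
  coordinate copies of \<open>Z\<close> on \<open>P \<Otimes>\<^sub>M P\<close>.\<close>

definition superposable :: "'a measure \<Rightarrow> ('a \<Rightarrow> locfin_measure) \<Rightarrow> bool" where
  "superposable P Z \<longleftrightarrow> (\<forall>\<alpha> \<beta> :: real. exp \<alpha> + exp \<beta> = 1 \<longrightarrow>
     distr P borel Z =
     distr (P \<Otimes>\<^sub>M P) borel (\<lambda>(\<omega>, \<omega>'). translate \<alpha> (Z \<omega>) + translate \<beta> (Z \<omega>')))"

definition M_pos :: "locfin_measure \<Rightarrow> ereal" where
  "M_pos \<mu> = Inf (ereal ` {x. emeasure (to_measure \<mu>) {x<..}
                              < min 1 (emeasure (to_measure \<mu>) UNIV / 2)})"

text \<open>In the integrability condition below, \<open>\<mu>(A + x)\<close> is finite since \<open>A\<close> is bounded, so its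
  real value \<^const>\<open>measure\<close> loses nothing.\<close>

definition integrability_condition :: "locfin_measure measure \<Rightarrow> bool" where
  "integrability_condition \<Delta> \<longleftrightarrow> (\<forall>A\<in>sets (borel :: real measure). bounded A \<longrightarrow>
     (\<integral>\<^sup>+ x. ennreal (exp x) *
        (\<integral>\<^sup>+ y\<in>{0..}. ennreal (1 - exp (- y))
           \<partial>distr \<Delta> borel (\<lambda>\<mu>. measure (to_measure \<mu>) ((\<lambda>a. a + x) ` A)))
      \<partial>lborel) < \<infinity>)"

definition represents ::
  "real \<Rightarrow> locfin_measure measure \<Rightarrow> 'a measure \<Rightarrow> ('a \<Rightarrow> locfin_measure) \<Rightarrow> bool" where
  "represents c \<Delta> P Z \<longleftrightarrow>
     0 \<le> c \<and> sets \<Delta> = sets borel_nonzero \<and> integrability_condition \<Delta> \<and>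
     (\<forall>f\<in>borel_measurable borel. (\<forall>x. 0 \<le> f x) \<longrightarrow>
        cumulant P Z f =
          ennreal c * (\<integral>\<^sup>+ x. ennreal (exp (- x) * f x) \<partial>lborel) +
          (\<integral>\<^sup>+ x. ennreal (exp (- x)) *
             (\<integral>\<^sup>+ \<mu>. ennreal (1 - exp_neg (pairing \<mu> f)) \<partial>translate_law x \<Delta>) \<partial>lborel))"

end

theory Submission
  imports Defs
begin

text \<open>
  Write \<open>Z\<^sub>t\<close> for the translate of \<open>Z\<close> by \<open>ln t\<close>. Superposability says that \<open>Z\<^sub>s + Z'\<^sub>t\<close> has the
  law of \<open>Z\<^bsub>s+t\<^esub>\<close>, so \<open>Z\<close> is infinitely divisible and the cumulant of \<open>Z\<^sub>t\<close> is \<open>t K\<close>.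

  The Levy measure \<open>\<Lambda>\<close> of \<open>Z\<close> is obtained without a compactness argument. Split \<open>Z\<close> repeatedly into
  two independent halves, follow one branch \<open>W\<^sub>0 \<ge> W\<^sub>1 \<ge> \<dots>\<close> of the resulting binary tree, and bias
  the law of the branch up to depth \<open>k\<close> by \<open>2\<^sup>k \<langle>W\<^sub>k, h\<rangle>\<close>. As the children of a node are exchangeable, the
  biased laws are consistent, so they extend to infinite branches. There the decreasing sequence
  \<open>W\<^sub>k\<close> converges, and the law of its limit yields \<open>\<Lambda>\<close> through the first differences
  \<open>K(f + h) - K(f)\<close>. What \<open>\<Lambda>\<close> leaves of the cumulant is additive in \<open>f\<close>, and its scaling under
  translations makes it a multiple of the integral of \<open>f\<close> against \<open>exp (- x) dx\<close>.

  The same scaling multiplies \<open>\<Lambda>\<close> by \<open>e\<^sup>a\<close> under translation by \<open>a\<close>, whereas the position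
  \<open>M\<close> moves by \<open>a\<close>. So \<open>\<Lambda>\<close> disintegrates into \<open>exp (- x) dx\<close> for the position and a measure \<open>\<Delta>\<close> of
  clusters at position 0. Conversely any \<open>\<Delta>\<close> produces such a \<open>\<Lambda>\<close>, which the second differences
  of \<open>K\<close> determine; when the positions vanish, \<open>\<Delta>\<close> is recovered from \<open>\<Lambda>\<close> by recentring.
\<close>

section \<open>Borel structure of the vague topology\<close>

text \<open>Two infinities shape the argument: \<open>Z\<close> and its clusters may have infinite
  total mass, and \<open>\<Lambda>\<close> may be infinite near the zero measure. Both are met by a
  single strictly positive \<open>h\<close> for which <Z,h> is almost surely finite. The weight 1 -
  exp(-<\<mu>,h>) is bounded, vanishes only at \<mu> = 0 and is integrable against
  \<open>\<Lambda>\<close>. The measure with Laplace functional f -> K(f + h) - K(f) is this weight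
  times \<open>\<Lambda>\<close> plus an atom at the zero measure: the atom is the drift of
  \<open>h\<close>, and dividing the rest by the weight gives \<open>\<Lambda>\<close>.

  The weighted sum over all 2^k nodes of depth \<open>k\<close> approximates that measure; the size
  bias turns the sum into an expectation along one branch, so that the limit can be taken pathwise
  under a single law instead of along a sequence of laws.

  Clusters have a finite position because, by the same scaling, the unit intervals (j, j + 1] enter
  the cumulant with the geometric factor e^(-j); this makes the mass to the right of 0
  finite.\<close>

lemma locfin_measure_eqI:
  assumes "\<And>a b. a < b \<Longrightarrow> emeasure (to_measure \<mu>) {a<..b} = emeasure (to_measure \<nu>) {a<..b}"
  shows "\<mu> = \<nu>"
proof -
  have "to_measure \<mu> = to_measure \<nu>"
  proof (rule measure_eqI_generator_eq[where E="range (\<lambda>(a, b). {a<..b::real})" and \<Omega>=UNIV and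
        A="\<lambda>i::nat. {- real i<..real i}"])
    show "Int_stable (range (\<lambda>(a, b). {a<..b::real}))"
      by (auto simp: Int_stable_def)
    show "emeasure (to_measure \<mu>) X = emeasure (to_measure \<nu>) X"
      if "X \<in> range (\<lambda>(a, b). {a<..b})" for X
    proof -
      from that obtain a b where X: "X = {a<..b}" by (auto simp: image_iff)
      show ?thesis using assms[of a b] by (cases "a < b") (auto simp: X)
    qed
    show "sets (to_measure \<mu>) = sigma_sets UNIV (range (\<lambda>(a, b). {a<..b}))"
      "sets (to_measure \<nu>) = sigma_sets UNIV (range (\<lambda>(a, b). {a<..b}))"
      by (simp_all add: borel_sigma_sets_Ioc)
    show "(\<Union>i::nat. {- real i<..real i}) = UNIV"
    proof (safe; simp)
      fix x :: real
      obtain n :: nat where "\<bar>x\<bar> < n" using reals_Archimedean2 by blast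
      then show "\<exists>i::nat. - real i < x \<and> x \<le> real i" by (intro exI[of _ n]) auto
    qed
    show "emeasure (to_measure \<mu>) {- real i<..real i} \<noteq> \<infinity>" for i :: nat
      using emeasure_to_measure_bounded[of "{- real i<..real i}" \<mu>] by simp
  qed auto
  then show ?thesis by (simp add: to_measure_inject)
qed

lemma sigma_finite_to_measure: "sigma_finite_measure (to_measure \<mu>)"
proof
  show "\<exists>A. countable A \<and> A \<subseteq> sets (to_measure \<mu>) \<and> \<Union>A = space (to_measure \<mu>) \<and>
    (\<forall>a\<in>A. emeasure (to_measure \<mu>) a \<noteq> \<infinity>)"
  proof (intro exI[of _ "range (\<lambda>i::nat. {- real i..real i})"] conjI ballI)
    show "\<Union> (range (\<lambda>i::nat. {- real i..real i})) = space (to_measure \<mu>)"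
    proof (safe; simp)
      fix x :: real
      obtain n :: nat where "\<bar>x\<bar> < n" using reals_Archimedean2 by blast
      then show "\<exists>i::nat. - real i \<le> x \<and> x \<le> real i" by (intro exI[of _ n]) auto
    qed
    fix a assume "a \<in> range (\<lambda>i::nat. {- real i..real i})"
    then show "emeasure (to_measure \<mu>) a \<noteq> \<infinity>"
      using emeasure_to_measure_bounded[of a \<mu>] by auto
  qed auto
qed

text \<open>Tent functions: every continuous function is approximated by its values at the grid points
  times the corresponding tents, so countably many of them already generate the vague topology.\<close>

definition tent :: "nat \<times> int \<Rightarrow> real \<Rightarrow> real" where
  "tent p x = max 0 (1 - \<bar>real (Suc (fst p)) * x - real_of_int (snd p)\<bar>)"

lemma tent_nonneg: "0 \<le> tent p x" and tent_le_1: "tent p x \<le> 1"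
  by (auto simp: tent_def)

lemma tent_pos_iff: "tent p x \<noteq> 0 \<longleftrightarrow> \<bar>real (Suc (fst p)) * x - real_of_int (snd p)\<bar> < 1"
  by (auto simp: tent_def max_def)

lemma continuous_tent: "continuous_on A (tent p)"
  unfolding tent_def by (intro continuous_intros)

text \<open>At each point only the tents at \<open>\<lfloor>y\<rfloor>\<close> and
  \<open>\<lfloor>y\<rfloor> + 1\<close>, with y = (n + 1) x, can be nonzero, and their heights add
  up to 1; the range of indices is wide enough to contain both.\<close>

lemma sum_tent:
  assumes "\<bar>real (Suc n) * x\<bar> \<le> real m"
  shows "(\<Sum>j\<in>{- int m - 1..int m + 1}. tent (n, j) x) = 1"
proof -
  define y where "y = real (Suc n) * x"
  have *: "- int m - 1 \<le> \<lfloor>y\<rfloor>" "\<lfloor>y\<rfloor> + 1 \<le> int m + 1" using assms unfolding y_def[symmetric] by linarith+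
  have "(\<Sum>j\<in>{- int m - 1..int m + 1}. tent (n, j) x) = (\<Sum>j\<in>{\<lfloor>y\<rfloor>, \<lfloor>y\<rfloor> + 1}. tent (n, j) x)"
  proof (rule sum.mono_neutral_right)
    show "{\<lfloor>y\<rfloor>, \<lfloor>y\<rfloor> + 1} \<subseteq> {- int m - 1..int m + 1}" using * by auto
    show "\<forall>i\<in>{- int m - 1..int m + 1} - {\<lfloor>y\<rfloor>, \<lfloor>y\<rfloor> + 1}. tent (n, i) x = 0"
    proof
      fix i assume "i \<in> {- int m - 1..int m + 1} - {\<lfloor>y\<rfloor>, \<lfloor>y\<rfloor> + 1}"
      then have "i \<le> \<lfloor>y\<rfloor> - 1 \<or> \<lfloor>y\<rfloor> + 2 \<le> i" by auto
      then have "\<bar>y - real_of_int i\<bar> \<ge> 1" by linarith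
      then show "tent (n, i) x = 0" by (simp add: tent_def y_def)
    qed
  qed simp
  also have "\<dots> = tent (n, \<lfloor>y\<rfloor>) x + tent (n, \<lfloor>y\<rfloor> + 1) x" by simp
  also have "\<dots> = 1"
  proof -
    have "\<bar>y - real_of_int \<lfloor>y\<rfloor>\<bar> = y - \<lfloor>y\<rfloor>" "\<bar>y - real_of_int (\<lfloor>y\<rfloor> + 1)\<bar> = \<lfloor>y\<rfloor> + 1 - y"
      "y - \<lfloor>y\<rfloor> \<le> 1" "\<lfloor>y\<rfloor> + 1 - y \<le> 1" by linarith+
    then show ?thesis unfolding tent_def fst_conv snd_conv y_def[symmetric] by (simp add: max_def)
  qed
  finally show ?thesis .
qed

lemma integrable_bounded_support:
  fixes f :: "real \<Rightarrow> real"
  assumes [measurable]: "f \<in> borel_measurable borel"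
    and supp: "\<And>x. R < \<bar>x\<bar> \<Longrightarrow> f x = 0" and bnd: "\<And>x. \<bar>f x\<bar> \<le> B"
  shows "integrable (to_measure \<mu>) f"
proof (rule integrableI_bounded_set[where A="{-R..R}" and B=B])
  show "emeasure (to_measure \<mu>) {- R..R} < \<infinity>" by (rule emeasure_to_measure_bounded) auto
  show "AE x in to_measure \<mu>. x \<in> {- R..R} \<longrightarrow> norm (f x) \<le> B" using bnd by auto
  show "AE x in to_measure \<mu>. x \<notin> {- R..R} \<longrightarrow> f x = 0" using supp by (auto intro!: AE_I2)
qed auto

lemma integrable_tent: "integrable (to_measure \<mu>) (tent p)"
proof (rule integrable_bounded_support[where R="1 + \<bar>real_of_int (snd p)\<bar>" and B=1])
  show "tent p x = 0" if "1 + \<bar>real_of_int (snd p)\<bar> < \<bar>x\<bar>" for x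
  proof -
    have "\<bar>x\<bar> \<le> \<bar>real (Suc (fst p)) * x\<bar>" by (simp add: abs_mult mult_le_cancel_right1)
    with that have "1 \<le> \<bar>real (Suc (fst p)) * x - real_of_int (snd p)\<bar>" by linarith
    then show ?thesis using tent_pos_iff[of p x] by auto
  qed
qed (auto simp: tent_nonneg tent_le_1 intro: borel_measurable_continuous_onI continuous_tent)

text \<open>Uniform continuity bounds the distance of \<open>f\<close> to its tent interpolant
  \<open>F\<close> by \<open>\<epsilon>\<close> times a finite sum of tents, so the error of the
  integral is \<open>\<epsilon>\<close> times a tent mass. Fixing those finitely many coordinates up
  to \<open>\<delta>\<close> controls both the integral of \<open>F\<close> and this error.\<close>

lemma vague_nbhd:
  fixes f :: "real \<Rightarrow> real"
  assumes cont: "continuous_on UNIV f" and comp: "compact (closure {x. f x \<noteq> 0})"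
    and U: "open U" "integral\<^sup>L (to_measure \<mu>0) f \<in> U"
  shows "\<exists>V. open V \<and> (\<lambda>p. integral\<^sup>L (to_measure \<mu>0) (tent p)) \<in> V \<and>
     (\<forall>\<mu>. (\<lambda>p. integral\<^sup>L (to_measure \<mu>) (tent p)) \<in> V \<longrightarrow> integral\<^sup>L (to_measure \<mu>) f \<in> U)"
proof -
  define E where "E = (\<lambda>\<mu> p. integral\<^sup>L (to_measure \<mu>) (tent p))"
  have "bounded {x. f x \<noteq> 0}"
    by (rule bounded_subset[OF compact_imp_bounded[OF comp] closure_subset])
  then obtain R0 where R0: "\<And>x. f x \<noteq> 0 \<Longrightarrow> \<bar>x\<bar> \<le> R0"
    by (auto simp: bounded_iff)
  obtain R :: nat where R: "R0 < R" using reals_Archimedean2 by blast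
  have supp: "f x = 0" if "real R \<le> \<bar>x\<bar>" for x using R0[of x] R that by auto
  have "compact (f ` {-real R..real R})"
    using cont by (intro compact_continuous_image continuous_on_subset[OF cont]) auto
  then obtain B where B0: "\<forall>y\<in>f ` {-real R..real R}. \<bar>y\<bar> \<le> B"
    by (metis bounded_iff compact_imp_bounded real_norm_def)
  have B: "\<bar>f x\<bar> \<le> \<bar>B\<bar>" for x
  proof (cases "\<bar>x\<bar> \<le> R")
    case True
    then have "x \<in> {-real R..real R}" by auto
    then have "f x \<in> f ` {-real R..real R}" by (rule imageI)
    then have "\<bar>f x\<bar> \<le> B" using B0 by blast
    then show ?thesis by linarith
  next
    case False
    then show ?thesis using supp[of x] by auto
  qed
  have [measurable]: "f \<in> borel_measurable borel" by (rule borel_measurable_continuous_onI[OF cont])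
  have int_f: "integrable (to_measure \<mu>) f" for \<mu>
    by (rule integrable_bounded_support[where R="real R" and B="\<bar>B\<bar>"]) (auto simp: supp B)
  obtain \<eta> where \<eta>: "0 < \<eta>" "\<And>y. \<bar>y - integral\<^sup>L (to_measure \<mu>0) f\<bar> < \<eta> \<Longrightarrow> y \<in> U"
    using U(1)[unfolded open_dist, rule_format, OF U(2)] unfolding dist_real_def by blast
  define m0 where "m0 = measure (to_measure \<mu>0) {-real (R+2)..real (R+2)}"
  \<comment> \<open>The tent masses are at most \<open>m0\<close> for \<open>\<mu>0\<close> and will
    be at most \<open>m0 + 1\<close> for \<open>\<mu>\<close>, together \<open>2 * m0 + 1\<close>.
    The other half of \<open>\<eta>\<close> is kept for the interpolants.\<close>
  define \<epsilon> where "\<epsilon> = \<eta> / (2 * (2 * m0 + 1))"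
  have m0: "0 \<le> m0" by (simp add: m0_def)
  have \<epsilon>: "0 < \<epsilon>" "\<epsilon> * (2 * m0 + 1) = \<eta> / 2" using \<eta> m0 by (auto simp: \<epsilon>_def field_simps)
  have "uniformly_continuous_on {-real (R+1)..real (R+1)} f"
    by (intro compact_uniformly_continuous continuous_on_subset[OF cont]) auto
  then obtain d where d: "0 < d"
    "\<And>x y. x \<in> {-real (R+1)..real (R+1)} \<Longrightarrow> y \<in> {-real (R+1)..real (R+1)} \<Longrightarrow> \<bar>x - y\<bar> < d \<Longrightarrow> \<bar>f x - f y\<bar> < \<epsilon>"
    using \<open>0 < \<epsilon>\<close> unfolding uniformly_continuous_on_def dist_real_def
    by (metis abs_minus_commute)
  have d': "\<bar>f x - f y\<bar> \<le> \<epsilon>" if "\<bar>x - y\<bar> < min d 1" for x y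
  proof (cases "\<bar>x\<bar> \<le> real (R+1) \<and> \<bar>y\<bar> \<le> real (R+1)")
    case True
    then have "x \<in> {-real (R+1)..real (R+1)}" "y \<in> {-real (R+1)..real (R+1)}" by auto
    then show ?thesis using d(2)[of x y] that by auto
  next
    case False
    then have "real R \<le> \<bar>x\<bar>" "real R \<le> \<bar>y\<bar>" using that by auto
    then show ?thesis using supp \<epsilon> by auto
  qed
  obtain n :: nat where n: "1 / real (Suc n) < min d 1"
    using d(1) by (metis min_less_iff_conj nat_approx_posE zero_less_one)
  define N where "N = real (Suc n)"
  have N: "0 < N" "1 \<le> N" by (auto simp: N_def)
  define m where "m = R * Suc n"
  define J where "J = {- int m - 1..int m + 1}"
  have fJ: "finite J" by (simp add: J_def)
  have tent_close: "\<bar>x - real_of_int j / N\<bar> < min d 1" if "tent (n, j) x \<noteq> 0" for j x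
  proof -
    have "\<bar>N * x - j\<bar> < 1" using that by (simp add: tent_pos_iff N_def)
    moreover have "N * x - j = N * (x - j / N)" using N by (simp add: field_simps)
    ultimately have "N * \<bar>x - j / N\<bar> < 1" using N by (simp add: abs_mult)
    then have "\<bar>x - j / N\<bar> < 1 / N" using N by (simp add: field_simps)
    then show ?thesis using n unfolding N_def by (rule less_trans)
  qed
  define F where "F = (\<lambda>x. \<Sum>j\<in>J. f (j / N) * tent (n, j) x)"
  have approx: "\<bar>f x - F x\<bar> \<le> \<epsilon> * (\<Sum>j\<in>J. tent (n, j) x)" for x
  proof -
    \<comment> \<open>On [-R, R] the tents sum to 1; outside, \<open>f\<close> is 0, so the identity
      survives where they do not.\<close>
    have "f x = (\<Sum>j\<in>J. f x * tent (n, j) x)"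
    proof (cases "\<bar>x\<bar> \<le> R")
      case True
      have "\<bar>real (Suc n) * x\<bar> = real (Suc n) * \<bar>x\<bar>" by (simp only: abs_mult abs_of_nat)
      also have "\<dots> \<le> real (Suc n) * real R" using True by (rule mult_left_mono) simp
      also have "\<dots> = real m" by (simp only: m_def of_nat_mult mult.commute[of "real R"])
      finally have "\<bar>real (Suc n) * x\<bar> \<le> real m" .
      from sum_tent[OF this] show ?thesis by (simp add: sum_distrib_left[symmetric] J_def)
    next
      case False then show ?thesis using supp[of x] by simp
    qed
    then have "f x - F x = (\<Sum>j\<in>J. (f x - f (j / N)) * tent (n, j) x)"
      by (simp add: F_def sum_subtractf left_diff_distrib)
    also have "\<bar>\<dots>\<bar> \<le> (\<Sum>j\<in>J. \<bar>(f x - f (j / N)) * tent (n, j) x\<bar>)" by (rule sum_abs)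
    also have "\<dots> \<le> (\<Sum>j\<in>J. \<epsilon> * tent (n, j) x)"
    proof (rule sum_mono)
      fix j assume "j \<in> J"
      show "\<bar>(f x - f (real_of_int j / N)) * tent (n, j) x\<bar> \<le> \<epsilon> * tent (n, j) x"
        using d'[OF tent_close[of j x]] tent_nonneg[of "(n,j)" x]
        by (cases "tent (n, j) x = 0") (auto simp: abs_mult intro!: mult_right_mono)
    qed
    finally show ?thesis by (simp add: sum_distrib_left)
  qed
  have int_F: "integral\<^sup>L (to_measure \<mu>) F = (\<Sum>j\<in>J. f (j / N) * E \<mu> (n, j))" "integrable (to_measure \<mu>) F" for \<mu>
    unfolding F_def E_def by (auto simp: integrable_tent)
  have close: "\<bar>integral\<^sup>L (to_measure \<mu>) f - integral\<^sup>L (to_measure \<mu>) F\<bar> \<le> \<epsilon> * (\<Sum>j\<in>J. E \<mu> (n, j))" for \<mu>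
  proof -
    have "\<bar>integral\<^sup>L (to_measure \<mu>) f - integral\<^sup>L (to_measure \<mu>) F\<bar> = \<bar>\<integral>x. f x - F x \<partial>to_measure \<mu>\<bar>"
      using int_f int_F by simp
    also have "\<dots> \<le> (\<integral>x. \<bar>f x - F x\<bar> \<partial>to_measure \<mu>)" by (rule integral_abs_bound)
    also have "\<dots> \<le> (\<integral>x. \<epsilon> * (\<Sum>j\<in>J. tent (n, j) x) \<partial>to_measure \<mu>)"
      using int_f int_F approx by (intro integral_mono) (auto simp: integrable_tent)
    also have "\<dots> = \<epsilon> * (\<Sum>j\<in>J. E \<mu> (n, j))" by (simp add: E_def integrable_tent)
    finally show ?thesis .
  qed
  have S0: "(\<Sum>j\<in>J. E \<mu>0 (n, j)) \<le> m0"
  proof -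
    have "(\<Sum>j\<in>J. E \<mu>0 (n, j)) = (\<integral>x. (\<Sum>j\<in>J. tent (n, j) x) \<partial>to_measure \<mu>0)"
      by (simp add: E_def integrable_tent)
    also have "\<dots> \<le> (\<integral>x. indicator {-real (R+2)..real (R+2)} x \<partial>to_measure \<mu>0)"
    proof (rule integral_mono)
      show "integrable (to_measure \<mu>0) (indicat_real {- real (R + 2)..real (R + 2)})"
        using emeasure_to_measure_bounded[of "{- real (R + 2)..real (R + 2)}" \<mu>0] by simp
      fix x
      obtain k :: nat where k: "\<bar>N * x\<bar> < k" using reals_Archimedean2 by blast
      have "(\<Sum>j\<in>J. tent (n, j) x) \<le> (\<Sum>j\<in>{- int (m + k) - 1..int (m + k) + 1}. tent (n, j) x)"
        by (rule sum_mono2) (auto simp: J_def tent_nonneg)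
      also have "\<dots> = 1" using k by (intro sum_tent) (auto simp: N_def)
      finally have le1: "(\<Sum>j\<in>J. tent (n, j) x) \<le> 1" .
      have "(\<Sum>j\<in>J. tent (n, j) x) = 0" if "x \<notin> {-real (R+2)..real (R+2)}"
      proof (rule sum.neutral, rule ballI)
        fix j assume "j \<in> J"
        then have "\<bar>j\<bar> \<le> int m + 1" by (auto simp: J_def)
        then have "\<bar>real_of_int j\<bar> \<le> real m + 1" by linarith
        moreover have "real m = R * N" by (simp add: m_def N_def algebra_simps)
        ultimately have "\<bar>real_of_int j / N\<bar> \<le> R + 1 / N" using N by (simp add: field_simps)
        moreover have "1 / N \<le> 1" using N by simp
        moreover have "real (R + 2) < \<bar>x\<bar>" using that by auto
        ultimately have "\<not> \<bar>x - real_of_int j / N\<bar> < 1" by linarith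
        then have "\<not> \<bar>x - real_of_int j / N\<bar> < min d 1" by simp
        then show "tent (n, j) x = 0" using tent_close by blast
      qed
      then show "(\<Sum>j\<in>J. tent (n, j) x) \<le> indicator {-real (R+2)..real (R+2)} x"
        using le1 by (auto simp: indicator_def)
    qed (auto simp: integrable_tent)
    also have "\<dots> = m0" by (simp add: m0_def)
    finally show ?thesis .
  qed
  define c where "c = real (card J)"
  have "0 < c" by (auto simp: c_def J_def card_gt_0_iff)
  \<comment> \<open>The first bound lets the \<open>c\<close> tent masses change by at most 1 in
    total, the second moves the integral of \<open>F\<close> by at most \<open>\<eta> / 4\<close>;
    the \<open>+ 1\<close> covers \<open>B = 0\<close>.\<close>
  define \<delta> where "\<delta> = min (1 / c) (\<eta> / (4 * c * (\<bar>B\<bar> + 1)))"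
  have \<delta>: "0 < \<delta>" "c * \<delta> \<le> 1" "\<bar>B\<bar> * (c * \<delta>) < \<eta> / 2"
  proof -
    show "0 < \<delta>" using \<open>0 < c\<close> \<eta> by (simp add: \<delta>_def add_nonneg_pos)
    have "c * \<delta> \<le> c * (1 / c)" using \<open>0 < c\<close> by (intro mult_left_mono) (auto simp: \<delta>_def)
    then show "c * \<delta> \<le> 1" using \<open>0 < c\<close> by simp
    have "c * \<delta> \<le> c * (\<eta> / (4 * c * (\<bar>B\<bar> + 1)))" using \<open>0 < c\<close> by (intro mult_left_mono) (auto simp: \<delta>_def)
    also have "\<dots> = \<eta> / (4 * (\<bar>B\<bar> + 1))" using \<open>0 < c\<close> by simp
    finally have "(\<bar>B\<bar> + 1) * (c * \<delta>) \<le> (\<bar>B\<bar> + 1) * (\<eta> / (4 * (\<bar>B\<bar> + 1)))" by (intro mult_left_mono) auto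
    also have "\<dots> = \<eta> / 4 * ((\<bar>B\<bar> + 1) / (\<bar>B\<bar> + 1))" by (simp del: divide_self_if add: field_simps)
    also have "\<dots> = \<eta> / 4" by (subst divide_self) (auto simp: add_nonneg_eq_0_iff)
    finally have "(\<bar>B\<bar> + 1) * (c * \<delta>) \<le> \<eta> / 4" .
    moreover have "0 \<le> c * \<delta>" using \<open>0 < c\<close> \<open>0 < \<delta>\<close> by simp
    ultimately show "\<bar>B\<bar> * (c * \<delta>) < \<eta> / 2" using \<eta> by (simp add: algebra_simps)
  qed
  define V where "V = (\<Inter>j\<in>J. (\<lambda>x. x (n, j)) -` {E \<mu>0 (n, j) - \<delta><..<E \<mu>0 (n, j) + \<delta>})"
  have "open V" unfolding V_def using fJ
    by (intro open_INT ballI open_vimage continuous_on_product_coordinates) auto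
  moreover have "E \<mu>0 \<in> V" using \<delta> by (auto simp: V_def)
  moreover have "integral\<^sup>L (to_measure \<mu>) f \<in> U" if "E \<mu> \<in> V" for \<mu>
  proof (rule \<eta>(2))
    have diff: "\<bar>E \<mu> (n, j) - E \<mu>0 (n, j)\<bar> \<le> \<delta>" if "j \<in> J" for j
      using \<open>E \<mu> \<in> V\<close> that by (auto simp: V_def abs_le_iff less_imp_le algebra_simps)
    have "(\<Sum>j\<in>J. E \<mu> (n, j)) - (\<Sum>j\<in>J. E \<mu>0 (n, j)) = (\<Sum>j\<in>J. E \<mu> (n, j) - E \<mu>0 (n, j))"
      by (simp add: sum_subtractf)
    also have "\<dots> \<le> (\<Sum>j\<in>J. \<delta>)" by (rule sum_mono) (use diff abs_le_D1 in blast)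
    also have "\<dots> = c * \<delta>" by (simp add: c_def)
    finally have S1: "(\<Sum>j\<in>J. E \<mu> (n, j)) \<le> m0 + 1" using S0 \<delta> by linarith
    have "\<bar>integral\<^sup>L (to_measure \<mu>) F - integral\<^sup>L (to_measure \<mu>0) F\<bar>
      = \<bar>\<Sum>j\<in>J. f (j / N) * (E \<mu> (n, j) - E \<mu>0 (n, j))\<bar>"
      by (simp add: int_F sum_subtractf right_diff_distrib)
    also have "\<dots> \<le> (\<Sum>j\<in>J. \<bar>f (j / N) * (E \<mu> (n, j) - E \<mu>0 (n, j))\<bar>)" by (rule sum_abs)
    also have "\<dots> \<le> (\<Sum>j\<in>J. \<bar>B\<bar> * \<delta>)"
      by (rule sum_mono) (auto simp: abs_mult intro!: mult_mono B diff)
    also have "\<dots> = \<bar>B\<bar> * (c * \<delta>)" by (simp add: c_def)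
    finally have 1: "\<bar>integral\<^sup>L (to_measure \<mu>) F - integral\<^sup>L (to_measure \<mu>0) F\<bar> < \<eta> / 2" using \<delta> by linarith
    have 2: "\<epsilon> * (\<Sum>j\<in>J. E \<mu> (n, j)) + \<epsilon> * (\<Sum>j\<in>J. E \<mu>0 (n, j)) \<le> \<epsilon> * (2 * m0 + 1)"
      using \<epsilon> S0 S1 by (simp add: distrib_left[symmetric])
    show "\<bar>integral\<^sup>L (to_measure \<mu>) f - integral\<^sup>L (to_measure \<mu>0) f\<bar> < \<eta>"
      using close[of \<mu>] close[of \<mu>0] 1 2 \<epsilon>(2) by linarith
  qed
  ultimately show ?thesis unfolding E_def by blast
qed

text \<open>The preimages of open sets of the product contain the subbasis by
  \<open>vague_nbhd\<close> and are stable under unions and finite intersections. Since the product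
  is countable, Borel measurability into the space of measures can be checked on
  coordinates.\<close>

lemma vague_open_eq_vimage:
  assumes "open (W :: locfin_measure set)"
  shows "\<exists>V. open V \<and> W = (\<lambda>\<mu> p. integral\<^sup>L (to_measure \<mu>) (tent p)) -` V"
proof -
  define E where "E = (\<lambda>\<mu> p. integral\<^sup>L (to_measure \<mu>) (tent p))"
  from assms have "\<exists>V. open V \<and> E -` V = W"
    unfolding open_locfin_measure_def
  proof (induction rule: generate_topology.induct)
    case UNIV
    show ?case by (intro exI[of _ UNIV]) auto
  next
    case (Int a b)
    then obtain A B where "open A" "E -` A = a" "open B" "E -` B = b" by blast
    then show ?case by (intro exI[of _ "A \<inter> B"]) auto
  next
    case (UN K)
    show ?case
    proof (intro exI conjI)
      show "open (\<Union>{V. open V \<and> E -` V \<in> K})" by (rule open_Union) simp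
      show "E -` \<Union>{V. open V \<and> E -` V \<in> K} = \<Union>K"
      proof (intro equalityI subsetI)
        fix x assume "x \<in> \<Union>K"
        then obtain k where k: "k \<in> K" "x \<in> k" by blast
        from UN(2)[OF k(1)] obtain V where "open V" "E -` V = k" by blast
        with k show "x \<in> E -` \<Union>{V. open V \<and> E -` V \<in> K}" by auto
      qed auto
    qed
  next
    case (Basis s)
    then obtain f :: "real \<Rightarrow> real" and U where s: "s = {\<mu>. integral\<^sup>L (to_measure \<mu>) f \<in> U}"
      and f: "continuous_on UNIV f" "compact (closure {x. f x \<noteq> 0})" and U: "open U" by blast
    show ?case
    proof (intro exI conjI)
      show "open (\<Union>{V. open V \<and> E -` V \<subseteq> s})" by (rule open_Union) simp
      show "E -` \<Union>{V. open V \<and> E -` V \<subseteq> s} = s"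
      proof (intro equalityI subsetI)
        fix \<mu> assume "\<mu> \<in> s"
        then have "integral\<^sup>L (to_measure \<mu>) f \<in> U" by (simp add: s)
        from vague_nbhd[OF f U this] obtain V where "open V" "E \<mu> \<in> V" "E -` V \<subseteq> s"
          unfolding s E_def by auto
        then show "\<mu> \<in> E -` \<Union>{V. open V \<and> E -` V \<subseteq> s}" by auto
      qed auto
    qed
  qed
  then show ?thesis unfolding E_def by (metis (no_types))
qed

section \<open>Measurability criteria for maps into and out of the space of measures\<close>

lemma measurable_locfin_tent:
  assumes "\<And>p. (\<lambda>w. integral\<^sup>L (to_measure (g w)) (tent p)) \<in> borel_measurable N"
  shows "g \<in> borel_measurable N"
proof (rule borel_measurableI)
  fix W :: "locfin_measure set" assume "open W"
  then obtain V where V: "open V" "W = (\<lambda>\<mu> p. integral\<^sup>L (to_measure \<mu>) (tent p)) -` V"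
    using vague_open_eq_vimage by blast
  have "(\<lambda>w p. integral\<^sup>L (to_measure (g w)) (tent p)) \<in> borel_measurable N"
    by (rule measurable_coordinatewise_then_product) (rule assms)
  from measurable_sets[OF this borel_open[OF V(1)]]
  show "g -` W \<inter> space N \<in> sets N"
    unfolding V(2) by (simp add: vimage_def)
qed

text \<open>Dynkin induction inside a bounded window, where all masses are finite and complements
  can be subtracted; the windows then increase to the whole line.\<close>

lemma measurable_emeasure_of_Ioc:
  assumes "\<And>a b. (\<lambda>w. emeasure (to_measure (g w)) {a<..b}) \<in> borel_measurable N"
    and A: "A \<in> sets borel"
  shows "(\<lambda>w. emeasure (to_measure (g w)) A) \<in> borel_measurable N"
proof -
  have Ioc: "sets (borel :: real measure) = sigma_sets UNIV (range (\<lambda>(a, b). {a<..b}))"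
    by (simp add: borel_sigma_sets_Ioc)
  define I where "I = (\<lambda>n::nat. {-real n<..real n})"
  have I_fin: "emeasure (to_measure (g w)) (X \<inter> I n) \<noteq> \<infinity>" if "X \<in> sets borel" for w X n
    using emeasure_to_measure_bounded[of "X \<inter> I n" "g w"] that
    bounded_subset[of "I n" "X \<inter> I n"] by (auto simp: I_def)
  have win: "(\<lambda>w. emeasure (to_measure (g w)) (A \<inter> I n)) \<in> borel_measurable N" for n
  proof -
    have "Int_stable (range (\<lambda>(a, b). {a<..b::real}))" "range (\<lambda>(a, b). {a<..b::real}) \<subseteq> Pow UNIV"
      "A \<in> sigma_sets UNIV (range (\<lambda>(a, b). {a<..b::real}))"
      using A unfolding Ioc by (auto simp: Int_stable_def)
    then show ?thesis
    proof (induction rule: sigma_sets_induct_disjoint)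
      case (basic A)
      then obtain a b where "A = {a<..b}" by (auto simp: image_iff)
      then have "A \<inter> I n = {max a (- real n)<..min b (real n)}" by (auto simp: I_def)
      then show ?case using assms(1) by simp
    next
      case empty then show ?case by simp
    next
      case (compl A)
      have [measurable]: "A \<in> sets borel" using compl(1) unfolding Ioc .
      have "emeasure (to_measure (g w)) ((UNIV - A) \<inter> I n) =
        emeasure (to_measure (g w)) (I n) - emeasure (to_measure (g w)) (A \<inter> I n)" for w
        using I_fin[of A w n]
        by (subst emeasure_Diff[symmetric]) (auto simp: I_def intro!: arg_cong[where f="emeasure _"])
      moreover have "(\<lambda>w. emeasure (to_measure (g w)) (I n)) \<in> borel_measurable N"
        unfolding I_def by (rule assms(1))
      ultimately show ?case using compl by simp
    next
      case (union A)
      have [measurable]: "A i \<in> sets borel" for i using union(2) unfolding Ioc by blast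
      have "emeasure (to_measure (g w)) (\<Union>(range A) \<inter> I n) = (\<Sum>i. emeasure (to_measure (g w)) (A i \<inter> I n))" for w
        using union(1) by (subst suminf_emeasure) (auto simp: disjoint_family_on_def I_def)
      then show ?case using union by simp
    qed
  qed
  have "emeasure (to_measure (g w)) A = (SUP n. emeasure (to_measure (g w)) (A \<inter> I n))" for w
  proof -
    have "(\<Union>n. A \<inter> I n) = A"
    proof safe
      fix x assume "x \<in> A"
      obtain n :: nat where "\<bar>x\<bar> < n" using reals_Archimedean2 by blast
      then show "x \<in> (\<Union>n. A \<inter> I n)" using \<open>x \<in> A\<close> by (auto simp: I_def intro!: exI[of _ n])
    qed
    moreover have "(SUP n. emeasure (to_measure (g w)) (A \<inter> I n)) = emeasure (to_measure (g w)) (\<Union>n. A \<inter> I n)"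
      using A by (intro SUP_emeasure_incseq) (auto simp: I_def incseq_def)
    ultimately show ?thesis by simp
  qed
  then show ?thesis using win by simp
qed

text \<open>Interval masses give all masses, these give the integrals of tents by monotone
  approximation, and tents generate the vague topology. This is the working criterion for maps into
  this space.\<close>

lemma measurable_locfinI:
  assumes "\<And>a b. (\<lambda>w. emeasure (to_measure (g w)) {a<..b}) \<in> borel_measurable N"
  shows "g \<in> borel_measurable N"
proof (rule measurable_locfin_tent)
  fix p
  have [measurable]: "(\<lambda>w. emeasure (to_measure (g w)) A) \<in> borel_measurable N" if "A \<in> sets borel" for A
    using measurable_emeasure_of_Ioc[OF assms that] .
  have nn: "(\<lambda>w. \<integral>\<^sup>+x. u x \<partial>to_measure (g w)) \<in> borel_measurable N" if "u \<in> borel_measurable borel" for u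
    using that
  proof (induction rule: borel_measurable_induct)
    case (cong f g)
    then show ?case by (simp cong: nn_integral_cong)
  next
    case (set A) then show ?case by simp
  next
    case (mult u c) then show ?case by (simp add: nn_integral_cmult)
  next
    case (add u v) then show ?case by (simp add: nn_integral_add)
  next
    case (seq U)
    then have "(\<integral>\<^sup>+x. (SUP i. U i) x \<partial>to_measure (g w)) = (SUP i. \<integral>\<^sup>+x. U i x \<partial>to_measure (g w))" for w
      by (simp add: nn_integral_monotone_convergence_SUP image_comp)
    then show ?case using seq by simp
  qed
  have "integral\<^sup>L (to_measure (g w)) (tent p) = enn2real (\<integral>\<^sup>+x. ennreal (tent p x) \<partial>to_measure (g w))" for w
    by (rule integral_eq_nn_integral) (use integrable_tent tent_nonneg in auto)
  moreover have "(\<lambda>x. ennreal (tent p x)) \<in> borel_measurable borel"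
    using borel_measurable_continuous_onI[OF continuous_tent, of p] by measurable
  ultimately show "(\<lambda>w. integral\<^sup>L (to_measure (g w)) (tent p)) \<in> borel_measurable N"
    using nn by simp
qed

text \<open>The integrals of the compactly supported continuous \<open>f n\<close> are vaguely
  continuous, and the \<open>f n\<close> increase to the indicator. Half-open intervals are not
  reached by increasing continuous functions, so they follow as differences.\<close>

lemma measurable_emeasure_Ioo: "(\<lambda>\<mu>. emeasure (to_measure \<mu>) {a<..<b}) \<in> borel_measurable borel"
proof (cases "a < b")
  case True
  define f where "f = (\<lambda>(n::nat) x::real. min 1 (real n * max 0 (min (x - a) (b - x))))"
  have cont: "continuous_on UNIV (f n)" for n unfolding f_def by (intro continuous_intros)
  have f01: "0 \<le> f n x" "f n x \<le> 1" for n x by (auto simp: f_def)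
  have [measurable]: "f n \<in> borel_measurable borel" for n by (rule borel_measurable_continuous_onI[OF cont])
  have supp: "x \<in> {a..b}" if "f n x \<noteq> 0" for n x
  proof (rule ccontr)
    assume "x \<notin> {a..b}"
    then have "max 0 (min (x - a) (b - x)) = 0" by auto
    with that show False by (simp add: f_def)
  qed
  have meas: "(\<lambda>\<mu>. integral\<^sup>L (to_measure \<mu>) (f n)) \<in> borel_measurable borel" for n
  proof (rule borel_measurableI)
    fix U :: "real set" assume "open U"
    have "bounded {x. f n x \<noteq> 0}" using supp by (intro bounded_subset[OF bounded_closed_interval[of a b]]) auto
    then have "compact (closure {x. f n x \<noteq> 0})" by simp
    with \<open>open U\<close> cont[of n] have "open {\<mu>. integral\<^sup>L (to_measure \<mu>) (f n) \<in> U}"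
      unfolding open_locfin_measure_def by (intro generate_topology.Basis) blast
    then show "(\<lambda>\<mu>. integral\<^sup>L (to_measure \<mu>) (f n)) -` U \<inter> space borel \<in> sets borel"
      by (simp add: vimage_def)
  qed
  have int: "integrable (to_measure \<mu>) (f n)" for \<mu> n
  proof (rule integrable_bounded_support[where R="\<bar>a\<bar> + \<bar>b\<bar>" and B=1])
    fix x assume "\<bar>a\<bar> + \<bar>b\<bar> < \<bar>x\<bar>"
    then have "x \<notin> {a..b}" by auto
    then show "f n x = 0" using supp by blast
  qed (auto simp: f01)
  have inc: "f n x \<le> f m x" if "n \<le> m" for n m x
    unfolding f_def using that by (intro min.mono mult_right_mono) auto
  have sup: "(SUP n. ennreal (f n x)) = indicator {a<..<b} x" for x
  proof (cases "x \<in> {a<..<b}")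
    case x: True
    define e where "e = min (x - a) (b - x)"
    have e: "0 < e" using x by (auto simp: e_def)
    obtain k :: nat where "1 / e < k" using reals_Archimedean2 by blast
    then have "1 \<le> real k * e" using e by (simp add: field_simps)
    then have "f k x = 1" using e by (simp add: f_def e_def[symmetric])
    then have "ennreal 1 \<le> (SUP n. ennreal (f n x))" by (metis SUP_upper UNIV_I)
    moreover have "(SUP n. ennreal (f n x)) \<le> 1" using f01 by (intro SUP_least) simp
    ultimately show ?thesis using x by simp
  next
    case False
    then have "max 0 (min (x - a) (b - x)) = 0" by auto
    then have "f n x = 0" for n by (simp add: f_def)
    then show ?thesis using False by simp
  qed
  have "emeasure (to_measure \<mu>) {a<..<b} = (SUP n. ennreal (integral\<^sup>L (to_measure \<mu>) (f n)))" for \<mu>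
  proof -
    have "emeasure (to_measure \<mu>) {a<..<b} = (\<integral>\<^sup>+x. (SUP n. ennreal (f n x)) \<partial>to_measure \<mu>)"
      by (simp add: sup)
    also have "\<dots> = (SUP n. \<integral>\<^sup>+x. ennreal (f n x) \<partial>to_measure \<mu>)"
      by (rule nn_integral_monotone_convergence_SUP) (auto simp: incseq_def le_fun_def inc f01)
    also have "\<dots> = (SUP n. ennreal (integral\<^sup>L (to_measure \<mu>) (f n)))"
      using int f01 by (intro SUP_cong refl nn_integral_eq_integral) auto
    finally show ?thesis .
  qed
  then show ?thesis using meas by simp
qed simp

lemma measurable_emeasure_locfin [measurable]:
  assumes "A \<in> sets borel"
  shows "(\<lambda>\<mu>. emeasure (to_measure \<mu>) A) \<in> borel_measurable borel"
proof (rule measurable_emeasure_of_Ioc[OF _ assms])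
  fix a b :: real
  show "(\<lambda>\<mu>. emeasure (to_measure \<mu>) {a<..b}) \<in> borel_measurable borel"
  proof (cases "a < b")
    case True
    \<comment> \<open>Any point beyond \<open>b\<close> would do in place of \<open>b + 1\<close>:
      both open intervals stay bounded and the difference is one of finite masses.\<close>
    have "emeasure (to_measure \<mu>) {a<..b} = emeasure (to_measure \<mu>) {a<..<b+1} - emeasure (to_measure \<mu>) {b<..<b+1}" for \<mu>
    proof -
      have "emeasure (to_measure \<mu>) {b<..<b+1} \<noteq> \<infinity>"
        using emeasure_to_measure_bounded[of "{b<..<b+1}" \<mu>] by auto
      then show ?thesis using True
        by (subst emeasure_Diff[symmetric]) (auto intro!: arg_cong[where f="emeasure _"])
    qed
    then show ?thesis using measurable_emeasure_Ioo by simp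
  qed simp
qed

text \<open>The library proves measurability of integrals against kernels only for subprobabilities, so
  the window \<open>[-n, n]\<close> is normalised to total mass below 1.\<close>

lemma measurable_nn_integral_locfin [measurable (raw)]:
  assumes [measurable]: "g \<in> borel_measurable N"
    and F[measurable]: "case_prod F \<in> borel_measurable (N \<Otimes>\<^sub>M borel)"
  shows "(\<lambda>w. \<integral>\<^sup>+y. F w y \<partial>to_measure (g w)) \<in> borel_measurable N"
proof -
  define I where "I = (\<lambda>n::nat. {-real n..real n})"
  have [measurable]: "I n \<in> sets borel" for n by (simp add: I_def)
  define c where "c = (\<lambda>n w. 1 + emeasure (to_measure (g w)) (I n))"
  have [measurable]: "c n \<in> borel_measurable N" for n unfolding c_def by measurable
  have c: "c n w \<noteq> 0" "c n w \<noteq> \<infinity>" for n w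
    using emeasure_to_measure_bounded[of "I n" "g w"] by (auto simp: c_def I_def)
  define k where "k = (\<lambda>n w. density (to_measure (g w)) (\<lambda>y. indicator (I n) y / c n w))"
  have emk: "emeasure (k n w) A = emeasure (to_measure (g w)) (A \<inter> I n) / c n w"
    if [measurable]: "A \<in> sets borel" for n w A
  proof -
    have "emeasure (k n w) A = (\<integral>\<^sup>+y. indicator (A \<inter> I n) y / c n w \<partial>to_measure (g w))"
      unfolding k_def by (subst emeasure_density) (auto intro!: nn_integral_cong simp: indicator_def)
    then show ?thesis by (simp add: nn_integral_divide)
  qed
  have space_k: "space (k n w) = UNIV" for n w by (simp add: k_def)
  have k[measurable]: "k n \<in> measurable N (subprob_algebra borel)" for n
  proof (rule measurable_subprob_algebra)
    show "subprob_space (k n w)" for w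
    proof
      have "emeasure (to_measure (g w)) (I n) / c n w \<le> c n w / c n w"
        by (intro divide_right_mono_ennreal) (simp add: c_def)
      also have "\<dots> = 1" using c[of n w] by (simp add: ennreal_divide_self top.not_eq_extremum zero_less_iff_neq_zero)
      finally show "emeasure (k n w) (space (k n w)) \<le> 1" by (simp add: emk space_k)
    qed (simp add: k_def)
    show "sets (k n w) = sets borel" for w by (simp add: k_def)
    show "(\<lambda>w. emeasure (k n w) A) \<in> borel_measurable N" if [measurable]: "A \<in> sets borel" for A
      by (subst emk[OF that]) measurable
  qed
  have kF: "(\<lambda>w. c n w * (\<integral>\<^sup>+y. F w y \<partial>k n w)) \<in> borel_measurable N" for n
    by (intro borel_measurable_times_ennreal nn_integral_measurable_subprob_algebra2[OF F k]) simp
  have "(\<integral>\<^sup>+y. F w y \<partial>to_measure (g w)) = (SUP n. c n w * (\<integral>\<^sup>+y. F w y \<partial>k n w))" if w: "w \<in> space N" for w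
  proof -
    have Fw[measurable]: "F w \<in> borel_measurable borel" using measurable_Pair2[OF F w] by simp
    have "c n w * (\<integral>\<^sup>+y. F w y \<partial>k n w) = (\<integral>\<^sup>+y. F w y * indicator (I n) y \<partial>to_measure (g w))" for n
    proof -
      have "(\<integral>\<^sup>+y. F w y \<partial>k n w) = (\<integral>\<^sup>+y. F w y * indicator (I n) y / c n w \<partial>to_measure (g w))"
        unfolding k_def by (subst nn_integral_density) (auto intro!: nn_integral_cong simp: indicator_def divide_ennreal_def mult.commute)
      also have "\<dots> = (\<integral>\<^sup>+y. F w y * indicator (I n) y \<partial>to_measure (g w)) / c n w"
        by (rule nn_integral_divide) simp
      finally show ?thesis using c[of n w]
        by (metis ennreal_mult_divide_eq ennreal_times_divide infinity_ennreal_def mult.commute)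
    qed
    moreover have "(SUP n. \<integral>\<^sup>+y. F w y * indicator (I n) y \<partial>to_measure (g w)) =
      (\<integral>\<^sup>+y. (SUP n. F w y * indicator (I n) y) \<partial>to_measure (g w))"
      by (rule nn_integral_monotone_convergence_SUP[symmetric])
        (auto simp: incseq_def le_fun_def I_def intro!: mult_left_mono split: split_indicator)
    moreover have "(SUP n. F w y * indicator (I n) y) = F w y" for y
    proof (rule antisym)
      show "(SUP n. F w y * indicator (I n) y) \<le> F w y" by (intro SUP_least) (auto split: split_indicator)
      obtain n :: nat where "\<bar>y\<bar> < n" using reals_Archimedean2 by blast
      then have "y \<in> I n" by (auto simp: I_def)
      then have "F w y = F w y * indicator (I n) y" by simp
      also have "\<dots> \<le> (SUP n. F w y * indicator (I n) y)" by (rule SUP_upper) simp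
      finally show "F w y \<le> (SUP n. F w y * indicator (I n) y)" .
    qed
    ultimately show ?thesis by simp
  qed
  then show ?thesis using kF by (simp cong: measurable_cong)
qed

section \<open>Sums, translations, the zero measure and pairings\<close>

lemma measurable_pairing [measurable (raw)]:
  assumes [measurable]: "g \<in> borel_measurable N" "case_prod f \<in> borel_measurable (N \<Otimes>\<^sub>M borel)"
  shows "(\<lambda>w. pairing (g w) (f w)) \<in> borel_measurable N"
  unfolding pairing_def by measurable

lemma measurable_plus_locfin [measurable (raw)]:
  assumes [measurable]: "f \<in> borel_measurable N" "g \<in> borel_measurable N"
  shows "(\<lambda>w. f w + g w :: locfin_measure) \<in> borel_measurable N"
  by (rule measurable_locfinI) (simp add: emeasure_plus_locfin)

lemma nn_integral_translate:
  assumes [measurable]: "f \<in> borel_measurable borel"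
  shows "(\<integral>\<^sup>+y. f y \<partial>to_measure (translate x \<mu>)) = (\<integral>\<^sup>+y. f (y + x) \<partial>to_measure \<mu>)"
  unfolding translate.rep_eq by (subst nn_integral_distr) auto

lemma measurable_translate [measurable (raw)]:
  assumes [measurable]: "x \<in> borel_measurable N" "g \<in> borel_measurable N"
  shows "(\<lambda>w. translate (x w) (g w)) \<in> borel_measurable N"
proof (rule measurable_locfinI)
  fix a b :: real
  have "emeasure (to_measure (translate (x w) (g w))) {a<..b} = (\<integral>\<^sup>+y. indicator {a<..b} (y + x w) \<partial>to_measure (g w))" for w
    using nn_integral_translate[of "indicator {a<..b}" "x w" "g w"] by simp
  then show "(\<lambda>w. emeasure (to_measure (translate (x w) (g w))) {a<..b}) \<in> borel_measurable N"
    by simp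
qed

lemma emeasure_translate_Ioc:
  "emeasure (to_measure (translate x \<mu>)) {a<..b} = emeasure (to_measure \<mu>) {a - x<..b - x}"
proof -
  have "(\<lambda>y. y - x) ` {a<..b} = {a - x<..b - x}" by (auto simp: image_iff intro!: bexI[of _ "_ + x"])
  then show ?thesis by (simp add: emeasure_translate)
qed

lemma translate_translate: "translate x (translate y \<mu>) = translate (x + y) \<mu>"
proof (rule locfin_measure_eqI)
  fix a b :: real
  show "emeasure (to_measure (translate x (translate y \<mu>))) {a<..b} = emeasure (to_measure (translate (x + y) \<mu>)) {a<..b}"
    by (simp add: emeasure_translate_Ioc diff_diff_eq)
qed

lemma translate_0 [simp]: "translate 0 \<mu> = \<mu>"
  by (rule locfin_measure_eqI) (simp add: emeasure_translate_Ioc)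

lemma translate_plus: "translate x (\<mu> + \<nu>) = translate x \<mu> + translate x \<nu>"
  by (rule locfin_measure_eqI) (simp add: emeasure_translate_Ioc emeasure_plus_locfin)

lemma translate_zero [simp]: "translate x 0 = 0"
  by (rule locfin_measure_eqI) (simp add: emeasure_translate_Ioc emeasure_zero_locfin)

lemma translate_eq_0_iff [simp]: "translate x \<mu> = 0 \<longleftrightarrow> \<mu> = 0"
  by (metis add.left_inverse translate_0 translate_translate translate_zero)

lemma locfin_eq_0_iff: "\<mu> = 0 \<longleftrightarrow> emeasure (to_measure \<mu>) UNIV = 0"
proof
  assume *: "emeasure (to_measure \<mu>) UNIV = 0"
  have "emeasure (to_measure \<mu>) A = 0" for A
    using emeasure_mono[of A UNIV "to_measure \<mu>"] * by simp
  then show "\<mu> = 0" by (intro locfin_measure_eqI) (simp add: emeasure_zero_locfin)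
qed (simp add: emeasure_zero_locfin)

lemma sets_zero_locfin [measurable]: "{0 :: locfin_measure} \<in> sets borel"
proof -
  have "{0 :: locfin_measure} = {\<mu> \<in> space borel. emeasure (to_measure \<mu>) UNIV = 0}"
    using locfin_eq_0_iff by auto
  also have "\<dots> \<in> sets borel" by measurable
  finally show ?thesis .
qed

lemma pairing_plus:
  assumes [measurable]: "f \<in> borel_measurable borel"
  shows "pairing (\<mu> + \<nu>) f = pairing \<mu> f + pairing \<nu> f"
proof -
  have "(\<integral>\<^sup>+y. u y \<partial>to_measure (\<mu> + \<nu>)) = (\<integral>\<^sup>+y. u y \<partial>to_measure \<mu>) + (\<integral>\<^sup>+y. u y \<partial>to_measure \<nu>)"
    if "u \<in> borel_measurable borel" for u :: "real \<Rightarrow> ennreal"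
    using that
  proof (induction rule: borel_measurable_induct)
    case (cong f g) then show ?case by (simp cong: nn_integral_cong)
  next
    case (set A) then show ?case by (simp add: emeasure_plus_locfin)
  next
    case (mult u c) then show ?case by (simp add: nn_integral_cmult distrib_left)
  next
    case (add u v) then show ?case by (simp add: nn_integral_add algebra_simps)
  next
    case (seq U)
    have "(SUP i. (\<integral>\<^sup>+y. U i y \<partial>to_measure \<mu>) + (\<integral>\<^sup>+y. U i y \<partial>to_measure \<nu>)) =
      (SUP i. (\<integral>\<^sup>+y. U i y \<partial>to_measure \<mu>)) + (SUP i. (\<integral>\<^sup>+y. U i y \<partial>to_measure \<nu>))"
      using \<open>incseq U\<close> by (intro ennreal_SUP_add) (auto simp: incseq_def le_fun_def intro!: nn_integral_mono)
    then show ?case using seq by (simp add: nn_integral_monotone_convergence_SUP image_comp)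
  qed
  then show ?thesis by (simp add: pairing_def)
qed

lemma pairing_translate:
  assumes [measurable]: "f \<in> borel_measurable borel"
  shows "pairing (translate x \<mu>) f = pairing \<mu> (\<lambda>y. f (y + x))"
  by (simp add: pairing_def nn_integral_translate)

lemma pairing_zero [simp]: "pairing 0 f = 0"
  by (simp add: pairing_def zero_locfin_measure.rep_eq nn_integral_null_measure)

lemma pairing_add:
  assumes [measurable]: "f \<in> borel_measurable borel" "g \<in> borel_measurable borel"
    and "\<And>x. 0 \<le> f x" "\<And>x. 0 \<le> g x"
  shows "pairing \<mu> (\<lambda>x. f x + g x) = pairing \<mu> f + pairing \<mu> g"
  using assms(3,4) by (simp add: pairing_def ennreal_plus nn_integral_add)

lemma pairing_cmult:
  assumes [measurable]: "f \<in> borel_measurable borel" and "0 \<le> c"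
  shows "pairing \<mu> (\<lambda>x. c * f x) = ennreal c * pairing \<mu> f"
  using assms(2) by (simp add: pairing_def ennreal_mult' nn_integral_cmult)

lemma pairing_mono: "(\<And>x. f x \<le> g x) \<Longrightarrow> pairing \<mu> f \<le> pairing \<mu> g"
  unfolding pairing_def by (intro nn_integral_mono ennreal_leI)

lemma pairing_indicator: "A \<in> sets borel \<Longrightarrow> pairing \<mu> (indicator A) = emeasure (to_measure \<mu>) A"
  by (simp add: pairing_def ennreal_indicator)

text \<open>For this reason the weight 1 - exp(-<\<mu>,h>) with h > 0 can be divided out away from
  the zero measure, both when \<open>\<Lambda>\<close> is extracted and when uniqueness is
  proved.\<close>

lemma pairing_pos:
  assumes [measurable]: "f \<in> borel_measurable borel" and "\<And>x. 0 < f x"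
  shows "pairing \<mu> f = 0 \<longleftrightarrow> \<mu> = 0"
proof -
  have "pairing \<mu> f = 0 \<longleftrightarrow> (AE x in to_measure \<mu>. ennreal (f x) = 0)"
    unfolding pairing_def by (subst nn_integral_0_iff_AE) auto
  also have "\<dots> \<longleftrightarrow> (AE x in to_measure \<mu>. False)"
    using assms(2) by (intro AE_cong) (simp add: ennreal_eq_0_iff not_le)
  also have "\<dots> \<longleftrightarrow> emeasure (to_measure \<mu>) UNIV = 0"
    by (subst AE_iff_measurable[where N=UNIV]) auto
  finally show ?thesis by (simp add: locfin_eq_0_iff)
qed

lemma pairing_SUP:
  assumes [measurable]: "\<And>n. f n \<in> borel_measurable borel"
    and "incseq f" "\<And>x. (\<lambda>n. f n x) \<longlonglongrightarrow> g x" "\<And>n x. 0 \<le> f n x"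
  shows "(\<lambda>n. pairing \<mu> (f n)) \<longlonglongrightarrow> pairing \<mu> g"
proof -
  have "(\<lambda>n. pairing \<mu> (f n)) \<longlonglongrightarrow> (\<integral>\<^sup>+x. ennreal (g x) \<partial>to_measure \<mu>)"
    unfolding pairing_def
  proof (rule nn_integral_LIMSEQ)
    show "incseq (\<lambda>n x. ennreal (f n x))"
      using assms(2) by (auto simp: incseq_def le_fun_def intro: ennreal_leI)
    show "(\<lambda>n. ennreal (f n x)) \<longlonglongrightarrow> ennreal (g x)" for x
      using assms(3) by (intro tendsto_ennrealI)
  qed auto
  then show ?thesis by (simp add: pairing_def)
qed

section \<open>Laplace functionals\<close>

lemma exp_neg_nonneg [simp]: "0 \<le> exp_neg t" and exp_neg_le_1 [simp]: "exp_neg t \<le> 1"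
  by (auto simp: exp_neg_def)

lemma exp_neg_0 [simp]: "exp_neg 0 = 1" and exp_neg_top [simp]: "exp_neg \<top> = 0"
  by (auto simp: exp_neg_def)

lemma exp_neg_ennreal: "0 \<le> r \<Longrightarrow> exp_neg (ennreal r) = exp (- r)"
  by (simp add: exp_neg_def)

lemma exp_neg_add: "exp_neg (a + b) = exp_neg a * exp_neg b"
  by (cases a; cases b) (auto simp: exp_neg_ennreal exp_add[symmetric] ennreal_plus[symmetric] simp del: ennreal_plus)

lemma exp_neg_mono: "a \<le> b \<Longrightarrow> exp_neg b \<le> exp_neg a"
  by (cases a; cases b) (auto simp: exp_neg_ennreal top_unique)

lemma exp_neg_eq_0_iff [simp]: "exp_neg a = 0 \<longleftrightarrow> a = \<top>"
  by (auto simp: exp_neg_def)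

lemma exp_neg_eq_1_iff [simp]: "exp_neg a = 1 \<longleftrightarrow> a = 0"
  by (cases a) (auto simp: exp_neg_ennreal)

lemma exp_neg_less_1: "a \<noteq> 0 \<Longrightarrow> exp_neg a < 1"
  using exp_neg_le_1[of a] exp_neg_eq_1_iff[of a] by linarith

lemma measurable_exp_neg [measurable]: "exp_neg \<in> borel_measurable borel"
  unfolding exp_neg_def by measurable

lemma tendsto_exp_neg:
  assumes "(X \<longlongrightarrow> x) F"
  shows "((\<lambda>n. exp_neg (X n)) \<longlongrightarrow> exp_neg x) F"
proof (cases x)
  case (real r)
  have fin: "\<forall>\<^sub>F n in F. X n < \<top>" using assms real by (auto elim: order_tendstoD)
  have "((\<lambda>n. exp (- enn2real (X n))) \<longlongrightarrow> exp (- r)) F"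
    using assms real by (intro tendsto_intros) auto
  then have "((\<lambda>n. exp (- enn2real (X n))) \<longlongrightarrow> exp_neg x) F"
    using real by (simp add: exp_neg_ennreal)
  then show ?thesis
    by (rule Lim_transform_eventually) (use fin in eventually_elim, auto simp: exp_neg_def)
next
  case top
  show ?thesis
  proof (rule order_tendstoI)
    fix a assume "a < exp_neg x"
    then have "a < exp_neg t" for t using top exp_neg_nonneg[of t] by (simp add: less_le_trans)
    then show "\<forall>\<^sub>F n in F. a < exp_neg (X n)" by simp
  next
    fix a assume "exp_neg x < a"
    then have a: "0 < a" using top by simp
    define r where "r = \<bar>ln a\<bar> + 1"
    have "exp (- r) < exp (ln a)" by (simp add: r_def)
    then have r: "0 \<le> r" "exp (- r) < a" using a by (auto simp: r_def)
    have "\<forall>\<^sub>F n in F. ennreal r < X n" using assms top by (auto elim: order_tendstoD)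
    then show "\<forall>\<^sub>F n in F. exp_neg (X n) < a"
    proof eventually_elim
      case (elim n)
      then have "exp_neg (X n) \<le> exp (- r)" using exp_neg_mono[of "ennreal r" "X n"] r by (simp add: exp_neg_ennreal)
      then show ?case using r by simp
    qed
  qed
qed

lemma integrable_exp_neg:
  assumes "finite_measure N" "g \<in> borel_measurable N"
  shows "integrable N (\<lambda>w. exp_neg (g w))"
proof -
  interpret finite_measure N by fact
  have [measurable]: "g \<in> borel_measurable N" by fact
  show ?thesis by (rule integrable_const_bound[where B=1]) auto
qed

text \<open>Integrable under every locally finite measure and stable under sums, shifts and
  measurable minorants; indicators of bounded Borel sets belong to it, which continuity would
  exclude.\<close>

definition test_fun :: "(real \<Rightarrow> real) \<Rightarrow> bool" where
  "test_fun f \<longleftrightarrow> f \<in> borel_measurable borel \<and> (\<forall>x. 0 \<le> f x) \<and>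
     (\<exists>R B. \<forall>x. f x \<le> B \<and> (R < \<bar>x\<bar> \<longrightarrow> f x = 0))"

lemma test_funD: "test_fun f \<Longrightarrow> f \<in> borel_measurable borel" "test_fun f \<Longrightarrow> 0 \<le> f x"
  by (auto simp: test_fun_def)

lemma test_funI:
  assumes "f \<in> borel_measurable borel" "\<And>x. 0 \<le> f x" "\<And>x. f x \<le> B" "\<And>x. R < \<bar>x\<bar> \<Longrightarrow> f x = 0"
  shows "test_fun f"
  using assms unfolding test_fun_def by blast

lemma test_funE:
  assumes "test_fun f"
  obtains R B where "\<And>x. f x \<le> B" "\<And>x. R < \<bar>x\<bar> \<Longrightarrow> f x = 0"
  using assms unfolding test_fun_def by blast

lemma test_fun_pairing_finite:
  assumes "test_fun f"
  shows "pairing \<mu> f < \<top>"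
proof -
  obtain R B where f: "\<And>x. f x \<le> B" "\<And>x. R < \<bar>x\<bar> \<Longrightarrow> f x = 0" using assms by (rule test_funE) blast
  have [measurable]: "f \<in> borel_measurable borel" using assms by (rule test_funD)
  have "integrable (to_measure \<mu>) f"
    using f test_funD(2)[OF assms] by (intro integrable_bounded_support[where R=R and B=B]) auto
  then show ?thesis
    unfolding pairing_def using test_funD(2)[OF assms] by (simp add: nn_integral_eq_integral)
qed

lemma test_fun_add:
  assumes "test_fun f" "test_fun g"
  shows "test_fun (\<lambda>x. f x + g x)"
proof -
  note [measurable] = test_funD(1)[OF assms(1)] test_funD(1)[OF assms(2)]
  obtain R B where f: "\<And>x. f x \<le> B" "\<And>x. R < \<bar>x\<bar> \<Longrightarrow> f x = 0" using assms(1) by (rule test_funE) blast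
  obtain R' B' where g: "\<And>x. g x \<le> B'" "\<And>x. R' < \<bar>x\<bar> \<Longrightarrow> g x = 0" using assms(2) by (rule test_funE) blast
  show ?thesis
    by (rule test_funI[where B="B + B'" and R="max R R'"])
      (use f g test_funD(2)[OF assms(1)] test_funD(2)[OF assms(2)] in \<open>auto intro!: add_mono\<close>)
qed

lemma test_fun_cmult:
  assumes "test_fun f" "0 \<le> c"
  shows "test_fun (\<lambda>x. c * f x)"
proof -
  note [measurable] = test_funD(1)[OF assms(1)]
  obtain R B where f: "\<And>x. f x \<le> B" "\<And>x. R < \<bar>x\<bar> \<Longrightarrow> f x = 0" using assms(1) by (rule test_funE) blast
  show ?thesis
    by (rule test_funI[where B="c * B" and R="R"])
      (use f assms(2) test_funD(2)[OF assms(1)] in \<open>auto intro!: mult_left_mono\<close>)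
qed

lemma test_fun_shift:
  assumes "test_fun f"
  shows "test_fun (\<lambda>x. f (x + a))"
proof -
  note [measurable] = test_funD(1)[OF assms(1)]
  obtain R B where f: "\<And>x. f x \<le> B" "\<And>x. R < \<bar>x\<bar> \<Longrightarrow> f x = 0" using assms(1) by (rule test_funE) blast
  show ?thesis
    by (rule test_funI[where B=B and R="R + \<bar>a\<bar>"])
      (use f test_funD(2)[OF assms(1)] in auto)
qed

lemma test_fun_indicator:
  assumes "A \<in> sets borel" "bounded A"
  shows "test_fun (indicator A)"
proof -
  obtain R where "\<And>x. x \<in> A \<Longrightarrow> \<bar>x\<bar> \<le> R" using assms(2) by (auto simp: bounded_iff)
  then show ?thesis using assms(1)
    by (intro test_funI[where B=1 and R=R]) (auto simp: indicator_def not_le[symmetric])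
qed

lemma test_fun_0: "test_fun (\<lambda>_. 0)"
  by (rule test_funI) auto

text \<open>The analytic step of a multiplicative class theorem. \<open>H\<close> is closed under
  linear combinations, bounded pointwise limits and multiplication by members of \<open>C\<close>,
  hence under multiplication by Bernstein polynomials of \<open>u\<close>, by continuous functions
  of \<open>u\<close>, and finally by the indicator of a sublevel set. Testing against all of
  \<open>C\<close>, and not only against 1, is what makes \<open>H\<close> stable under
  multiplication by \<open>u\<close>.\<close>

lemma integral_uniqueness_closure:
  fixes \<nu> \<nu>' :: "'b measure" and C :: "('b \<Rightarrow> real) set"
  defines "H \<equiv> {g. (\<exists>B. \<forall>x. \<bar>g x\<bar> \<le> B) \<and> g \<in> borel_measurable \<nu> \<and>
      (\<forall>e\<in>C. (\<integral>x. g x * e x \<partial>\<nu>) = (\<integral>x. g x * e x \<partial>\<nu>'))}"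
  assumes fin: "finite_measure \<nu>" "finite_measure \<nu>'" and sets: "sets \<nu>' = sets \<nu>"
    and C: "\<And>e. e \<in> C \<Longrightarrow> e \<in> borel_measurable \<nu>" "\<And>e x. e \<in> C \<Longrightarrow> 0 \<le> e x \<and> e x \<le> 1"
      "\<And>e e'. e \<in> C \<Longrightarrow> e' \<in> C \<Longrightarrow> (\<lambda>x. e x * e' x) \<in> C"
    and g: "g \<in> H" and u: "u \<in> C"
  shows "(\<lambda>x. g x * indicator {x. u x \<le> a} x) \<in> H"
proof -
  interpret \<nu>: finite_measure \<nu> by fact
  interpret \<nu>': finite_measure \<nu>' by fact
  note [measurable] = C(1)[OF u]
  note [measurable_cong] = sets
  have u01: "0 \<le> u x" "u x \<le> 1" for x using C(2)[OF u] by auto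
  have intg: "integrable \<nu> (\<lambda>x. g x * e x)" "integrable \<nu>' (\<lambda>x. g x * e x)" if g: "g \<in> H" "e \<in> C" for g e
  proof -
    from g(1) obtain B where B: "\<And>x. \<bar>g x\<bar> \<le> B" unfolding H_def by blast
    have [measurable]: "g \<in> borel_measurable \<nu>" "e \<in> borel_measurable \<nu>" using g C(1) by (auto simp: H_def)
    have "\<bar>g x * e x\<bar> \<le> B" for x
      using mult_mono[OF B[of x], of "\<bar>e x\<bar>" 1] C(2)[OF g(2), of x] order_trans[OF abs_ge_zero B[of x]] by (simp add: abs_mult)
    then show "integrable \<nu> (\<lambda>x. g x * e x)" "integrable \<nu>' (\<lambda>x. g x * e x)"
      by (auto intro!: \<nu>.integrable_const_bound[where B=B] \<nu>'.integrable_const_bound[where B=B])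
  qed
  have H_u: "(\<lambda>x. g x * u x) \<in> H" if "g \<in> H" for g
  proof -
    from that obtain B where B: "\<And>x. \<bar>g x\<bar> \<le> B" unfolding H_def by blast
    have "\<bar>g x * u x\<bar> \<le> B" for x
      using mult_mono[OF B[of x], of "\<bar>u x\<bar>" 1] u01[of x] order_trans[OF abs_ge_zero B[of x]] by (simp add: abs_mult)
    then show ?thesis using that C(3)[OF u] by (auto simp: H_def mult.assoc)
  qed
  have H_lin: "(\<lambda>x. c * g x + d * g' x) \<in> H" if gg: "g \<in> H" "g' \<in> H" for g g' c d
  proof -
    from gg(1) obtain B where B1: "\<And>x. \<bar>g x\<bar> \<le> B" unfolding H_def by blast
    from gg(2) obtain B' where "\<And>x. \<bar>g' x\<bar> \<le> B'" unfolding H_def by blast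
    note B = B1 this
    have "\<bar>c * g x + d * g' x\<bar> \<le> \<bar>c\<bar> * B + \<bar>d\<bar> * B'" for x
      using abs_triangle_ineq[of "c * g x" "d * g' x"] mult_left_mono[OF B(1)[of x], of "\<bar>c\<bar>"]
        mult_left_mono[OF B(2)[of x], of "\<bar>d\<bar>"] by (simp add: abs_mult)
    moreover have "(\<integral>x. (c * g x + d * g' x) * e x \<partial>\<nu>) = (\<integral>x. (c * g x + d * g' x) * e x \<partial>\<nu>')" if e: "e \<in> C" for e
    proof -
      have "(\<integral>x. (c * g x + d * g' x) * e x \<partial>\<nu>) = c * (\<integral>x. g x * e x \<partial>\<nu>) + d * (\<integral>x. g' x * e x \<partial>\<nu>)"
        using intg[OF gg(1) e] intg[OF gg(2) e] by (simp add: distrib_right mult.assoc)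
      moreover have "(\<integral>x. (c * g x + d * g' x) * e x \<partial>\<nu>') = c * (\<integral>x. g x * e x \<partial>\<nu>') + d * (\<integral>x. g' x * e x \<partial>\<nu>')"
        using intg[OF gg(1) e] intg[OF gg(2) e] by (simp add: distrib_right mult.assoc)
      ultimately show ?thesis using gg e by (simp add: H_def)
    qed
    ultimately show ?thesis using gg by (auto simp: H_def)
  qed
  have H_lim: "g' \<in> H" if G: "\<And>n. G n \<in> H" "\<And>n x. \<bar>G n x\<bar> \<le> B" "\<And>x. (\<lambda>n. G n x) \<longlonglongrightarrow> g' x" for G g' B
  proof -
    have Gm[measurable]: "\<And>n. G n \<in> borel_measurable \<nu>" using G(1) by (auto simp: H_def)
    have g'm[measurable]: "g' \<in> borel_measurable \<nu>" by (rule borel_measurable_LIMSEQ_metric[OF Gm G(3)])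
    have B': "\<bar>g' x\<bar> \<le> B" for x
      using G(2) by (intro LIMSEQ_le_const2[OF tendsto_rabs[OF G(3)[of x]]]) auto
    have bnd: "\<bar>G n x * e x\<bar> \<le> B" if "e \<in> C" for n x e
      using mult_mono[OF G(2)[of n x], of "\<bar>e x\<bar>" 1] C(2)[OF that, of x] order_trans[OF abs_ge_zero G(2)[of n x]] by (simp add: abs_mult)
    have "(\<integral>x. g' x * e x \<partial>\<nu>) = (\<integral>x. g' x * e x \<partial>\<nu>')" if e: "e \<in> C" for e
    proof (rule LIMSEQ_unique)
      have [measurable]: "e \<in> borel_measurable \<nu>" using e C(1) by auto
      show "(\<lambda>n. \<integral>x. G n x * e x \<partial>\<nu>) \<longlonglongrightarrow> (\<integral>x. g' x * e x \<partial>\<nu>)"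
        using bnd[OF e] G(3) by (intro integral_dominated_convergence[where w="\<lambda>_. B"]) (auto intro!: tendsto_intros)
      have "(\<lambda>n. \<integral>x. G n x * e x \<partial>\<nu>') \<longlonglongrightarrow> (\<integral>x. g' x * e x \<partial>\<nu>')"
        using bnd[OF e] G(3) by (intro integral_dominated_convergence[where w="\<lambda>_. B"]) (auto intro!: tendsto_intros)
      then show "(\<lambda>n. \<integral>x. G n x * e x \<partial>\<nu>) \<longlonglongrightarrow> (\<integral>x. g' x * e x \<partial>\<nu>')"
        using G(1) e by (simp add: H_def)
    qed
    then show ?thesis using B' g'm by (auto simp: H_def)
  qed
  have H_pow: "(\<lambda>x. g x * (u x ^ k * (1 - u x) ^ m)) \<in> H" for k m
  proof -
    have 1: "(\<lambda>x. g x * u x ^ k) \<in> H"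
    proof (induction k)
      case (Suc k)
      from H_u[OF this] show ?case by (simp add: mult_ac)
    qed (simp add: g)
    show ?thesis
    proof (induction m)
      case (Suc m)
      from H_lin[OF this H_u[OF this], of 1 "-1"] show ?case by (simp add: algebra_simps)
    qed (simp add: 1)
  qed
  have H_0: "(\<lambda>x. 0) \<in> H" using H_lin[OF g g, of 0 0] by simp
  have H_bern: "(\<lambda>x. g x * (\<Sum>k\<le>n. c k * Bernstein n k (u x))) \<in> H" for c n
  proof -
    have "(\<lambda>x. g x * (\<Sum>k<m. c k * Bernstein n k (u x))) \<in> H" for m
    proof (induction m)
      case (Suc m)
      from H_lin[OF this H_pow[of m "n - m"], of 1 "c m * of_nat (n choose m)"]
      show ?case by (simp add: Bernstein_def algebra_simps)
    qed (simp add: H_0)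
    from this[of "Suc n"] show ?thesis unfolding lessThan_Suc_atMost .
  qed
  obtain Bg where Bg: "\<And>x. \<bar>g x\<bar> \<le> Bg" using g by (auto simp: H_def)
  have Bg0: "0 \<le> Bg" using order_trans[OF abs_ge_zero Bg] .
  have H_cont: "(\<lambda>x. g x * \<phi> (u x)) \<in> H"
    if \<phi>: "continuous_on {0..1} \<phi>" "\<And>y. \<bar>\<phi> y\<bar> \<le> 1" for \<phi> :: "real \<Rightarrow> real"
  proof (rule H_lim[where G="\<lambda>n x. g x * (\<Sum>k\<le>n. \<phi> (k / n) * Bernstein n k (u x))" and B=Bg])
    have "\<bar>\<Sum>k\<le>n. \<phi> (k / n) * Bernstein n k (u x)\<bar> \<le> 1" for n x
    proof -
      have "\<bar>\<Sum>k\<le>n. \<phi> (k / n) * Bernstein n k (u x)\<bar> \<le> (\<Sum>k\<le>n. \<bar>\<phi> (k / n) * Bernstein n k (u x)\<bar>)" by (rule sum_abs)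
      also have "\<dots> \<le> (\<Sum>k\<le>n. Bernstein n k (u x))"
      proof (rule sum_mono)
        fix k
        show "\<bar>\<phi> (k / n) * Bernstein n k (u x)\<bar> \<le> Bernstein n k (u x)"
          using mult_right_mono[OF \<phi>(2)[of "k / n"] Bernstein_nonneg[OF u01[of x], of n k]] Bernstein_nonneg[OF u01[of x], of n k]
          by (simp add: abs_mult)
      qed
      finally show ?thesis by simp
    qed
    then show "\<bar>g x * (\<Sum>k\<le>n. \<phi> (k / n) * Bernstein n k (u x))\<bar> \<le> Bg" for n x
      using mult_mono[OF Bg[of x], of _ 1] Bg0 by (simp add: abs_mult)
    show "(\<lambda>n. g x * (\<Sum>k\<le>n. \<phi> (k / n) * Bernstein n k (u x))) \<longlonglongrightarrow> g x * \<phi> (u x)" for x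
    proof (intro tendsto_mult tendsto_const)
      show "(\<lambda>n. \<Sum>k\<le>n. \<phi> (real k / real n) * Bernstein n k (u x)) \<longlonglongrightarrow> \<phi> (u x)"
      proof (rule LIMSEQ_I)
        fix r :: real assume "0 < r"
        from Bernstein_Weierstrass[OF \<phi>(1) this] obtain N where
          N: "\<forall>n x. N \<le> n \<and> x \<in> {0..1} \<longrightarrow> \<bar>\<phi> x - (\<Sum>k\<le>n. \<phi> (k / n) * Bernstein n k x)\<bar> < r" by blast
        have "norm ((\<Sum>k\<le>n. \<phi> (real k / real n) * Bernstein n k (u x)) - \<phi> (u x)) < r" if "N \<le> n" for n
          using N[rule_format, of n "u x"] u01[of x] that by (simp add: abs_minus_commute)
        then show "\<exists>no. \<forall>n\<ge>no. norm ((\<Sum>k\<le>n. \<phi> (real k / real n) * Bernstein n k (u x)) - \<phi> (u x)) < r" by blast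
      qed
    qed
  qed (rule H_bern)
  \<comment> \<open>Continuous cut-offs, equal to 1 up to \<open>a\<close> and decreasing to 0
    beyond \<open>a\<close> as the slope \<open>m\<close> grows.\<close>
  define \<phi> where "\<phi> = (\<lambda>(m::nat) y::real. max 0 (1 - real m * max 0 (y - a)))"
  have \<phi>1: "\<bar>\<phi> m y\<bar> \<le> 1" for m y by (auto simp: \<phi>_def max_def)
  show ?thesis
  proof (rule H_lim[where G="\<lambda>m x. g x * \<phi> m (u x)" and B=Bg])
    show "(\<lambda>x. g x * \<phi> m (u x)) \<in> H" for m
      by (rule H_cont[OF _ \<phi>1]) (auto simp: \<phi>_def intro!: continuous_intros)
    show "\<bar>g x * \<phi> m (u x)\<bar> \<le> Bg" for m x
      using mult_mono[OF Bg[of x] \<phi>1[of m "u x"]] Bg0 by (simp add: abs_mult)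
    show "(\<lambda>m. g x * \<phi> m (u x)) \<longlonglongrightarrow> g x * indicator {x. u x \<le> a} x" for x
    proof (intro tendsto_mult tendsto_const)
      show "(\<lambda>m. \<phi> m (u x)) \<longlonglongrightarrow> indicator {x. u x \<le> a} x"
      proof (cases "u x \<le> a")
        case True then show ?thesis by (simp add: \<phi>_def)
      next
        case False
        obtain M :: nat where "1 / (u x - a) < M" using reals_Archimedean2 by blast
        then have "1 \<le> real M * (u x - a)" using False by (simp add: field_simps)
        have "\<phi> m (u x) = 0" if "M \<le> m" for m
        proof -
          have "real M * (u x - a) \<le> real m * (u x - a)" using that False by (intro mult_right_mono) auto
          then have "1 - real m * (u x - a) \<le> 0" using \<open>1 \<le> real M * (u x - a)\<close> by linarith
          then show ?thesis using False by (simp add: \<phi>_def max_def)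
        qed
        then have "(\<lambda>m. \<phi> m (u x)) \<longlonglongrightarrow> 0"
          by (intro tendsto_eventually) (auto simp: eventually_sequentially)
        then show ?thesis using False by simp
      qed
    qed
  qed
qed

text \<open>Products of functions exp(-<\<mu>,f>) are again of this form, so indicators of their
  sublevel sets can be multiplied in one at a time. The finite intersections of sublevel sets form a
  generator: with \<open>f\<close> the indicator of an interval the function determines the mass of
  the interval, and interval masses generate the Borel field.\<close>

theorem laplace_functional_unique:
  assumes fin: "finite_measure \<nu>" "finite_measure \<nu>'"
    and sets: "sets \<nu> = sets (borel :: locfin_measure measure)" "sets \<nu>' = sets borel"
    and eq: "\<And>f. test_fun f \<Longrightarrow> (\<integral>\<mu>. exp_neg (pairing \<mu> f) \<partial>\<nu>) = (\<integral>\<mu>. exp_neg (pairing \<mu> f) \<partial>\<nu>')"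
  shows "\<nu> = \<nu>'"
proof -
  interpret \<nu>: finite_measure \<nu> by fact
  interpret \<nu>': finite_measure \<nu>' by fact
  note [measurable_cong] = sets
  define C where "C = {e. \<exists>f. test_fun f \<and> e = (\<lambda>\<mu>. exp_neg (pairing \<mu> f))}"
  define H where "H = {g. (\<exists>B. \<forall>x. \<bar>g x\<bar> \<le> B) \<and> g \<in> borel_measurable \<nu> \<and>
      (\<forall>e\<in>C. (\<integral>x. g x * e x \<partial>\<nu>) = (\<integral>x. g x * e x \<partial>\<nu>'))}"
  have C_meas: "e \<in> borel_measurable \<nu>" if "e \<in> C" for e
    using that test_funD(1) unfolding C_def by auto
  have C_mult: "(\<lambda>\<mu>. e \<mu> * e' \<mu>) \<in> C" if ee: "e \<in> C" "e' \<in> C" for e e'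
  proof -
    obtain f f' where f: "test_fun f" "test_fun f'" and e: "e = (\<lambda>\<mu>. exp_neg (pairing \<mu> f))" "e' = (\<lambda>\<mu>. exp_neg (pairing \<mu> f'))"
      using ee by (auto simp: C_def)
    have "(\<lambda>\<mu>. e \<mu> * e' \<mu>) = (\<lambda>\<mu>. exp_neg (pairing \<mu> (\<lambda>x. f x + f' x)))"
      using f by (simp add: e exp_neg_add[symmetric] pairing_add test_funD)
    then show ?thesis using test_fun_add[OF f] by (auto simp: C_def)
  qed
  have step: "(\<lambda>x. g x * indicator {x. u x \<le> a} x) \<in> H" if "g \<in> H" "u \<in> C" for g u a
    unfolding H_def by (rule integral_uniqueness_closure[OF fin])
      (use C_meas C_mult that sets in \<open>auto simp: C_def H_def\<close>)
  have one: "(\<lambda>_. 1) \<in> H" using eq by (auto simp: H_def C_def intro!: exI[of _ 1])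
  define G where "G = {A. \<exists>us. set us \<subseteq> C \<times> UNIV \<and> A = {\<mu>. \<forall>(u, a)\<in>set us. u \<mu> \<le> (a::real)}}"
  have G_int: "Int_stable G"
  proof (rule Int_stableI)
    fix A B assume "A \<in> G" "B \<in> G"
    then obtain us vs where "set us \<subseteq> C \<times> UNIV" "A = {\<mu>. \<forall>(u, a)\<in>set us. u \<mu> \<le> (a::real)}"
      "set vs \<subseteq> C \<times> UNIV" "B = {\<mu>. \<forall>(u, a)\<in>set vs. u \<mu> \<le> (a::real)}" by (auto simp: G_def)
    then show "A \<inter> B \<in> G" unfolding G_def by (intro CollectI exI[of _ "us @ vs"]) auto
  qed
  have G_H: "indicator {\<mu>. \<forall>(u, a)\<in>set us. u \<mu> \<le> (a::real)} \<in> H" if "set us \<subseteq> C \<times> UNIV" for us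
    using that
  proof (induction us)
    case Nil then show ?case using one by (simp add: indicator_def[abs_def])
  next
    case (Cons p us)
    obtain u a where p: "p = (u, a)" by (cases p)
    have "indicator {\<mu>. \<forall>(u, a)\<in>set (p # us). u \<mu> \<le> a} =
      (\<lambda>x. indicator {\<mu>. \<forall>(u, a)\<in>set us. u \<mu> \<le> a} x * indicator {x. u x \<le> a} x :: real)"
      by (auto simp: p indicator_def fun_eq_iff)
    then show ?case using step[of "indicator {\<mu>. \<forall>(u, a)\<in>set us. u \<mu> \<le> a}" u a] Cons p by auto
  qed
  have G_sets: "G \<subseteq> sets borel"
  proof
    fix A assume "A \<in> G"
    then obtain us where us: "set us \<subseteq> C \<times> UNIV" "A = {\<mu>. \<forall>(u, a)\<in>set us. u \<mu> \<le> (a::real)}" by (auto simp: G_def)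
    have "A = space borel \<inter> {\<mu> \<in> space borel. \<forall>p\<in>set us. fst p \<mu> \<le> snd p}" by (auto simp: us(2))
    also have "\<dots> \<in> sets borel"
    proof (intro sets.Int sets.top sets.sets_Collect_finite_All)
      fix p assume "p \<in> set us"
      then have [measurable]: "fst p \<in> borel_measurable borel"
        using us(1) C_meas[of "fst p"] measurable_cong_sets[OF sets(1) refl] by force
      show "{\<mu> \<in> space borel. fst p \<mu> \<le> snd p} \<in> sets borel" by measurable
    qed auto
    finally show "A \<in> sets borel" .
  qed
  have id: "(\<lambda>\<mu>. \<mu>) \<in> borel_measurable (sigma UNIV G)"
  proof (rule measurable_locfinI)
    fix a b :: real
    define f where "f = indicat_real {a<..b}"
    have f: "test_fun f" unfolding f_def by (rule test_fun_indicator) auto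
    have "(\<lambda>\<mu>. exp_neg (pairing \<mu> f)) \<in> borel_measurable (sigma UNIV G)"
    proof (rule borel_measurable_iff_le[THEN iffD2], rule allI)
      fix t :: real
      have "{w. exp_neg (pairing w f) \<le> t} \<in> G"
        unfolding G_def using f by (intro CollectI exI[of _ "[(\<lambda>\<mu>. exp_neg (pairing \<mu> f), t)]"]) (auto simp: C_def)
      then show "{w \<in> space (sigma UNIV G). exp_neg (pairing w f) \<le> t} \<in> sets (sigma UNIV G)"
        by (simp add: space_measure_of_conv)
    qed
    then have [measurable]: "(\<lambda>\<mu>. ennreal (- ln (exp_neg (pairing \<mu> f)))) \<in> borel_measurable (sigma UNIV G)" by measurable
    have "emeasure (to_measure \<mu>) {a<..b} = ennreal (- ln (exp_neg (pairing \<mu> f)))" for \<mu>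
    proof -
      have "pairing \<mu> f = emeasure (to_measure \<mu>) {a<..b}" unfolding f_def by (rule pairing_indicator) simp
      moreover have "pairing \<mu> f < \<top>" by (rule test_fun_pairing_finite[OF f])
      moreover have "t = ennreal (- ln (exp_neg t))" if "t < \<top>" for t
        using that by (cases t) (auto simp: exp_neg_ennreal)
      ultimately show ?thesis by metis
    qed
    then show "(\<lambda>\<mu>. emeasure (to_measure \<mu>) {a<..b}) \<in> borel_measurable (sigma UNIV G)" by simp
  qed
  have sb: "sets borel = sigma_sets UNIV G"
  proof
    show "sets borel \<subseteq> sigma_sets UNIV G"
    proof
      fix A :: "locfin_measure set" assume "A \<in> sets borel"
      from measurable_sets[OF id this] show "A \<in> sigma_sets UNIV G"
        by (simp add: space_measure_of_conv)
    qed
    show "sigma_sets UNIV G \<subseteq> sets borel"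
      using sets.sigma_sets_subset[OF G_sets] by simp
  qed
  show ?thesis
  proof (rule measure_eqI_generator_eq[where E=G and \<Omega>=UNIV and A="\<lambda>_. UNIV"])
    show "emeasure \<nu> X = emeasure \<nu>' X" if "X \<in> G" for X
    proof -
      have X: "X \<in> sets borel" using that G_sets by auto
      have "indicator X \<in> H" using that G_H by (auto simp: G_def)
      \<comment> \<open>Taking f = 0 puts the constant 1 into \<open>C\<close>, so that an indicator
        in \<open>H\<close> has the same integral under both measures.\<close>
      moreover have "(\<lambda>_. 1) \<in> C" using test_fun_0 unfolding C_def by (auto simp: pairing_def intro!: exI[of _ "\<lambda>_. 0"])
      ultimately have "measure \<nu> X = measure \<nu>' X"
        using X sets by (auto simp: H_def)
      then show ?thesis by (simp add: \<nu>.emeasure_eq_measure \<nu>'.emeasure_eq_measure)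
    qed
    show "range (\<lambda>_::nat. UNIV) \<subseteq> G" unfolding G_def by (auto intro!: exI[of _ "[]"])
    show "sets \<nu> = sigma_sets UNIV G" "sets \<nu>' = sigma_sets UNIV G" using sets sb by auto
  qed (use G_int in auto)
qed

text \<open>Cauchy's equation on the half-line: nonnegativity makes \<open>k\<close> monotone,
  additivity settles the rationals, and monotonicity squeezes the remaining points between
  them.\<close>

lemma additive_nonneg_imp_linear:
  fixes k :: "real \<Rightarrow> real"
  assumes nn: "\<And>t. 0 < t \<Longrightarrow> 0 \<le> k t" and add: "\<And>s t. 0 < s \<Longrightarrow> 0 < t \<Longrightarrow> k (s + t) = k s + k t"
    and "0 < t"
  shows "k t = t * k 1"
proof -
  have mult: "k (real (Suc n) * t) = real (Suc n) * k t" if "0 < t" for n t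
  proof (induction n)
    case (Suc n)
    have "k (real (Suc (Suc n)) * t) = k (real (Suc n) * t + t)" by (simp add: algebra_simps)
    also have "\<dots> = k (real (Suc n) * t) + k t" using that by (intro add) auto
    finally show ?case using Suc by (simp add: algebra_simps)
  qed simp
  have mono: "k s \<le> k t" if "0 < s" "s < t" for s t
    using add[of s "t - s"] nn[of "t - s"] that by simp
  have k1: "0 \<le> k 1" by (rule nn) simp
  have krat: "k r = r * k 1" if r: "r \<in> \<rat>" "0 < r" for r
  proof -
    from r(1) obtain a b :: nat where ab: "b \<noteq> 0" "\<bar>r\<bar> = real a / real b" by (rule Rats_abs_nat_div_natE)
    obtain m n where mn: "a = Suc m" "b = Suc n" using ab r by (cases a; cases b) auto
    have "k (real (Suc m) / real (Suc n)) = real (Suc m) / real (Suc n) * k 1"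
      using mult[of "1 / real (Suc n)" m] mult[of "1 / real (Suc n)" n] by (simp add: field_simps del: of_nat_Suc)
    then show ?thesis using ab r mn by simp
  qed
  have le: "k t \<le> y * k 1" if "t < y" for y
  proof -
    from Rats_dense_in_real[OF that] obtain r where r: "r \<in> \<rat>" "t < r" "r < y" by blast
    have "k t \<le> r * k 1" using mono[OF \<open>0 < t\<close> r(2)] krat[OF r(1)] r(2) \<open>0 < t\<close> by simp
    also have "\<dots> \<le> y * k 1" using r k1 by (intro mult_right_mono) auto
    finally show ?thesis .
  qed
  have ge: "x * k 1 \<le> k t" if "0 < x" "x < t" for x
  proof -
    from Rats_dense_in_real[OF that(2)] obtain r where r: "r \<in> \<rat>" "x < r" "r < t" by blast
    have "x * k 1 \<le> r * k 1" using r k1 by (intro mult_right_mono) auto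
    also have "\<dots> \<le> k t" using mono[OF _ r(3)] krat[OF r(1)] r(2) that(1) by simp
    finally show ?thesis .
  qed
  show ?thesis
  proof (cases "k 1 = 0")
    case True
    then show ?thesis using le[of "t + 1"] nn[OF \<open>0 < t\<close>] by simp
  next
    case False
    then have k1: "0 < k 1" using k1 by simp
    show ?thesis
    proof (rule antisym)
      show "k t \<le> t * k 1"
      proof (rule dense_ge)
        fix z assume "t * k 1 < z"
        then show "k t \<le> z" using le[of "z / k 1"] k1 by (simp add: field_simps)
      qed
      show "t * k 1 \<le> k t"
      proof (rule dense_le_bounded[where x=0])
        show "0 < t * k 1" using \<open>0 < t\<close> k1 by simp
        fix z assume "0 < z" "z < t * k 1"
        then show "z \<le> k t" using ge[of "z / k 1"] k1 by (simp add: field_simps)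
      qed
    qed
  qed
qed

section \<open>Cumulants of superposable laws\<close>

locale locfin_law = prob_space L for L :: "locfin_measure measure" +
  assumes sets_L: "sets L = sets borel"
begin

lemma sets_L' [simp, measurable_cong]: "sets L = sets borel" by (rule sets_L)

lemma space_L [simp]: "space L = UNIV"
  using sets_eq_imp_space_eq[OF sets_L] by simp

lemma prob_UNIV [simp]: "measure L UNIV = 1"
  using prob_space by simp

definition lap :: "(real \<Rightarrow> real) \<Rightarrow> real" where
  "lap f = (\<integral>\<mu>. exp_neg (pairing \<mu> f) \<partial>L)"

text \<open>Agrees with the cumulant only where \<open>lap f\<close> is positive: since
  \<open>ln 0 = 0\<close>, it takes the value 0 where the cumulant is infinite.\<close>

definition kum :: "(real \<Rightarrow> real) \<Rightarrow> real" where
  "kum f = - ln (lap f)"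

text \<open>Almost sure finiteness of the pairing makes \<open>lap f\<close> positive, so
  \<open>kum f\<close> is the finite cumulant. Unlike test functions, some of these functions are
  strictly positive on the whole line, see \<open>ex_adm_pos\<close>.\<close>

definition adm :: "(real \<Rightarrow> real) \<Rightarrow> bool" where
  "adm f \<longleftrightarrow> f \<in> borel_measurable borel \<and> (\<forall>x. 0 \<le> f x) \<and> (AE \<mu> in L. pairing \<mu> f < \<top>)"

lemma admD: "adm f \<Longrightarrow> f \<in> borel_measurable borel" "adm f \<Longrightarrow> 0 \<le> f x"
  "adm f \<Longrightarrow> AE \<mu> in L. pairing \<mu> f < \<top>"
  by (auto simp: adm_def)

lemma adm_test_fun: "test_fun f \<Longrightarrow> adm f"
  by (simp add: adm_def test_funD test_fun_pairing_finite)

lemma adm_add: "adm f \<Longrightarrow> adm g \<Longrightarrow> adm (\<lambda>x. f x + g x)"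
  unfolding adm_def by (auto simp: pairing_add)

lemma adm_cmult:
  assumes "adm f" "0 \<le> c"
  shows "adm (\<lambda>x. c * f x)"
proof -
  have "AE \<mu> in L. ennreal c * pairing \<mu> f < \<top>"
    using admD(3)[OF assms(1)] by eventually_elim (simp add: ennreal_mult_less_top)
  moreover have [measurable]: "f \<in> borel_measurable borel" using assms(1) by (rule admD)
  ultimately show ?thesis using assms by (simp add: adm_def pairing_cmult)
qed

lemma adm_0: "adm (\<lambda>_. 0)"
  by (rule adm_test_fun[OF test_fun_0])

lemma integrable_lap: "f \<in> borel_measurable borel \<Longrightarrow> integrable L (\<lambda>\<mu>. exp_neg (pairing \<mu> f))"
  by (rule integrable_exp_neg) (auto intro: finite_measure_axioms)

lemma lap_nonneg: "0 \<le> lap f"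
  unfolding lap_def by (rule integral_nonneg_AE) simp

lemma lap_le_1: "lap f \<le> 1"
proof (cases "integrable L (\<lambda>\<mu>. exp_neg (pairing \<mu> f))")
  case True
  then have "lap f \<le> (\<integral>\<mu>. 1 \<partial>L)" unfolding lap_def by (intro integral_mono) auto
  then show ?thesis by (simp add: prob_space)
qed (simp add: lap_def not_integrable_integral_eq)

lemma nn_integral_lap:
  assumes [measurable]: "f \<in> borel_measurable borel"
  shows "(\<integral>\<^sup>+\<mu>. ennreal (exp_neg (pairing \<mu> f)) \<partial>L) = ennreal (lap f)"
  unfolding lap_def by (rule nn_integral_eq_integral) (auto intro: integrable_lap)

lemma lap_pos:
  assumes "adm f"
  shows "0 < lap f"
proof (rule ccontr)
  note [measurable] = admD(1)[OF assms]
  assume "\<not> 0 < lap f"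
  then have "lap f = 0" using lap_nonneg[of f] by simp
  then have "AE \<mu> in L. exp_neg (pairing \<mu> f) = 0"
    unfolding lap_def by (subst (asm) integral_nonneg_eq_0_iff_AE) (auto intro: integrable_lap)
  with admD(3)[OF assms] have "AE \<mu> in L. False" by eventually_elim simp
  then show False by simp
qed

lemma kum_nonneg: "adm f \<Longrightarrow> 0 \<le> kum f"
  using lap_pos[of f] lap_le_1[of f] by (simp add: kum_def)

lemma lap_eq_exp_kum: "0 < lap f \<Longrightarrow> lap f = exp (- kum f)"
  by (simp add: kum_def)

lemma lap_0 [simp]: "lap (\<lambda>_. 0) = 1"
  by (simp add: lap_def pairing_def prob_space)

lemma kum_0 [simp]: "kum (\<lambda>_. 0) = 0"
  by (simp add: kum_def)

lemma tendsto_lap: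
  assumes [measurable]: "\<And>n. f n \<in> borel_measurable borel" "g \<in> borel_measurable borel"
    and "AE \<mu> in L. (\<lambda>n. pairing \<mu> (f n)) \<longlonglongrightarrow> pairing \<mu> g"
  shows "(\<lambda>n. lap (f n)) \<longlonglongrightarrow> lap g"
  unfolding lap_def
proof (rule integral_dominated_convergence[where w="\<lambda>_. 1"])
  show "AE \<mu> in L. (\<lambda>n. exp_neg (pairing \<mu> (f n))) \<longlonglongrightarrow> exp_neg (pairing \<mu> g)"
    using assms(3) by eventually_elim (rule tendsto_exp_neg)
qed auto

lemma lap_superposed:
  assumes [measurable]: "f \<in> borel_measurable borel"
  shows "(\<integral>\<mu>. exp_neg (pairing \<mu> f) \<partial>distr (L \<Otimes>\<^sub>M L) borel (\<lambda>(\<mu>, \<nu>). translate \<alpha> \<mu> + translate \<beta> \<nu>)) =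
    lap (\<lambda>x. f (x + \<alpha>)) * lap (\<lambda>x. f (x + \<beta>))"
proof -
  interpret LL: pair_prob_space L L ..
  have "(\<integral>\<mu>. exp_neg (pairing \<mu> f) \<partial>distr (L \<Otimes>\<^sub>M L) borel (\<lambda>(\<mu>, \<nu>). translate \<alpha> \<mu> + translate \<beta> \<nu>)) =
    (\<integral>p. exp_neg (pairing (fst p) (\<lambda>x. f (x + \<alpha>))) * exp_neg (pairing (snd p) (\<lambda>x. f (x + \<beta>))) \<partial>(L \<Otimes>\<^sub>M L))"
    by (subst integral_distr) (auto simp: case_prod_beta pairing_plus pairing_translate exp_neg_add)
  also have "\<dots> = (\<integral>\<mu>. (\<integral>\<nu>. exp_neg (pairing \<mu> (\<lambda>x. f (x + \<alpha>))) * exp_neg (pairing \<nu> (\<lambda>x. f (x + \<beta>))) \<partial>L) \<partial>L)"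
  proof (subst LL.integral_fst'[symmetric])
    show "integrable (L \<Otimes>\<^sub>M L) (\<lambda>p. exp_neg (pairing (fst p) (\<lambda>x. f (x + \<alpha>))) * exp_neg (pairing (snd p) (\<lambda>x. f (x + \<beta>))))"
      by (rule LL.P.integrable_const_bound[where B=1]) (auto intro!: mult_le_one)
  qed simp
  also have "\<dots> = lap (\<lambda>x. f (x + \<alpha>)) * lap (\<lambda>x. f (x + \<beta>))"
    by (simp add: lap_def)
  finally show ?thesis .
qed

text \<open>Borel--Cantelli: small multiples of the indicators of \<open>[-n, n]\<close> are eventually dominated by
  a summable sequence.\<close>

lemma ex_adm_pos: "\<exists>h. adm h \<and> (\<forall>x. 0 < h x)"
proof -
  define N where "N = (\<lambda>(n::nat) \<mu>. emeasure (to_measure \<mu>) {-real n..real n})"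
  have [measurable]: "N n \<in> borel_measurable borel" for n unfolding N_def by measurable
  have N_fin: "N n \<mu> < \<top>" for n \<mu> using emeasure_to_measure_bounded[of "{-real n..real n}" \<mu>] by (simp add: N_def)
  have "\<exists>m::nat. measure L {\<mu>. of_nat (Suc m) < N n \<mu>} < (1/2)^n" for n
  proof -
    have "(\<lambda>m. measure L {\<mu>. of_nat (Suc m) < N n \<mu>}) \<longlonglongrightarrow> measure L (\<Inter>m. {\<mu>. of_nat (Suc m) < N n \<mu>})"
    proof (rule finite_Lim_measure_decseq)
      show "range (\<lambda>m. {\<mu>. of_nat (Suc m) < N n \<mu>}) \<subseteq> events"
      proof safe
        fix m :: nat
        have "{\<mu> \<in> space L. of_nat (Suc m) < N n \<mu>} \<in> sets L" by measurable
        then show "{\<mu>. of_nat (Suc m) < N n \<mu>} \<in> events" by simp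
      qed
      show "decseq (\<lambda>m. {\<mu>. of_nat (Suc m) < N n \<mu>})"
        by (auto simp: decseq_def intro: le_less_trans[OF of_nat_mono[of "Suc _" "Suc _"]] simp del: of_nat_Suc)
    qed
    moreover have "(\<Inter>m. {\<mu>. of_nat (Suc m) < N n \<mu>}) = {}"
    proof -
      have "\<exists>m::nat. \<not> of_nat (Suc m) < N n \<mu>" for \<mu>
      proof -
        obtain r where r: "0 \<le> r" "N n \<mu> = ennreal r" using N_fin[of n \<mu>] by (cases "N n \<mu>") auto
        obtain m :: nat where "r < m" using reals_Archimedean2 by blast
        then have "N n \<mu> \<le> ennreal (real (Suc m))" unfolding r by (intro ennreal_leI) simp
        then show ?thesis by (metis ennreal_of_nat_eq_real_of_nat not_less)
      qed
      then show ?thesis by blast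
    qed
    ultimately have "(\<lambda>m. measure L {\<mu>. of_nat (Suc m) < N n \<mu>}) \<longlonglongrightarrow> 0" by simp
    from order_tendstoD(2)[OF this, of "(1/2)^n"] show ?thesis
      by (auto simp: eventually_sequentially)
  qed
  then obtain m :: "nat \<Rightarrow> nat" where m: "\<And>n. measure L {\<mu>. of_nat (Suc (m n)) < N n \<mu>} < (1/2)^n" by metis
  \<comment> \<open>On the likely event \<open>N n \<mu> \<le> Suc (m n)\<close> the
    \<open>n\<close>-th term of the pairing is at most (1/2)^n; and \<open>c\<close> itself is
    summable, so \<open>h\<close> is finite.\<close>
  define c where "c = (\<lambda>n. (1/2)^n / real (Suc (m n)))"
  have c_pos: "0 < c n" for n by (simp add: c_def del: of_nat_Suc)
  have c_le: "c n \<le> (1/2)^n" for n by (simp add: c_def divide_le_eq mult_le_cancel_left1 del: of_nat_Suc)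
  have sum_c: "summable c"
    by (rule summable_comparison_test'[OF summable_geometric[of "1/2"], of 0]) (use c_pos c_le in \<open>auto simp: abs_of_pos\<close>)
  define h where "h = (\<lambda>x. \<Sum>n. c n * indicator {-real n..real n} x)"
  have sum_h: "summable (\<lambda>n. c n * indicator {-real n..real n} x)" for x :: real
    by (rule summable_comparison_test'[OF sum_c, of 0]) (use c_pos in \<open>auto simp: abs_mult indicator_def less_imp_le\<close>)
  have h_nn: "0 \<le> h x" for x unfolding h_def using c_pos by (intro suminf_nonneg sum_h) (simp add: less_imp_le)
  have h_pos: "0 < h x" for x
  proof -
    obtain k :: nat where "\<bar>x\<bar> < k" using reals_Archimedean2 by blast
    then have "0 < c k * indicator {-real k..real k} x" using c_pos by (simp add: abs_less_iff less_imp_le)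
    then show ?thesis unfolding h_def using c_pos by (intro suminf_pos2[OF sum_h, of _ k]) (auto simp: less_imp_le)
  qed
  have [measurable]: "h \<in> borel_measurable borel" unfolding h_def by measurable
  have pair: "pairing \<mu> h = (\<Sum>n. ennreal (c n) * N n \<mu>)" for \<mu>
  proof -
    have "ennreal (h x) = (\<Sum>n. ennreal (c n) * indicator {-real n..real n} x)" for x
    proof -
      have "(\<Sum>n. ennreal (c n * indicator {-real n..real n} x)) = ennreal (h x)"
        unfolding h_def using c_pos by (intro suminf_ennreal2 sum_h) (simp add: less_imp_le)
      moreover have "ennreal (c n * indicator {-real n..real n} x) = ennreal (c n) * indicator {-real n..real n} x" for n
        using c_pos[of n] by (simp add: indicator_def)
      ultimately show ?thesis by simp
    qed
    then show ?thesis unfolding pairing_def N_def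
      by (simp add: nn_integral_suminf nn_integral_cmult)
  qed
  have "AE \<mu> in L. \<forall>\<^sub>F n in sequentially. \<mu> \<in> space L - {\<mu> \<in> space L. of_nat (Suc (m n)) < N n \<mu>}"
  proof (rule borel_cantelli_AE1)
    show "summable (\<lambda>n. measure L {\<mu> \<in> space L. of_nat (Suc (m n)) < N n \<mu>})"
      by (rule summable_comparison_test'[OF summable_geometric[of "1/2"], of 0])
        (use m in \<open>auto simp: less_imp_le simp del: of_nat_Suc\<close>)
  qed (auto simp: less_top[symmetric])
  then have "AE \<mu> in L. pairing \<mu> h < \<top>"
  proof eventually_elim
    case (elim \<mu>)
    then obtain k where k: "\<And>n. k \<le> n \<Longrightarrow> N n \<mu> \<le> of_nat (Suc (m n))"
      by (auto simp: eventually_sequentially not_less)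
    have "ennreal (c (n + k)) * N (n + k) \<mu> \<le> ennreal ((1/2)^n)" for n
    proof -
      have "ennreal (c (n + k)) * N (n + k) \<mu> \<le> ennreal (c (n + k)) * ennreal (real (Suc (m (n + k))))"
        using k[of "n + k"] by (intro mult_left_mono) (auto simp: ennreal_of_nat_eq_real_of_nat)
      also have "\<dots> = ennreal ((1/2)^(n + k))"
        using c_pos[of "n + k"] by (subst ennreal_mult[symmetric]) (auto simp: c_def simp del: of_nat_Suc)
      also have "\<dots> \<le> ennreal ((1/2)^n)" by (intro ennreal_leI power_decreasing) auto
      finally show ?thesis .
    qed
    then have "(\<Sum>n. ennreal (c (n + k)) * N (n + k) \<mu>) \<le> (\<Sum>n. ennreal ((1/2)^n))" by (intro suminf_le) auto
    also have "\<dots> < \<top>" by (subst suminf_ennreal2) auto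
    finally have "(\<Sum>n. ennreal (c (n + k)) * N (n + k) \<mu>) < \<top>" .
    moreover have "(\<Sum>n<k. ennreal (c n) * N n \<mu>) < \<top>"
      using N_fin by (auto simp: ennreal_mult_less_top)
    ultimately show ?case unfolding pair
      by (subst suminf_offset[where i=k]) auto
  qed
  then show ?thesis using h_pos h_nn by (auto simp: adm_def intro!: exI[of _ h])
qed

end

lemma exp_add_exp_eq_1:
  fixes s t :: real
  assumes "0 < s" "0 < t"
  shows "exp (ln (s / (s + t))) + exp (ln (t / (s + t))) = 1"
proof -
  have "exp (ln (s / (s + t))) = s / (s + t)" "exp (ln (t / (s + t))) = t / (s + t)" using assms by auto
  moreover have "s / (s + t) + t / (s + t) = 1" using assms by (simp add: add_divide_distrib[symmetric])
  ultimately show ?thesis by simp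
qed

locale superposable_law = locfin_law +
  assumes superposition: "\<And>\<alpha> \<beta>. exp \<alpha> + exp \<beta> = 1 \<Longrightarrow>
     L = distr (L \<Otimes>\<^sub>M L) borel (\<lambda>(\<mu>, \<nu>). translate \<alpha> \<mu> + translate \<beta> \<nu>)"
begin

lemma lap_split:
  assumes [measurable]: "f \<in> borel_measurable borel" and ab: "exp \<alpha> + exp \<beta> = 1"
  shows "lap f = lap (\<lambda>x. f (x + \<alpha>)) * lap (\<lambda>x. f (x + \<beta>))"
proof -
  have "lap f = (\<integral>\<mu>. exp_neg (pairing \<mu> f) \<partial>distr (L \<Otimes>\<^sub>M L) borel (\<lambda>(\<mu>, \<nu>). translate \<alpha> \<mu> + translate \<beta> \<nu>))"
    unfolding lap_def by (subst superposition[OF ab]) simp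
  then show ?thesis by (simp add: lap_superposed)
qed

text \<open>Superposition speaks only of weights with sum 1. Applied to the function already shifted
  by ln (s + t), with weights s / (s + t) and t / (s + t), it becomes multiplicativity on the whole
  positive half-line in the parameter t = e^a.\<close>

lemma lap_split_ln:
  assumes [measurable]: "f \<in> borel_measurable borel" and st: "0 < s" "0 < t"
  shows "lap (\<lambda>x. f (x + ln (s + t))) = lap (\<lambda>x. f (x + ln s)) * lap (\<lambda>x. f (x + ln t))"
  using lap_split[of "\<lambda>x. f (x + ln (s + t))", OF _ exp_add_exp_eq_1[OF st]] st
  by (simp add: ln_div add.assoc)

text \<open>A multiplicative function that vanished at some t < 1 would vanish at 1 too; a larger t
  is an integer multiple of a number below 1.\<close>

lemma lap_shift_pos:
  assumes [measurable]: "f \<in> borel_measurable borel" and pos: "0 < lap f" and t: "0 < t"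
  shows "0 < lap (\<lambda>x. f (x + ln t))"
proof -
  define g where "g = (\<lambda>t. lap (\<lambda>x. f (x + ln t)))"
  have g_add: "g (s + t) = g s * g t" if "0 < s" "0 < t" for s t
    unfolding g_def using lap_split_ln[OF assms(1) that] .
  have g_nn: "0 \<le> g t" for t unfolding g_def by (rule lap_nonneg)
  have g1: "0 < g 1" using pos by (simp add: g_def)
  have small: "0 < g t" if "0 < t" "t \<le> 1" for t
  proof (cases "t = 1")
    case False
    then have "g 1 = g t * g (1 - t)" using g_add[of t "1 - t"] that by simp
    then show ?thesis using g1 g_nn[of t] by (cases "g t = 0") auto
  qed (use g1 in simp)
  have scaled: "0 < g (real (Suc n) * t)" if "0 < t" "t \<le> 1" for n t
  proof (induction n)
    case 0
    then show ?case using small that by simp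
  next
    case (Suc n)
    have "real (Suc (Suc n)) * t = real (Suc n) * t + t" by (simp add: algebra_simps)
    then have "g (real (Suc (Suc n)) * t) = g (real (Suc n) * t) * g t" using that by (simp add: g_add del: of_nat_Suc)
    then show ?case using Suc small that by simp
  qed
  obtain n :: nat where "t < n" using reals_Archimedean2 by blast
  then have "0 < g (real (Suc n) * (t / real (Suc n)))" using t by (intro scaled) (auto simp: divide_le_eq)
  then show ?thesis by (simp add: g_def del: of_nat_Suc)
qed

text \<open>Minus the logarithm of a positive multiplicative function is additive, and it is
  nonnegative because \<open>lap\<close> is at most 1; Cauchy's equation then leaves only linear
  solutions.\<close>

lemma kum_shift:
  assumes [measurable]: "f \<in> borel_measurable borel" and pos: "0 < lap f" and t: "0 < t"
  shows "kum (\<lambda>x. f (x + ln t)) = t * kum f"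
proof -
  have "kum (\<lambda>x. f (x + ln t)) = t * kum (\<lambda>x. f (x + ln 1))"
  proof (rule additive_nonneg_imp_linear[where k="\<lambda>t. kum (\<lambda>x. f (x + ln t))"])
    show "0 \<le> kum (\<lambda>x. f (x + ln t))" if "0 < t" for t
      using lap_shift_pos[OF assms(1,2) that] lap_le_1 by (simp add: kum_def)
    show "kum (\<lambda>x. f (x + ln (s + t))) = kum (\<lambda>x. f (x + ln s)) + kum (\<lambda>x. f (x + ln t))" if "0 < s" "0 < t" for s t
      using lap_shift_pos[OF assms(1,2) that(1)] lap_shift_pos[OF assms(1,2) that(2)]
      by (simp add: kum_def lap_split_ln[OF assms(1) that] ln_mult)
  qed (rule t)
  then show ?thesis by simp
qed

text \<open>For t < 1 the translate by ln t is one of two independent nonnegative summands of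
  \<open>Z\<close> and inherits finiteness from the sum. Shifts in the other direction are not
  reached in this way, so scaling of the Levy measure is first proved for nonpositive
  shifts.\<close>

lemma adm_shift:
  assumes f: "adm f" and t: "0 < t" "t \<le> 1"
  shows "adm (\<lambda>x. f (x + ln t))"
proof (cases "t = 1")
  case False
  interpret LL: pair_prob_space L L ..
  note [measurable] = admD(1)[OF f]
  have e: "exp (ln t) + exp (ln (1 - t)) = 1" using t False by simp
  have "AE \<mu> in distr (L \<Otimes>\<^sub>M L) borel (\<lambda>(\<mu>, \<nu>). translate (ln t) \<mu> + translate (ln (1 - t)) \<nu>). pairing \<mu> f < \<top>"
    using admD(3)[OF f] by (subst (asm) superposition[OF e])
  then have "AE p in L \<Otimes>\<^sub>M L. pairing (fst p) (\<lambda>x. f (x + ln t)) + pairing (snd p) (\<lambda>x. f (x + ln (1 - t))) < \<top>"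
    by (subst (asm) AE_distr_iff) (auto simp: case_prod_beta pairing_plus pairing_translate)
  then have "AE p in L \<Otimes>\<^sub>M L. pairing (fst p) (\<lambda>x. f (x + ln t)) < \<top>"
    by eventually_elim auto
  from LL.AE_pair[OF this] have "AE \<mu> in L. AE \<nu> in L. pairing \<mu> (\<lambda>x. f (x + ln t)) < \<top>" by simp
  then have "AE \<mu> in L. pairing \<mu> (\<lambda>x. f (x + ln t)) < \<top>" by simp
  then show ?thesis using f by (simp add: adm_def)
qed (use f in simp)

end

section \<open>Projective and decreasing limits\<close>

text \<open>Normalised to 0 at the origin, since the half-lines on both sides may have infinite
  mass.\<close>

definition dist_fun :: "locfin_measure \<Rightarrow> real \<Rightarrow> real" where
  "dist_fun \<mu> x = (if 0 \<le> x then measure (to_measure \<mu>) {0<..x} else - measure (to_measure \<mu>) {x<..0})"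

lemma emeasure_Ioc_finite: "emeasure (to_measure \<mu>) {a<..b} \<noteq> \<top>"
  using emeasure_to_measure_bounded[of "{a<..b}" \<mu>] by simp

lemma measure_Ioc_split:
  assumes "a \<le> b" "b \<le> c"
  shows "measure (to_measure \<mu>) {a<..c} = measure (to_measure \<mu>) {a<..b} + measure (to_measure \<mu>) {b<..c}"
proof -
  have "{a<..c} = {a<..b} \<union> {b<..c}" using assms by auto
  then show ?thesis
    by (simp only:) (rule measure_Union, auto simp: emeasure_Ioc_finite)
qed

lemma dist_fun_diff:
  assumes "a \<le> b"
  shows "dist_fun \<mu> b - dist_fun \<mu> a = measure (to_measure \<mu>) {a<..b}"
proof -
  consider "0 \<le> a" | "a < 0" "0 \<le> b" | "b < 0" by linarith
  then show ?thesis
  proof cases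
    case 1 then show ?thesis using measure_Ioc_split[of 0 a b \<mu>] assms by (simp add: dist_fun_def)
  next
    case 2 then show ?thesis using measure_Ioc_split[of a 0 b \<mu>] by (simp add: dist_fun_def)
  next
    case 3 then show ?thesis using measure_Ioc_split[of a b 0 \<mu>] assms by (simp add: dist_fun_def)
  qed
qed

lemma emeasure_eq_dist_fun:
  assumes "a \<le> b"
  shows "emeasure (to_measure \<mu>) {a<..b} = ennreal (dist_fun \<mu> b - dist_fun \<mu> a)"
  using dist_fun_diff[OF assms, of \<mu>] by (simp add: emeasure_eq_ennreal_measure emeasure_Ioc_finite)

lemma continuous_dist_fun: "continuous (at_right x) (dist_fun \<mu>)"
proof -
  have "(dist_fun \<mu> \<longlongrightarrow> dist_fun \<mu> x) (at_right x)"
  proof (rule tendsto_at_right_sequentially[where b="x + 1"])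
    fix S :: "nat \<Rightarrow> real"
    assume S: "\<And>n. x < S n" "\<And>n. S n < x + 1" "decseq S" "S \<longlonglongrightarrow> x"
    have "(\<lambda>n. measure (to_measure \<mu>) {x<..S n}) \<longlonglongrightarrow> measure (to_measure \<mu>) (\<Inter>n. {x<..S n})"
      using S(3) by (intro Lim_measure_decseq)
        (auto simp: decseq_def emeasure_Ioc_finite, meson order_trans)
    moreover have "(\<Inter>n. {x<..S n}) = {}"
    proof -
      have "\<exists>n. S n < y" if "x < y" for y
        using order_tendstoD(2)[OF S(4) that] by (auto simp: eventually_sequentially)
      then show ?thesis by (fastforce simp: not_le[symmetric])
    qed
    ultimately have "(\<lambda>n. measure (to_measure \<mu>) {x<..S n}) \<longlonglongrightarrow> 0" by simp
    then have "(\<lambda>n. dist_fun \<mu> (S n) - dist_fun \<mu> x) \<longlonglongrightarrow> 0"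
      using S(1) by (simp add: dist_fun_diff less_imp_le)
    then show "(\<lambda>n. dist_fun \<mu> (S n)) \<longlonglongrightarrow> dist_fun \<mu> x"
      by (simp add: LIM_zero_iff)
  qed simp
  then show ?thesis by (simp add: continuous_within)
qed

text \<open>A locally finite measure is encoded by the values of its distribution function at the
  rationals; unlike its range, a left inverse of this coding is easily seen to be measurable.\<close>

definition rat_above :: "real \<Rightarrow> nat \<Rightarrow> rat" where
  "rat_above x n = (SOME q. x < of_rat q \<and> of_rat q < x + 1 / real (Suc n))"

text \<open>One fixed sequence of rationals tending to \<open>x\<close> from the right is used, so
  that the value is a limit of countably many coordinates and measurable in \<open>X\<close>. For
  monotone \<open>X\<close> the choice of the sequence does not matter.\<close>

definition right_limit :: "(rat \<Rightarrow> real) \<Rightarrow> real \<Rightarrow> real" where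
  "right_limit X x = lim (\<lambda>n. X (rat_above x n))"

text \<open>Every monotone function is decoded, whether or not it arises from \<open>encode\<close>;
  anything else goes to the default 0.\<close>

definition decode :: "(rat \<Rightarrow> real) \<Rightarrow> locfin_measure" where
  "decode X = (if mono X then of_measure (interval_measure (right_limit X)) else 0)"

definition encode :: "locfin_measure \<Rightarrow> rat \<Rightarrow> real" where
  "encode \<mu> q = dist_fun \<mu> (of_rat q)"

lemma rat_above: "x < of_rat (rat_above x n)" "of_rat (rat_above x n) < x + 1 / real (Suc n)"
proof -
  have "\<exists>q. x < of_rat q \<and> of_rat q < x + 1 / real (Suc n)"
    by (rule of_rat_dense) simp
  from someI_ex[OF this] show "x < of_rat (rat_above x n)" "of_rat (rat_above x n) < x + 1 / real (Suc n)"
    by (simp_all add: rat_above_def)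
qed

lemma rat_above_tendsto: "(\<lambda>n. real_of_rat (rat_above x n)) \<longlonglongrightarrow> x"
proof (rule tendsto_sandwich[where f="\<lambda>_. x" and h="\<lambda>n. x + 1 / real (Suc n)"])
  show "(\<lambda>n. x + 1 / real (Suc n)) \<longlonglongrightarrow> x"
    using tendsto_add[OF tendsto_const LIMSEQ_inverse_real_of_nat, of x] by (simp add: inverse_eq_divide)
qed (use rat_above in \<open>auto intro!: always_eventually less_imp_le\<close>)

text \<open>Writing the limit as an infimum over the rationals to the right gives monotonicity and
  right continuity, the hypotheses of the Stieltjes construction.\<close>

lemma mono_right_limit:
  assumes "mono X"
  shows "right_limit X x = Inf (X ` {q. x < of_rat q})"
    and "x < of_rat q \<Longrightarrow> Inf (X ` {q. x < of_rat q}) \<le> X q"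
    and "Inf (X ` {q. x < of_rat q}) < c \<Longrightarrow> \<exists>q. x < of_rat q \<and> X q < c"
proof -
  let ?S = "X ` {q. x < of_rat q}"
  have bdd: "bdd_below ?S"
  proof -
    obtain p where p: "x - 1 < of_rat p" "of_rat p < x" using of_rat_dense[of "x - 1" x] by auto
    have "X p \<le> X q" if "x < of_rat q" for q
    proof -
      have "p \<le> q" using p that by (metis less_trans less_imp_le of_rat_less)
      then show ?thesis using assms by (rule monoD[rotated])
    qed
    then show ?thesis by (auto intro!: bdd_belowI)
  qed
  have ne: "?S \<noteq> {}" using rat_above(1)[of x 0] by auto
  show le: "Inf ?S \<le> X q" if "x < of_rat q" for q
    using that by (intro cInf_lower bdd) auto
  show ex: "\<exists>q. x < of_rat q \<and> X q < c" if "Inf ?S < c" for c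
    using that cInf_less_iff[OF ne bdd] by auto
  have "(\<lambda>n. X (rat_above x n)) \<longlonglongrightarrow> Inf ?S"
  proof (rule order_tendstoI)
    fix a assume "a < Inf ?S"
    then show "\<forall>\<^sub>F n in sequentially. a < X (rat_above x n)"
      using le[OF rat_above(1)] by (auto intro: always_eventually less_le_trans)
  next
    fix a assume "Inf ?S < a"
    then obtain q where q: "x < of_rat q" "X q < a" using ex by blast
    from order_tendstoD(2)[OF rat_above_tendsto q(1)]
    show "\<forall>\<^sub>F n in sequentially. X (rat_above x n) < a"
    proof eventually_elim
      case (elim n)
      then have "rat_above x n \<le> q" by (simp add: of_rat_less)
      then have "X (rat_above x n) \<le> X q" using assms by (rule monoD[rotated])
      with q show ?case by simp
    qed
  qed
  then show "right_limit X x = Inf ?S" unfolding right_limit_def by (rule limI)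
qed

lemma right_limit_mono:
  assumes "mono X" "x \<le> y"
  shows "right_limit X x \<le> right_limit X y"
proof (rule ccontr)
  assume "\<not> ?thesis"
  then have "Inf (X ` {q. y < of_rat q}) < right_limit X x" by (simp add: mono_right_limit(1)[OF assms(1)])
  from mono_right_limit(3)[OF assms(1) this] obtain q where q: "y < of_rat q" "X q < right_limit X x" by blast
  then have "right_limit X x \<le> X q" using mono_right_limit(2)[OF assms(1), of x q] assms(2)
    by (simp add: mono_right_limit(1)[OF assms(1)])
  with q show False by simp
qed

lemma right_limit_continuous:
  assumes "mono X"
  shows "continuous (at_right x) (right_limit X)"
proof -
  have "(right_limit X \<longlongrightarrow> right_limit X x) (at_right x)"
  proof (rule order_tendstoI)
    fix a assume "a < right_limit X x"
    then show "\<forall>\<^sub>F y in at_right x. a < right_limit X y"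
      using right_limit_mono[OF assms, of x]
      by (intro eventually_at_right_less[THEN eventually_mono]) (auto intro: less_le_trans)
  next
    fix a assume "right_limit X x < a"
    then obtain q where q: "x < of_rat q" "X q < a"
      using mono_right_limit(3)[OF assms, of x a] by (auto simp: mono_right_limit(1)[OF assms])
    have "right_limit X y < a" if "x < y" "y < of_rat q" for y
      using mono_right_limit(2)[OF assms, of y q] q that by (simp add: mono_right_limit(1)[OF assms])
    then show "\<forall>\<^sub>F y in at_right x. right_limit X y < a"
      using q(1) by (auto simp: eventually_at_right)
  qed
  then show ?thesis by (simp add: continuous_within)
qed

lemma emeasure_decode:
  assumes "mono X" "a \<le> b"
  shows "emeasure (to_measure (decode X)) {a<..b} = ennreal (right_limit X b - right_limit X a)"
proof -
  have Ioc: "emeasure (interval_measure (right_limit X)) {a<..b} = ennreal (right_limit X b - right_limit X a)"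
    if "a \<le> b" for a b
    by (rule emeasure_interval_measure_Ioc[OF that]) (auto intro: right_limit_mono right_limit_continuous assms)
  have "emeasure (interval_measure (right_limit X)) A < \<infinity>" if A: "A \<in> sets borel" "bounded A" for A
  proof -
    obtain R where R: "0 < R" "\<And>x. x \<in> A \<Longrightarrow> \<bar>x\<bar> < R" using A(2) by (auto simp: bounded_pos_less)
    have "emeasure (interval_measure (right_limit X)) A \<le> emeasure (interval_measure (right_limit X)) {-R<..R}"
      using R(2) by (intro emeasure_mono) (auto simp: abs_less_iff less_imp_le, (metis minus_less_iff)?)
    also have "\<dots> < \<infinity>" using R(1) by (subst Ioc) auto
    finally show ?thesis .
  qed
  then have "to_measure (decode X) = interval_measure (right_limit X)"
    using assms(1) by (simp add: decode_def of_measure_inverse)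
  then show ?thesis using Ioc[OF assms(2)] by simp
qed

lemma right_limit_eq:
  assumes "continuous (at_right x) G" "\<And>q. X q = G (of_rat q)"
  shows "right_limit X x = G x"
proof -
  have "filterlim (\<lambda>n. real_of_rat (rat_above x n)) (at_right x) sequentially"
    unfolding filterlim_at using rat_above_tendsto rat_above(1)
    by (auto intro!: always_eventually simp: less_imp_neq[symmetric]) (metis less_irrefl rat_above(1))?
  then have "(\<lambda>n. G (real_of_rat (rat_above x n))) \<longlonglongrightarrow> G x"
    using assms(1) by (auto simp: continuous_within intro: filterlim_compose)
  then show ?thesis unfolding right_limit_def assms(2) by (rule limI)
qed

lemma mono_encode: "mono (encode \<mu>)"
proof (rule monoI)
  fix p q :: rat assume "p \<le> q"
  then have "0 \<le> dist_fun \<mu> (of_rat q) - dist_fun \<mu> (of_rat p)"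
    by (subst dist_fun_diff) (simp_all add: of_rat_less_eq)
  then show "encode \<mu> p \<le> encode \<mu> q" by (simp add: encode_def)
qed

lemma decode_encode: "decode (encode \<mu>) = \<mu>"
proof (rule locfin_measure_eqI)
  fix a b :: real assume "a < b"
  have "right_limit (encode \<mu>) x = dist_fun \<mu> x" for x
    by (rule right_limit_eq[OF continuous_dist_fun]) (simp add: encode_def)
  then show "emeasure (to_measure (decode (encode \<mu>))) {a<..b} = emeasure (to_measure \<mu>) {a<..b}"
    using \<open>a < b\<close> emeasure_decode[OF mono_encode, of a b \<mu>] emeasure_eq_dist_fun[of a b \<mu>] by simp
qed

definition below :: "locfin_measure \<Rightarrow> locfin_measure \<Rightarrow> bool" where
  "below \<mu> \<nu> \<longleftrightarrow> (\<exists>\<kappa>. \<nu> = \<mu> + \<kappa>)"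

text \<open>Replaces the existence of a complement \<open>\<kappa>\<close> by countably many
  inequalities, which makes \<open>below\<close> measurable. Conversely the monotone difference of
  the codes decodes to the complement.\<close>

lemma below_iff_encode: "below \<mu> \<nu> \<longleftrightarrow> mono (\<lambda>q. encode \<nu> q - encode \<mu> q)"
proof
  assume "below \<mu> \<nu>"
  then obtain \<kappa> where \<kappa>: "\<nu> = \<mu> + \<kappa>" by (auto simp: below_def)
  show "mono (\<lambda>q. encode \<nu> q - encode \<mu> q)"
  proof (rule monoI)
    fix p q :: rat assume "p \<le> q"
    then have pq: "real_of_rat p \<le> real_of_rat q" by (simp add: of_rat_less_eq)
    let ?I = "{real_of_rat p<..real_of_rat q}"
    have "ennreal (measure (to_measure \<nu>) ?I) = ennreal (measure (to_measure \<mu>) ?I) + ennreal (measure (to_measure \<kappa>) ?I)"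
      using emeasure_plus_locfin[of ?I \<mu> \<kappa>] \<kappa>
      by (simp add: emeasure_eq_ennreal_measure[OF emeasure_Ioc_finite])
    then have "measure (to_measure \<mu>) ?I \<le> measure (to_measure \<nu>) ?I"
      by (simp add: ennreal_plus[symmetric] del: ennreal_plus)
    then show "encode \<nu> p - encode \<mu> p \<le> encode \<nu> q - encode \<mu> q"
      using dist_fun_diff[OF pq, of \<mu>] dist_fun_diff[OF pq, of \<nu>] by (simp add: encode_def)
  qed
next
  assume m: "mono (\<lambda>q. encode \<nu> q - encode \<mu> q)"
  define \<kappa> where "\<kappa> = decode (\<lambda>q. encode \<nu> q - encode \<mu> q)"
  have "\<nu> = \<mu> + \<kappa>"
  proof (rule locfin_measure_eqI)
    fix a b :: real assume "a < b"
    have rl: "right_limit (\<lambda>q. encode \<nu> q - encode \<mu> q) x = dist_fun \<nu> x - dist_fun \<mu> x" for x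
      by (rule right_limit_eq[where G="\<lambda>x. dist_fun \<nu> x - dist_fun \<mu> x"])
        (auto simp: encode_def intro!: continuous_intros continuous_dist_fun)
    have "0 \<le> dist_fun \<mu> b - dist_fun \<mu> a" using dist_fun_diff[of a b \<mu>] \<open>a < b\<close> by simp
    moreover have "0 \<le> (dist_fun \<nu> b - dist_fun \<mu> b) - (dist_fun \<nu> a - dist_fun \<mu> a)"
      using right_limit_mono[OF m, of a b] \<open>a < b\<close> by (simp add: rl)
    ultimately show "emeasure (to_measure \<nu>) {a<..b} = emeasure (to_measure (\<mu> + \<kappa>)) {a<..b}"
      using \<open>a < b\<close> emeasure_plus_locfin[of "{a<..b}" \<mu> \<kappa>] emeasure_decode[OF m, of a b]
        emeasure_eq_dist_fun[of a b \<mu>] emeasure_eq_dist_fun[of a b \<nu>]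
      unfolding \<kappa>_def[symmetric]
      by (simp add: rl ennreal_plus[symmetric] algebra_simps del: ennreal_plus)
  qed
  then show "below \<mu> \<nu>" by (auto simp: below_def)
qed

lemma measurable_dist_fun [measurable]: "(\<lambda>\<mu>. dist_fun \<mu> x) \<in> borel_measurable borel"
  unfolding dist_fun_def measure_def by measurable

lemma measurable_encode [measurable]: "encode \<in> borel_measurable borel"
  by (rule measurable_coordinatewise_then_product) (simp add: encode_def)

lemma measurable_decode [measurable]: "decode \<in> borel_measurable borel"
proof (rule measurable_locfinI)
  fix a b :: real
  have [measurable]: "(\<lambda>X :: rat \<Rightarrow> real. X q) \<in> borel_measurable borel" for q
    by (rule measurable_product_coordinates)
  have [measurable]: "Measurable.pred borel (\<lambda>X :: rat \<Rightarrow> real. mono X)"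
    unfolding mono_def
  proof (intro pred_intros_countable pred_intros_imp')
    fix p q :: rat
    show "Measurable.pred borel (\<lambda>X :: rat \<Rightarrow> real. X p \<le> X q)"
      unfolding pred_def
      by (rule borel_measurable_le) (rule measurable_product_coordinates)+
  qed
  have [measurable]: "(\<lambda>X. right_limit X x) \<in> borel_measurable borel" for x
    unfolding right_limit_def by (rule borel_measurable_lim_metric) measurable
  have "emeasure (to_measure (decode X)) {a<..b} =
    (if mono X \<and> a \<le> b then ennreal (right_limit X b - right_limit X a) else 0)" for X
    by (cases "mono X"; cases "a \<le> b") (auto simp: emeasure_decode, auto simp: decode_def emeasure_zero_locfin)
  then show "(\<lambda>X. emeasure (to_measure (decode X)) {a<..b}) \<in> borel_measurable borel" by simp
qed

section \<open>Projective limits of laws of sequences of measures\<close>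

abbreviation seqM :: "(nat \<Rightarrow> locfin_measure) measure" where
  "seqM \<equiv> PiM UNIV (\<lambda>_. borel)"

text \<open>Freezing the sequence at index \<open>k\<close>, instead of restricting it to
  \<open>{..k}\<close>, keeps all laws on the one space \<open>seqM\<close>.\<close>

definition trunc :: "nat \<Rightarrow> (nat \<Rightarrow> 'a) \<Rightarrow> nat \<Rightarrow> 'a" where
  "trunc k s = (\<lambda>i. s (min i k))"

lemma measurable_seqMI:
  assumes "\<And>i. (\<lambda>w. f w i) \<in> borel_measurable N"
  shows "f \<in> measurable N seqM"
  using assms by (intro measurable_PiM_single') auto

lemma measurable_trunc [measurable]: "trunc k \<in> measurable seqM seqM"
  unfolding trunc_def by (rule measurable_seqMI) simp

lemma trunc_trunc: "trunc m (trunc n s) = trunc (min m n) s"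
  by (simp add: trunc_def min.assoc)

text \<open>Kolmogorov extension is applied to the codes, which live in the Polish space of real
  functions on the rationals. As \<open>decode\<close> is a measurable left inverse of
  \<open>encode\<close>, the extended law can be carried back to measures.\<close>

theorem projective_limit_locfin:
  fixes Q :: "nat \<Rightarrow> (nat \<Rightarrow> locfin_measure) measure"
  assumes prob: "\<And>k. prob_space (Q k)" and sets: "\<And>k. sets (Q k) = sets seqM"
    and consistent: "\<And>k. distr (Q (Suc k)) seqM (trunc k) = distr (Q k) seqM (trunc k)"
  shows "\<exists>R. prob_space R \<and> sets R = sets seqM \<and> (\<forall>k. distr R seqM (trunc k) = distr (Q k) seqM (trunc k))"
proof -
  note [measurable_cong] = sets
  have cons: "distr (Q n) seqM (trunc m) = distr (Q m) seqM (trunc m)" if "m \<le> n" for m n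
    using that
  proof (induction n rule: dec_induct)
    case (step n)
    have "distr (Q (Suc n)) seqM (trunc m) = distr (distr (Q (Suc n)) seqM (trunc n)) seqM (trunc m)"
      using step(1) by (subst distr_distr) (auto simp: comp_def trunc_trunc min_def)
    also have "\<dots> = distr (distr (Q n) seqM (trunc n)) seqM (trunc m)" by (simp add: consistent)
    also have "\<dots> = distr (Q n) seqM (trunc m)"
      using step(1) by (subst distr_distr) (auto simp: comp_def trunc_trunc min_def)
    finally show ?case using step by simp
  qed simp
  define B where "B = (\<lambda>J::nat set. PiM J (\<lambda>_. borel :: (rat \<Rightarrow> real) measure))"
  define enc where "enc = (\<lambda>J (s::nat \<Rightarrow> locfin_measure). restrict (\<lambda>i. encode (s i)) J)"
  have enc_meas[measurable]: "enc J \<in> measurable seqM (B J)" for J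
    unfolding enc_def B_def by (intro measurable_restrict) measurable
  \<comment> \<open>By consistency any \<open>Q n\<close> with \<open>n\<close> an upper bound of
    \<open>J\<close> gives the same law; inserting 0 provides a maximum for the empty set.\<close>
  define P where "P = (\<lambda>J. distr (Q (Max (insert 0 J))) (B J) (enc J))"
  have P_eq: "P J = distr (Q n) (B J) (enc J)" if "finite J" "\<And>j. j \<in> J \<Longrightarrow> j \<le> n" for J n
  proof -
    let ?m = "Max (insert 0 J)"
    have m: "?m \<le> n" "\<And>j. j \<in> J \<Longrightarrow> j \<le> ?m" using that by auto
    have e: "enc J (trunc ?m s) = enc J s" for s
      using m(2) unfolding enc_def trunc_def by (intro restrict_ext) (simp add: min_def)
    have *: "distr (distr (Q k) seqM (trunc ?m)) (B J) (enc J) = distr (Q k) (B J) (enc J)" for k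
      by (subst distr_distr) (auto simp: comp_def e)
    show ?thesis unfolding P_def using *[of n] *[of ?m] cons[OF m(1)] by simp
  qed
  interpret pp: polish_projective UNIV P
  proof (rule polish_projective.intro, rule projective_family.intro)
    fix J H :: "nat set" assume JH: "J \<subseteq> H" "finite H" "H \<subseteq> UNIV"
    have fJ: "finite J" using JH finite_subset by blast
    have rm: "(\<lambda>f. restrict f J) \<in> measurable (B H) (B J)"
      unfolding B_def using JH by (intro measurable_restrict_subset) auto
    let ?n = "Max (insert 0 H)"
    have H_le: "\<And>j. j \<in> H \<Longrightarrow> j \<le> ?n" using JH by auto
    have PH: "P H = distr (Q ?n) (B H) (enc H)" by (rule P_eq[OF JH(2) H_le])
    have "distr (P H) (B J) (\<lambda>f. restrict f J) = distr (Q ?n) (B J) ((\<lambda>f. restrict f J) \<circ> enc H)"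
      unfolding PH by (rule distr_distr[OF rm]) measurable
    also have "(\<lambda>f. restrict f J) \<circ> enc H = enc J"
      using JH by (auto simp: comp_def enc_def Int_absorb1)
    finally have "distr (P H) (B J) (\<lambda>f. restrict f J) = distr (Q ?n) (B J) (enc J)" .
    also have "\<dots> = P J" using JH H_le by (intro P_eq[symmetric] fJ) auto
    finally show "P J = distr (P H) (PiM J (\<lambda>_. borel)) (\<lambda>f. restrict f J)" by (simp add: B_def)
  next
    fix J :: "nat set"
    show "prob_space (P J)" unfolding P_def
      by (intro prob_space.prob_space_distr prob) measurable
  qed
  have lim_restrict: "distr pp.lim (B J) (\<lambda>f. restrict f J) = P J" if J: "finite J" for J
  proof (rule measure_eqI)
    have s: "sets (P J) = sets (B J)" by (simp add: P_def)
    then show "sets (distr pp.lim (B J) (\<lambda>f. restrict f J)) = sets (P J)" by simp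
    fix A assume "A \<in> sets (distr pp.lim (B J) (\<lambda>f. restrict f J))"
    then have A: "A \<in> sets (PiM J (\<lambda>_. borel))" by (simp add: B_def)
    have "emeasure (distr pp.lim (B J) (\<lambda>f. restrict f J)) A = emeasure pp.lim (pp.emb UNIV J A)"
    proof (subst emeasure_distr)
      show "(\<lambda>f. restrict f J) \<in> measurable pp.lim (B J)"
        unfolding B_def by (subst measurable_cong_sets[OF pp.sets_lim refl]) (rule measurable_restrict_subset, simp)
    qed (use A in \<open>auto simp: B_def prod_emb_def space_PiM PiE_UNIV_domain\<close>)
    also have "\<dots> = emeasure (P J) A" using J A by (intro pp.emeasure_lim_emb) auto
    finally show "emeasure (distr pp.lim (B J) (\<lambda>f. restrict f J)) A = emeasure (P J) A" .
  qed
  have [measurable_cong]: "sets pp.lim = sets (PiM UNIV (\<lambda>_. borel :: (rat \<Rightarrow> real) measure))" by simp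
  define dec where "dec = (\<lambda>(w::nat \<Rightarrow> rat \<Rightarrow> real) i. decode (w i))"
  have [measurable]: "dec \<in> measurable (PiM UNIV (\<lambda>_. borel)) seqM"
    unfolding dec_def by (rule measurable_seqMI) measurable
  define R where "R = distr pp.lim seqM dec"
  have "distr R seqM (trunc k) = distr (Q k) seqM (trunc k)" for k
  proof -
    define g where "g = (\<lambda>(w::nat \<Rightarrow> rat \<Rightarrow> real) i. decode (w (min i k)))"
    have [measurable]: "g \<in> measurable (B {..k}) seqM"
      unfolding g_def B_def by (rule measurable_seqMI) (auto intro!: measurable_compose[OF measurable_component_singleton])
    have [measurable]: "(\<lambda>f. restrict f {..k}) \<in> measurable pp.lim (B {..k})"
      unfolding B_def by (subst measurable_cong_sets[OF pp.sets_lim refl]) (rule measurable_restrict_subset, simp)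
    have "distr R seqM (trunc k) = distr pp.lim seqM (\<lambda>w. trunc k (dec w))"
      unfolding R_def by (subst distr_distr) (auto simp: comp_def)
    also have "(\<lambda>w. trunc k (dec w)) = (\<lambda>w. g (restrict w {..k}))"
      by (auto simp: trunc_def dec_def g_def)
    also have "distr pp.lim seqM (\<lambda>w. g (restrict w {..k})) = distr (P {..k}) seqM g"
      by (subst lim_restrict[symmetric]) (auto simp: distr_distr comp_def)
    also have "\<dots> = distr (Q k) seqM (\<lambda>s. g (enc {..k} s))"
      by (subst P_eq[of "{..k}" k]) (auto simp: distr_distr comp_def)
    also have "(\<lambda>s. g (enc {..k} s)) = trunc k"
      by (auto simp: g_def enc_def trunc_def decode_encode)
    finally show ?thesis .
  qed
  moreover have "prob_space R" unfolding R_def by (intro pp.P.prob_space_distr) measurable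
  moreover have "sets R = sets seqM" by (simp add: R_def)
  ultimately show ?thesis by blast
qed

section \<open>Limits of decreasing sequences of measures\<close>

lemma below_density:
  assumes "below \<mu> \<nu>"
  shows "\<exists>r\<in>borel_measurable borel. (\<forall>x. r x \<le> (1::ennreal)) \<and> to_measure \<mu> = density (to_measure \<nu>) r"
proof -
  obtain \<kappa> where \<kappa>: "\<nu> = \<mu> + \<kappa>" using assms by (auto simp: below_def)
  have le: "emeasure (to_measure \<mu>) A \<le> emeasure (to_measure \<nu>) A" if "A \<in> sets borel" for A
    using that by (simp add: \<kappa> emeasure_plus_locfin)
  interpret \<nu>: sigma_finite_measure "to_measure \<nu>" by (rule sigma_finite_to_measure)
  have "absolutely_continuous (to_measure \<nu>) (to_measure \<mu>)"
    unfolding absolutely_continuous_def null_sets_def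
  proof safe
    fix N assume "N \<in> sets (to_measure \<nu>)" "emeasure (to_measure \<nu>) N = 0"
    then show "emeasure (to_measure \<mu>) N = 0" using le[of N] by simp
  qed simp
  then obtain f where f: "f \<in> borel_measurable (to_measure \<nu>)" and d: "density (to_measure \<nu>) f = to_measure \<mu>"
    using \<nu>.Radon_Nikodym[of "to_measure \<mu>"] by auto
  have [measurable]: "f \<in> borel_measurable borel"
    using f measurable_cong_sets[OF sets_to_measure refl] by blast
  have "AE x in to_measure \<nu>. f x \<le> 1"
  proof -
    have "AE x in to_measure \<nu>. \<bar>x\<bar> \<le> real n \<longrightarrow> f x \<le> 1" for n
    proof -
      define A where "A = {x. 1 < f x \<and> \<bar>x\<bar> \<le> real n}"
      have "{x \<in> space borel. 1 < f x \<and> \<bar>x\<bar> \<le> real n} \<in> sets borel" by measurable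
      then have A[measurable]: "A \<in> sets borel" by (simp add: A_def)
      have "bounded A" by (auto simp: A_def bounded_iff intro!: exI[of _ "real n"])
      then have fin: "emeasure (to_measure \<nu>) A \<noteq> \<top>" using emeasure_to_measure_bounded[of A \<nu>] A by simp
      \<comment> \<open>On \<open>A\<close> the density exceeds 1, so the excess over
        \<open>\<nu>\<close> would give \<open>\<mu>\<close> too much mass; the cut at
        \<open>n\<close> makes the mass of \<open>A\<close> finite, so it can be cancelled.\<close>
      have "emeasure (to_measure \<nu>) A + (\<integral>\<^sup>+x. (f x - 1) * indicator A x \<partial>to_measure \<nu>) =
        (\<integral>\<^sup>+x. indicator A x + (f x - 1) * indicator A x \<partial>to_measure \<nu>)"
        by (subst nn_integral_add) auto
      also have "\<dots> = (\<integral>\<^sup>+x. f x * indicator A x \<partial>to_measure \<nu>)"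
        by (intro nn_integral_cong) (auto simp: A_def indicator_def add_diff_inverse_ennreal less_imp_le)
      also have "\<dots> = emeasure (to_measure \<mu>) A"
        unfolding d[symmetric] by (subst emeasure_density) auto
      also have "\<dots> \<le> emeasure (to_measure \<nu>) A + 0" using le[OF A] by simp
      finally have "(\<integral>\<^sup>+x. (f x - 1) * indicator A x \<partial>to_measure \<nu>) = 0"
        using fin by (simp add: ennreal_add_left_cancel_le)
      then have "AE x in to_measure \<nu>. (f x - 1) * indicator A x = 0"
        by (subst (asm) nn_integral_0_iff_AE) auto
      then show ?thesis
        by eventually_elim (auto simp: A_def indicator_def diff_eq_0_iff_ennreal split: if_splits)
    qed
    then have "AE x in to_measure \<nu>. \<forall>n. \<bar>x\<bar> \<le> real n \<longrightarrow> f x \<le> 1"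
      by (intro AE_all_countable[THEN iffD2] allI)
    then show ?thesis
    proof eventually_elim
      case (elim x)
      obtain n :: nat where "\<bar>x\<bar> < n" using reals_Archimedean2 by blast
      with elim show ?case by (meson less_imp_le)
    qed
  qed
  \<comment> \<open>A change on a null set turns the bound by 1 from almost everywhere into
    everywhere.\<close>
  then have "density (to_measure \<nu>) (\<lambda>x. min (f x) 1) = density (to_measure \<nu>) f"
    by (intro density_cong) (auto simp: min_def)
  then show ?thesis using d by (intro bexI[of _ "\<lambda>x. min (f x) 1"]) auto
qed

text \<open>The successive densities are at most 1, so their products decrease pointwise to some
  \<open>G\<close>, and the limit is the measure with density \<open>G\<close> against the first
  one. Finiteness of the first pairing is the domination.\<close>

lemma decreasing_limit_exists:
  assumes "\<And>k. below (s (Suc k)) (s k)"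
  shows "\<exists>m. \<forall>f\<in>borel_measurable borel. pairing (s 0) f < \<top> \<longrightarrow> (\<lambda>k. pairing (s k) f) \<longlonglongrightarrow> pairing m f"
proof -
  have "\<forall>k. \<exists>r. r \<in> borel_measurable borel \<and> (\<forall>x. r x \<le> (1::ennreal)) \<and> to_measure (s (Suc k)) = density (to_measure (s k)) r"
    using below_density[OF assms] by blast
  then obtain r where r: "\<And>k. r k \<in> borel_measurable borel" "\<And>k x. r k x \<le> (1::ennreal)"
    "\<And>k. to_measure (s (Suc k)) = density (to_measure (s k)) (r k)" by metis
  note [measurable] = r(1)
  define g where "g = (\<lambda>k x. \<Prod>i<k. r i x)"
  have [measurable]: "g k \<in> borel_measurable borel" for k unfolding g_def by measurable
  have g: "to_measure (s k) = density (to_measure (s 0)) (g k)" for k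
  proof (induction k)
    case 0
    then show ?case by (simp add: g_def density_1)
  next
    case (Suc k)
    have "to_measure (s (Suc k)) = density (density (to_measure (s 0)) (g k)) (r k)" using r(3)[of k] Suc by simp
    also have "\<dots> = density (to_measure (s 0)) (\<lambda>x. g k x * r k x)" by (rule density_density_eq) auto
    finally show ?case by (simp add: g_def)
  qed
  have g_le: "g k x \<le> 1" for k x unfolding g_def using r(2) by (intro prod_le_1) auto
  have g_dec: "decseq (\<lambda>k. g k x)" for x
  proof (rule decseq_SucI)
    fix k
    have "g (Suc k) x = g k x * r k x" by (simp add: g_def)
    also have "\<dots> \<le> g k x * 1" using r(2) by (intro mult_left_mono) auto
    finally show "g (Suc k) x \<le> g k x" by simp
  qed
  define G where "G = (\<lambda>x. INF k. g k x)"
  have [measurable]: "G \<in> borel_measurable borel" unfolding G_def by measurable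
  have G_lim: "(\<lambda>k. g k x) \<longlonglongrightarrow> G x" for x unfolding G_def by (rule LIMSEQ_INF[OF g_dec])
  have G_le: "G x \<le> 1" for x unfolding G_def using g_le by (auto intro: INF_lower2)
  have G_top: "G x \<noteq> \<top>" for x using G_le[of x] by (auto simp: top_unique)
  have dG: "emeasure (density (to_measure (s 0)) G) A < \<infinity>" if "A \<in> sets borel" "bounded A" for A
  proof -
    have "emeasure (density (to_measure (s 0)) G) A = (\<integral>\<^sup>+x. G x * indicator A x \<partial>to_measure (s 0))"
      using that by (subst emeasure_density) auto
    also have "\<dots> \<le> (\<integral>\<^sup>+x. indicator A x \<partial>to_measure (s 0))"
      using G_le by (intro nn_integral_mono) (auto simp: indicator_def)
    also have "\<dots> < \<infinity>" using that emeasure_to_measure_bounded by simp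
    finally show ?thesis .
  qed
  define m where "m = of_measure (density (to_measure (s 0)) G)"
  have m: "to_measure m = density (to_measure (s 0)) G"
    unfolding m_def using dG by (intro of_measure_inverse) auto
  show ?thesis
  proof (intro exI[of _ m] ballI impI)
    fix f :: "real \<Rightarrow> real" assume [measurable]: "f \<in> borel_measurable borel" and fin: "pairing (s 0) f < \<top>"
    have p: "pairing (s k) f = (\<integral>\<^sup>+x. g k x * ennreal (f x) \<partial>to_measure (s 0))" for k
      unfolding pairing_def by (subst g) (simp add: nn_integral_density)
    have pm: "pairing m f = (\<integral>\<^sup>+x. G x * ennreal (f x) \<partial>to_measure (s 0))"
      unfolding pairing_def m by (simp add: nn_integral_density)
    show "(\<lambda>k. pairing (s k) f) \<longlonglongrightarrow> pairing m f"
      unfolding p pm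
    proof (rule nn_integral_dominated_convergence[where w="\<lambda>x. ennreal (f x)"])
      show "(\<integral>\<^sup>+ x. ennreal (f x) \<partial>to_measure (s 0)) < \<infinity>" using fin by (simp add: pairing_def)
      show "AE x in to_measure (s 0). g j x * ennreal (f x) \<le> ennreal (f x)" for j
        using mult_right_mono[OF g_le, of "ennreal (f _)" j] by (auto intro!: AE_I2)
      show "AE x in to_measure (s 0). (\<lambda>i. g i x * ennreal (f x)) \<longlonglongrightarrow> G x * ennreal (f x)"
        using G_lim G_top by (auto intro!: AE_I2 tendsto_mult_ennreal)
    qed auto
  qed
qed

definition lim_locfin :: "(nat \<Rightarrow> locfin_measure) \<Rightarrow> locfin_measure" where
  "lim_locfin s = (if \<forall>k. below (s (Suc k)) (s k)
     then SOME m. \<forall>f\<in>borel_measurable borel. pairing (s 0) f < \<top> \<longrightarrow> (\<lambda>k. pairing (s k) f) \<longlonglongrightarrow> pairing m f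
     else 0)"

lemma tendsto_lim_locfin:
  assumes "\<And>k. below (s (Suc k)) (s k)" "f \<in> borel_measurable borel" "pairing (s 0) f < \<top>"
  shows "(\<lambda>k. pairing (s k) f) \<longlonglongrightarrow> pairing (lim_locfin s) f"
  using someI_ex[OF decreasing_limit_exists[of s, OF assms(1)]] assms by (simp add: lim_locfin_def)

lemma measurable_below [measurable (raw)]:
  assumes [measurable]: "f \<in> borel_measurable N" "g \<in> borel_measurable N"
  shows "Measurable.pred N (\<lambda>w. below (f w) (g w))"
proof -
  have [measurable]: "(\<lambda>w. encode (f w) q) \<in> borel_measurable N" "(\<lambda>w. encode (g w) q) \<in> borel_measurable N" for q
    unfolding encode_def by measurable
  show ?thesis unfolding below_iff_encode mono_def by measurable
qed

text \<open>The choice in \<open>lim_locfin\<close> is harmless: on decreasing sequences the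
  interval masses of the limit are the limits of the interval masses, and these are
  measurable.\<close>

lemma measurable_lim_locfin [measurable]: "lim_locfin \<in> borel_measurable seqM"
proof (rule measurable_locfinI)
  fix a b :: real
  have "emeasure (to_measure (lim_locfin s)) {a<..b} =
    (if \<forall>k. below (s (Suc k)) (s k) then liminf (\<lambda>k. emeasure (to_measure (s k)) {a<..b}) else 0)" for s
  proof (cases "\<forall>k. below (s (Suc k)) (s k)")
    case True
    have "(\<lambda>k. pairing (s k) (indicator {a<..b})) \<longlonglongrightarrow> pairing (lim_locfin s) (indicator {a<..b})"
      using True by (intro tendsto_lim_locfin) (auto simp: pairing_indicator top.not_eq_extremum[symmetric] emeasure_Ioc_finite)
    then show ?thesis using True
      by (simp add: pairing_indicator lim_imp_Liminf)
  next
    case False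
    then show ?thesis by (auto simp: lim_locfin_def emeasure_zero_locfin)
  qed
  then show "(\<lambda>s. emeasure (to_measure (lim_locfin s)) {a<..b}) \<in> borel_measurable seqM" by simp
qed

lemma locfin_add_commute: "\<mu> + \<nu> = \<nu> + (\<mu> :: locfin_measure)"
  by (rule locfin_measure_eqI) (simp add: emeasure_plus_locfin add.commute)

lemma below_refl: "below \<mu> \<mu>"
proof -
  have "\<mu> = \<mu> + 0" by (rule locfin_measure_eqI) (simp add: emeasure_plus_locfin emeasure_zero_locfin)
  then show ?thesis by (auto simp: below_def)
qed

lemma below_translate: "below \<mu> \<nu> \<Longrightarrow> below (translate x \<mu>) (translate x \<nu>)"
  by (auto simp: below_def translate_plus)

section \<open>The spine of the splitting tree\<close>

context superposable_law
begin

abbreviation ex :: "(real \<Rightarrow> real) \<Rightarrow> locfin_measure \<Rightarrow> ennreal" where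
  "ex f \<mu> \<equiv> ennreal (exp_neg (pairing \<mu> f))"

definition halve :: "locfin_measure \<Rightarrow> locfin_measure" where
  "halve = translate (- ln 2)"

lemma measurable_halve [measurable]: "halve \<in> borel_measurable borel"
  unfolding halve_def by measurable

lemma pairing_halve: "f \<in> borel_measurable borel \<Longrightarrow> pairing (halve \<mu>) f = pairing \<mu> (\<lambda>x. f (x - ln 2))"
  by (simp add: halve_def pairing_translate)

lemma superposition_halve: "L = distr (L \<Otimes>\<^sub>M L) borel (\<lambda>(\<mu>, \<nu>). halve \<mu> + halve \<nu>)"
proof -
  have "exp (- ln 2) + exp (- ln 2) = (1 :: real)" by (simp add: exp_minus)
  from superposition[OF this] show ?thesis by (simp add: halve_def)
qed

lemma nn_integral_halve_add:
  assumes [measurable]: "\<phi> \<in> borel_measurable borel"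
  shows "(\<integral>\<^sup>+\<mu>. (\<integral>\<^sup>+\<nu>. \<phi> (halve \<mu> + halve \<nu>) \<partial>L) \<partial>L) = (\<integral>\<^sup>+\<mu>. \<phi> \<mu> \<partial>L)"
proof -
  interpret LL: pair_prob_space L L ..
  have "(\<integral>\<^sup>+\<mu>. \<phi> \<mu> \<partial>L) = (\<integral>\<^sup>+\<mu>. \<phi> \<mu> \<partial>distr (L \<Otimes>\<^sub>M L) borel (\<lambda>(\<mu>, \<nu>). halve \<mu> + halve \<nu>))"
    by (subst superposition_halve) simp
  also have "\<dots> = (\<integral>\<^sup>+p. \<phi> (halve (fst p) + halve (snd p)) \<partial>(L \<Otimes>\<^sub>M L))"
    by (subst nn_integral_distr) (auto simp: case_prod_beta)
  also have "\<dots> = (\<integral>\<^sup>+\<mu>. (\<integral>\<^sup>+\<nu>. \<phi> (halve \<mu> + halve \<nu>) \<partial>L) \<partial>L)"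
    by (subst nn_integral_fst[symmetric]) auto
  finally show ?thesis ..
qed

lemma kum_halve:
  assumes "f \<in> borel_measurable borel" "0 < lap f"
  shows "0 < lap (\<lambda>x. f (x - ln 2))" "kum (\<lambda>x. f (x - ln 2)) = kum f / 2"
  using lap_shift_pos[OF assms, of "1/2"] kum_shift[OF assms, of "1/2"] by (simp_all add: ln_div)

text \<open>\<open>spine k\<close> is the law of the chain \<open>(W\<^sub>0, \<dots>, W\<^sub>k)\<close> obtained by following one leaf of the binary
  tree of depth \<open>k\<close> in which every measure is the sum of its two independent children,
  \<open>W\<^sub>j\<close> being a copy of the translate of \<open>Z\<close> by \<open>- j ln 2\<close>.\<close>

primrec spine :: "nat \<Rightarrow> (nat \<Rightarrow> locfin_measure) measure" where
  "spine 0 = distr L seqM (\<lambda>w _. w)"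
| "spine (Suc k) = distr (L \<Otimes>\<^sub>M spine k) seqM (\<lambda>(v, s). case_nat (halve (s 0) + halve v) (\<lambda>i. halve (s i)))"

lemma sets_spine [simp, measurable_cong]: "sets (spine k) = sets seqM"
  by (cases k) auto

declare spine.simps [simp del]

lemma measurable_spine_step [measurable]:
  "(\<lambda>(v, s). case_nat (halve (s 0) + halve v) (\<lambda>i. halve (s i))) \<in> measurable (borel \<Otimes>\<^sub>M seqM) seqM"
proof (rule measurable_seqMI)
  fix i
  show "(\<lambda>w. (case w of (v, s) \<Rightarrow> case_nat (halve (s 0) + halve v) (\<lambda>i. halve (s i))) i) \<in> borel_measurable (borel \<Otimes>\<^sub>M seqM)"
    by (cases i) (simp_all add: case_prod_beta)
qed

lemma measurable_spine_step':
  "(\<lambda>(v, s). case_nat (halve (s 0) + halve v) (\<lambda>i. halve (s i))) \<in> measurable (L \<Otimes>\<^sub>M spine k) seqM"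
proof -
  have "sets (L \<Otimes>\<^sub>M spine k) = sets (borel \<Otimes>\<^sub>M seqM)" by (rule sets_pair_measure_cong) auto
  from measurable_cong_sets[OF this refl] show ?thesis using measurable_spine_step by blast
qed

lemma measurable_const_seq: "(\<lambda>w _. w) \<in> measurable L seqM"
  by (rule measurable_seqMI) simp

lemma prob_space_spine: "prob_space (spine k)"
proof (induction k)
  case 0
  show ?case unfolding spine.simps by (intro prob_space_distr measurable_const_seq)
next
  case (Suc k)
  interpret s: prob_space "spine k" by fact
  interpret LS: pair_prob_space L "spine k" ..
  show ?case unfolding spine.simps by (intro LS.prob_space_distr measurable_spine_step')
qed

lemma nn_integral_spine_0:
  "G \<in> borel_measurable seqM \<Longrightarrow> (\<integral>\<^sup>+s. G s \<partial>spine 0) = (\<integral>\<^sup>+w. G (\<lambda>_. w) \<partial>L)"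
  unfolding spine.simps by (subst nn_integral_distr[OF measurable_const_seq]) auto

lemma nn_integral_spine_Suc:
  assumes [measurable]: "G \<in> borel_measurable seqM"
  shows "(\<integral>\<^sup>+s. G s \<partial>spine (Suc k)) =
    (\<integral>\<^sup>+s. (\<integral>\<^sup>+v. G (case_nat (halve (s 0) + halve v) (\<lambda>i. halve (s i))) \<partial>L) \<partial>spine k)"
proof -
  interpret s: prob_space "spine k" by (rule prob_space_spine)
  interpret LS: pair_prob_space L "spine k" ..
  have m: "(\<lambda>p. G (case p of (v, s) \<Rightarrow> case_nat (halve (s 0) + halve v) (\<lambda>i. halve (s i)))) \<in> borel_measurable (L \<Otimes>\<^sub>M spine k)"
    by (rule measurable_compose[OF measurable_spine_step' assms])
  have "(\<integral>\<^sup>+s. G s \<partial>spine (Suc k)) = (\<integral>\<^sup>+p. G (case p of (v, s) \<Rightarrow> case_nat (halve (s 0) + halve v) (\<lambda>i. halve (s i))) \<partial>(L \<Otimes>\<^sub>M spine k))"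
    unfolding spine.simps by (subst nn_integral_distr[OF measurable_spine_step']) auto
  also have "\<dots> = (\<integral>\<^sup>+s. (\<integral>\<^sup>+v. G (case_nat (halve (s 0) + halve v) (\<lambda>i. halve (s i))) \<partial>L) \<partial>spine k)"
    by (subst LS.nn_integral_snd[symmetric]) (use m in \<open>auto simp: case_prod_beta\<close>)
  finally show ?thesis .
qed

lemma measurable_spine_inner [measurable]:
  assumes [measurable]: "G \<in> borel_measurable seqM"
  shows "(\<lambda>s. \<integral>\<^sup>+v. G (case_nat (halve (s 0) + halve v) (\<lambda>i. halve (s i))) \<partial>L) \<in> borel_measurable seqM"
proof -
  have "(\<lambda>(s, v). case_nat (halve (s 0) + halve v) (\<lambda>i. halve (s i))) \<in> measurable (seqM \<Otimes>\<^sub>M L) seqM"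
  proof (rule measurable_seqMI)
    fix i
    show "(\<lambda>w. (case w of (s, v) \<Rightarrow> case_nat (halve (s 0) + halve v) (\<lambda>i. halve (s i))) i) \<in> borel_measurable (seqM \<Otimes>\<^sub>M L)"
      by (cases i) (simp_all add: case_prod_beta)
  qed
  from measurable_compose[OF this assms] show ?thesis
    by (intro borel_measurable_nn_integral) (simp add: case_prod_beta)
qed

text \<open>Given the parent, either child is equally likely to be the first one, so twice the mass of the
  first child may be replaced by the mass of the parent.\<close>

lemma spine_consistent:
  assumes "G \<in> borel_measurable seqM" "\<And>s. G (trunc k s) = G s" "h \<in> borel_measurable borel"
  shows "(\<integral>\<^sup>+s. G s * (2 * pairing (s (Suc k)) h) \<partial>spine (Suc k)) = (\<integral>\<^sup>+s. G s * pairing (s k) h \<partial>spine k)"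
  using assms
proof (induction k arbitrary: G h)
  case 0
  note [measurable] = 0(1,3)
  interpret LL: pair_prob_space L L ..
  define g where "g = (\<lambda>\<mu>. G (\<lambda>_. \<mu>))"
  have G: "G s = g (s 0)" for s using 0(2)[of s] by (simp add: g_def trunc_def)
  have [measurable]: "g \<in> borel_measurable borel"
    unfolding g_def by (rule measurable_compose[OF _ 0(1)]) (rule measurable_seqMI, simp)
  let ?A = "\<integral>\<^sup>+\<mu>. (\<integral>\<^sup>+\<nu>. g (halve \<mu> + halve \<nu>) * pairing (halve \<mu>) h \<partial>L) \<partial>L"
  have "(\<integral>\<^sup>+s. G s * (2 * pairing (s (Suc 0)) h) \<partial>spine (Suc 0)) =
    (\<integral>\<^sup>+\<mu>. (\<integral>\<^sup>+\<nu>. g (halve \<mu> + halve \<nu>) * (2 * pairing (halve \<mu>) h) \<partial>L) \<partial>L)"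
    unfolding G by (subst nn_integral_spine_Suc) (auto simp: nn_integral_spine_0)
  also have "\<dots> = 2 * ?A"
    by (subst nn_integral_cmult[symmetric]) (auto simp: nn_integral_cmult[symmetric] mult_ac)
  also have "\<dots> = ?A + ?A" by (simp add: mult_2)
  \<comment> \<open>In the second copy the two children exchange their names, after which the two
    halves add up to the pairing of the parent.\<close>
  also have "\<dots> = ?A + (\<integral>\<^sup>+\<nu>. (\<integral>\<^sup>+\<mu>. g (halve \<mu> + halve \<nu>) * pairing (halve \<mu>) h \<partial>L) \<partial>L)"
    by (subst (2) LL.Fubini') auto
  also have "(\<integral>\<^sup>+\<nu>. (\<integral>\<^sup>+\<mu>. g (halve \<mu> + halve \<nu>) * pairing (halve \<mu>) h \<partial>L) \<partial>L) =
    (\<integral>\<^sup>+\<mu>. (\<integral>\<^sup>+\<nu>. g (halve \<mu> + halve \<nu>) * pairing (halve \<nu>) h \<partial>L) \<partial>L)"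
    by (simp add: locfin_add_commute)
  also have "?A + \<dots> = (\<integral>\<^sup>+\<mu>. (\<integral>\<^sup>+\<nu>. g (halve \<mu> + halve \<nu>) * pairing (halve \<mu> + halve \<nu>) h \<partial>L) \<partial>L)"
    by (subst nn_integral_add[symmetric], simp, simp)
      (simp add: nn_integral_add[symmetric] pairing_plus distrib_left)
  also have "\<dots> = (\<integral>\<^sup>+\<mu>. g \<mu> * pairing \<mu> h \<partial>L)" by (rule nn_integral_halve_add) measurable
  also have "\<dots> = (\<integral>\<^sup>+s. G s * pairing (s 0) h \<partial>spine 0)"
    unfolding G by (subst nn_integral_spine_0) auto
  finally show ?case .
next
  case (Suc k)
  note [measurable] = Suc.prems(1,3)
  \<comment> \<open>The sibling of the first child is integrated out. What remains is the same
    statement one level lower, with the branch translated by - ln 2 and \<open>h\<close> shifted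
    accordingly.\<close>
  define G' where "G' = (\<lambda>s. \<integral>\<^sup>+v. G (case_nat (halve (s 0) + halve v) (\<lambda>i. halve (s i))) \<partial>L)"
  have [measurable]: "G' \<in> borel_measurable seqM" unfolding G'_def by measurable
  have tr: "trunc (Suc k) (case_nat a u) = case_nat a (\<lambda>i. u (min i k))" for a and u :: "nat \<Rightarrow> locfin_measure"
    by (auto simp: trunc_def fun_eq_iff split: nat.split)
  have G'_tr: "G' (trunc k s) = G' s" for s
  proof -
    have "G (case_nat a (\<lambda>i. halve (trunc k s i))) = G (case_nat a (\<lambda>i. halve (s i)))" for a
      using Suc.prems(2)[of "case_nat a (\<lambda>i. halve (s i))"] by (simp add: tr trunc_def[of k s])
    then show ?thesis by (simp add: G'_def) (simp add: trunc_def)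
  qed
  have step: "(\<integral>\<^sup>+s. G s * (c * pairing (s (Suc j)) h) \<partial>spine (Suc n)) =
    (\<integral>\<^sup>+s. G' s * (c * pairing (s j) (\<lambda>x. h (x - ln 2))) \<partial>spine n)" for c j n
  proof -
    have "(\<lambda>v. G (case_nat (halve (s 0) + halve v) (\<lambda>i. halve (s i)))) \<in> borel_measurable L" for s
    proof (rule measurable_compose[OF _ Suc.prems(1)], rule measurable_seqMI)
      fix i
      show "(\<lambda>v. case_nat (halve (s 0) + halve v) (\<lambda>i. halve (s i)) i) \<in> borel_measurable L"
        by (cases i) auto
    qed
    then show ?thesis
      by (subst nn_integral_spine_Suc) (auto simp: G'_def nn_integral_multc pairing_halve)
  qed
  have "(\<integral>\<^sup>+s. G s * (2 * pairing (s (Suc (Suc k))) h) \<partial>spine (Suc (Suc k))) =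
    (\<integral>\<^sup>+s. G' s * (2 * pairing (s (Suc k)) (\<lambda>x. h (x - ln 2))) \<partial>spine (Suc k))" by (rule step)
  also have "\<dots> = (\<integral>\<^sup>+s. G' s * pairing (s k) (\<lambda>x. h (x - ln 2)) \<partial>spine k)"
    by (rule Suc.IH) (auto simp: G'_tr)
  also have "\<dots> = (\<integral>\<^sup>+s. G s * pairing (s (Suc k)) h \<partial>spine (Suc k))"
  proof -
    have "(\<integral>\<^sup>+s. G s * (1 * pairing (s (Suc k)) h) \<partial>spine (Suc k)) =
      (\<integral>\<^sup>+s. G' s * (1 * pairing (s k) (\<lambda>x. h (x - ln 2))) \<partial>spine k)" by (rule step)
    then show ?thesis by simp
  qed
  finally show ?case .
qed

text \<open>A child is a summand of its parent, and translation respects this. Beyond index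
  \<open>k\<close> the sequence is constant, and there reflexivity is used.\<close>

lemma spine_below: "AE s in spine k. \<forall>i. below (s (Suc i)) (s i)"
proof (induction k)
  case 0
  have "AE w in L. \<forall>i::nat. below w w" by (simp add: below_refl)
  then show ?case unfolding spine.simps by (subst AE_distr_iff[OF measurable_const_seq]) auto
next
  case (Suc k)
  interpret s: prob_space "spine k" by (rule prob_space_spine)
  interpret LS: pair_prob_space L "spine k" ..
  have "AE p in L \<Otimes>\<^sub>M spine k. \<forall>i. below (snd p (Suc i)) (snd p i)"
  proof (rule LS.AE_pair_measure)
    show "{p \<in> space (L \<Otimes>\<^sub>M spine k). \<forall>i. below (snd p (Suc i)) (snd p i)} \<in> sets (L \<Otimes>\<^sub>M spine k)" by measurable
    show "AE x in L. AE y in spine k. \<forall>i. below (snd (x, y) (Suc i)) (snd (x, y) i)" using Suc by simp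
  qed
  then have "AE p in L \<Otimes>\<^sub>M spine k. \<forall>i. below ((case p of (v, s) \<Rightarrow> case_nat (halve (s 0) + halve v) (\<lambda>i. halve (s i))) (Suc i))
     ((case p of (v, s) \<Rightarrow> case_nat (halve (s 0) + halve v) (\<lambda>i. halve (s i))) i)"
  proof eventually_elim
    case (elim p)
    show ?case
    proof
      fix i
      show "below ((case p of (v, s) \<Rightarrow> case_nat (halve (s 0) + halve v) (\<lambda>i. halve (s i))) (Suc i))
        ((case p of (v, s) \<Rightarrow> case_nat (halve (s 0) + halve v) (\<lambda>i. halve (s i))) i)"
      proof (cases i)
        case 0 then show ?thesis by (auto simp: below_def case_prod_beta)
      next
        case (Suc j) then show ?thesis using elim below_translate by (simp add: case_prod_beta halve_def)
      qed
    qed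
  qed
  then show ?case unfolding spine.simps
    by (subst AE_distr_iff[OF measurable_spine_step']) auto
qed

text \<open>Law of a single node at depth \<open>k\<close>, that is of \<open>Z\<close> translated
  by - k ln 2; the root is the sum of 2^k independent such nodes.\<close>

definition Lk :: "nat \<Rightarrow> locfin_measure measure" where
  "Lk k = distr L borel (halve ^^ k)"

lemma measurable_halve_pow [measurable]: "halve ^^ k \<in> borel_measurable borel"
  by (induction k) (auto simp: comp_def)

lemma nn_integral_Lk: "\<phi> \<in> borel_measurable borel \<Longrightarrow> (\<integral>\<^sup>+\<mu>. \<phi> \<mu> \<partial>Lk k) = (\<integral>\<^sup>+\<mu>. \<phi> ((halve ^^ k) \<mu>) \<partial>L)"
  unfolding Lk_def by (subst nn_integral_distr) auto

lemma nn_integral_Lk_Suc: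
  assumes [measurable]: "\<phi> \<in> borel_measurable borel"
  shows "(\<integral>\<^sup>+\<mu>. \<phi> \<mu> \<partial>Lk (Suc k)) = (\<integral>\<^sup>+\<mu>. \<phi> (halve \<mu>) \<partial>Lk k)"
  by (subst (1 2) nn_integral_Lk) auto

lemma nn_integral_Lk_ex:
  assumes "f \<in> borel_measurable borel" "0 < lap f"
  shows "(\<integral>\<^sup>+\<mu>. ex f \<mu> \<partial>Lk k) = ennreal (exp (- (kum f / 2 ^ k)))"
  using assms
proof (induction k arbitrary: f)
  case 0
  then show ?case by (simp add: nn_integral_Lk nn_integral_lap lap_eq_exp_kum)
next
  case (Suc k)
  note [measurable] = Suc.prems(1)
  have "(\<integral>\<^sup>+\<mu>. ex f \<mu> \<partial>Lk (Suc k)) = (\<integral>\<^sup>+\<mu>. ex (\<lambda>x. f (x - ln 2)) \<mu> \<partial>Lk k)"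
    by (subst nn_integral_Lk_Suc) (auto simp: pairing_halve)
  also have "\<dots> = ennreal (exp (- (kum f / 2 ^ Suc k)))"
    using Suc.IH[of "\<lambda>x. f (x - ln 2)"] kum_halve[OF Suc.prems] by simp
  finally show ?case .
qed

lemma adm_halve: "adm f \<Longrightarrow> adm (\<lambda>x. f (x - ln 2))"
  using adm_shift[of f "1/2"] by (simp add: ln_div)

lemma AE_Lk_finite:
  assumes "adm f"
  shows "AE \<mu> in Lk k. pairing \<mu> f < \<top>"
proof -
  have "AE \<mu> in L. pairing ((halve ^^ k) \<mu>) f < \<top>" using assms
  proof (induction k arbitrary: f)
    case 0 then show ?case by (simp add: adm_def)
  next
    case (Suc k)
    from Suc.IH[OF adm_halve[OF Suc.prems]] show ?case
      using admD(1)[OF Suc.prems] by (simp add: pairing_halve)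
  qed
  then show ?thesis unfolding Lk_def using admD(1)[OF assms] by (subst AE_distr_iff) auto
qed

text \<open>Apart from the spine itself, the top measure \<open>W\<^sub>0\<close> consists of an independent part.\<close>

lemma spine_ends:
  assumes "f \<in> borel_measurable borel" "0 < lap f" "\<phi> \<in> borel_measurable borel"
  shows "(\<integral>\<^sup>+s. ex f (s 0) * \<phi> (s k) \<partial>spine k) =
    ennreal (exp (- (1 - 1 / 2 ^ k) * kum f)) * (\<integral>\<^sup>+\<mu>. ex f \<mu> * \<phi> \<mu> \<partial>Lk k)"
  using assms
proof (induction k arbitrary: f \<phi>)
  case 0
  note [measurable] = 0(1,3)
  show ?case by (subst nn_integral_spine_0) (auto simp: nn_integral_Lk)
next
  case (Suc k)
  note [measurable] = Suc.prems(1,3)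
  let ?f = "\<lambda>x. f (x - ln 2)"
  note fh = kum_halve[OF Suc.prems(1,2)]
  have "(\<integral>\<^sup>+s. ex f (s 0) * \<phi> (s (Suc k)) \<partial>spine (Suc k)) =
    (\<integral>\<^sup>+s. (\<integral>\<^sup>+v. ex ?f v * (ex ?f (s 0) * \<phi> (halve (s k))) \<partial>L) \<partial>spine k)"
    by (subst nn_integral_spine_Suc) (auto simp: pairing_plus pairing_halve exp_neg_add ennreal_mult mult_ac)
  also have "\<dots> = (\<integral>\<^sup>+s. ennreal (lap ?f) * (ex ?f (s 0) * \<phi> (halve (s k))) \<partial>spine k)"
    by (intro nn_integral_cong) (simp add: nn_integral_multc nn_integral_lap)
  also have "\<dots> = ennreal (lap ?f) * (\<integral>\<^sup>+s. ex ?f (s 0) * \<phi> (halve (s k)) \<partial>spine k)"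
    by (rule nn_integral_cmult) measurable
  also have "(\<integral>\<^sup>+s. ex ?f (s 0) * \<phi> (halve (s k)) \<partial>spine k) =
      ennreal (exp (- (1 - 1 / 2 ^ k) * kum ?f)) * (\<integral>\<^sup>+\<mu>. ex ?f \<mu> * \<phi> (halve \<mu>) \<partial>Lk k)"
    by (rule Suc.IH) (auto simp: fh)
  also have "(\<integral>\<^sup>+\<mu>. ex ?f \<mu> * \<phi> (halve \<mu>) \<partial>Lk k) = (\<integral>\<^sup>+\<mu>. ex f \<mu> * \<phi> \<mu> \<partial>Lk (Suc k))"
    by (subst nn_integral_Lk_Suc) (auto simp: pairing_halve)
  \<comment> \<open>The sibling carries one half of K(f), the lower levels off the spine half of the
    share 1 - 2^(-k); together the share is 1 - 2^(-k-1).\<close>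
  also have "ennreal (lap ?f) * (ennreal (exp (- (1 - 1 / 2 ^ k) * kum ?f)) * \<dots>) =
    ennreal (exp (- (1 - 1 / 2 ^ Suc k) * kum f)) * \<dots>"
  proof -
    have "lap ?f * exp (- (1 - 1 / 2 ^ k) * kum ?f) = exp (- (1 - 1 / 2 ^ Suc k) * kum f)"
      unfolding lap_eq_exp_kum[OF fh(1)] fh(2) exp_add[symmetric] by (simp add: field_simps)
    then show ?thesis by (simp add: mult.assoc[symmetric] ennreal_mult[symmetric] lap_nonneg)
  qed
  finally show ?case .
qed

end

section \<open>The size-biased spine and the increment measure\<close>

lemma nn_integral_exp_Icc:
  assumes "t < \<top>"
  shows "(\<integral>\<^sup>+\<theta>. ennreal (exp_neg (ennreal \<theta> * t)) * t * indicator {0..1} \<theta> \<partial>lborel) = ennreal (1 - exp_neg t)"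
proof -
  obtain p where p: "0 \<le> p" "t = ennreal p" using assms by (cases t) auto
  have "(\<integral>\<^sup>+\<theta>. ennreal (exp_neg (ennreal \<theta> * t)) * t * indicator {0..1} \<theta> \<partial>lborel) =
    (\<integral>\<^sup>+\<theta>. ennreal (exp (- (\<theta> * p)) * p) * indicator {0..1} \<theta> \<partial>lborel)"
    using p by (intro nn_integral_cong) (auto simp: indicator_def exp_neg_ennreal ennreal_mult[symmetric])
  also have "\<dots> = ennreal ((- exp (- (1 * p))) - (- exp (- (0 * p))))"
    using p(1) by (intro nn_integral_FTC_Icc) (auto intro!: derivative_eq_intros)
  finally show ?thesis using p by (simp add: exp_neg_ennreal)
qed

text \<open>The derivative of t -> exp(-c t) at 0, taken along t = 2^(-k). It turns the Laplace
  transforms exp(-K(f) / 2^k) of single nodes into a difference of cumulants.\<close>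

lemma tendsto_two_pow_exp:
  fixes a b :: real
  shows "(\<lambda>k::nat. 2 ^ k * (exp (- (a / 2 ^ k)) - exp (- (b / 2 ^ k)))) \<longlonglongrightarrow> b - a"
proof -
  have lim: "(\<lambda>k::nat. 2 ^ k * (exp (- (c / 2 ^ k)) - 1)) \<longlonglongrightarrow> - c" for c :: real
  proof -
    have "((\<lambda>t. exp (- (c * t))) has_real_derivative - c) (at 0)"
      by (auto intro!: derivative_eq_intros)
    then have d: "((\<lambda>t. (exp (- (c * t)) - 1) / t) \<longlongrightarrow> - c) (at 0)"
      by (simp add: has_field_derivative_iff)
    have "(\<lambda>k::nat. (1/2::real) ^ k) \<longlonglongrightarrow> 0" by (rule LIMSEQ_realpow_zero) auto
    then have "filterlim (\<lambda>k::nat. (1/2::real) ^ k) (at 0) sequentially"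
      by (auto simp: filterlim_at)
    from filterlim_compose[OF d this] show ?thesis
      by (simp add: power_one_over field_simps)
  qed
  from tendsto_diff[OF lim[of a] lim[of b]] show ?thesis by (simp add: algebra_simps)
qed

context superposable_law
begin

lemma adm_kum_add_le:
  assumes "adm f" "adm h"
  shows "kum f \<le> kum (\<lambda>x. f x + h x)"
proof -
  note [measurable] = admD(1)[OF assms(1)] admD(1)[OF assms(2)]
  have "lap (\<lambda>x. f x + h x) \<le> lap f"
    unfolding lap_def
  proof (intro integral_mono integrable_lap)
    fix \<mu>
    show "exp_neg (pairing \<mu> (\<lambda>x. f x + h x)) \<le> exp_neg (pairing \<mu> f)"
      using admD(2)[OF assms(2)] by (intro exp_neg_mono pairing_mono) simp
  qed auto
  then show ?thesis unfolding kum_def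
    using lap_pos[OF adm_add[OF assms]] by simp
qed

lemma prob_space_Lk: "prob_space (Lk k)"
  unfolding Lk_def by (rule prob_space_distr) measurable

lemma sets_Lk [simp, measurable_cong]: "sets (Lk k) = sets borel"
  by (simp add: Lk_def)

lemma nn_integral_Lk_ex_diff:
  assumes f: "adm f" and h: "adm h"
  shows "(\<integral>\<^sup>+\<mu>. ex f \<mu> * ennreal (1 - exp_neg (pairing \<mu> h)) \<partial>Lk k) =
    ennreal (exp (- (kum f / 2 ^ k)) - exp (- (kum (\<lambda>x. f x + h x) / 2 ^ k)))"
proof -
  note [measurable] = admD(1)[OF f] admD(1)[OF h]
  note fh = adm_add[OF f h]
  have "(\<integral>\<^sup>+\<mu>. ex f \<mu> * ennreal (1 - exp_neg (pairing \<mu> h)) \<partial>Lk k) =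
    (\<integral>\<^sup>+\<mu>. ex f \<mu> - ex (\<lambda>x. f x + h x) \<mu> \<partial>Lk k)"
    using admD(2)[OF f] admD(2)[OF h]
    by (intro nn_integral_cong)
      (simp add: pairing_add exp_neg_add ennreal_mult[symmetric] ennreal_minus algebra_simps)
  also have "\<dots> = (\<integral>\<^sup>+\<mu>. ex f \<mu> \<partial>Lk k) - (\<integral>\<^sup>+\<mu>. ex (\<lambda>x. f x + h x) \<mu> \<partial>Lk k)"
  proof (rule nn_integral_diff)
    show "AE \<mu> in Lk k. ex (\<lambda>x. f x + h x) \<mu> \<le> ex f \<mu>"
      using admD(2)[OF h] by (intro AE_I2 ennreal_leI exp_neg_mono pairing_mono) simp
  qed (use nn_integral_Lk_ex[OF admD(1)[OF fh] lap_pos[OF fh]] in auto)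
  also have "\<dots> = ennreal (exp (- (kum f / 2 ^ k)) - exp (- (kum (\<lambda>x. f x + h x) / 2 ^ k)))"
    using nn_integral_Lk_ex[OF admD(1)[OF fh] lap_pos[OF fh]] nn_integral_Lk_ex[OF admD(1)[OF f] lap_pos[OF f]]
    by (simp add: ennreal_minus)
  finally show ?thesis .
qed

end

locale spine_weight = superposable_law +
  fixes h :: "real \<Rightarrow> real"
  assumes h: "adm h"
begin

lemma h_meas [measurable]: "h \<in> borel_measurable borel" by (rule admD(1)[OF h])

lemma scaled: "0 \<le> \<theta> \<Longrightarrow> pairing \<mu> (\<lambda>x. \<theta> * h x) = ennreal \<theta> * pairing \<mu> h"
  by (rule pairing_cmult) auto

lemma kum_scaled_le: "0 \<le> \<theta> \<Longrightarrow> \<theta> \<le> 1 \<Longrightarrow> kum (\<lambda>x. \<theta> * h x) \<le> kum h"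
  using adm_kum_add_le[OF adm_cmult[OF h, of \<theta>] adm_cmult[OF h, of "1 - \<theta>"]]
  by (simp add: algebra_simps)

lemma measurable_kum_scaled: "(\<lambda>\<theta>. kum (\<lambda>x. \<theta> * h x)) \<in> borel_measurable borel"
proof -
  have "(\<lambda>\<theta>. \<integral>\<mu>. exp_neg (pairing \<mu> (\<lambda>x. \<theta> * h x)) \<partial>L) \<in> borel_measurable borel"
    by (rule borel_measurable_lebesgue_integral) (simp add: case_prod_beta)
  then show ?thesis unfolding kum_def lap_def by measurable
qed

text \<open>\<open>\<langle>Z, h\<rangle>\<close> may have infinite mean, so \<open>W\<^sub>0\<close> also gets a weight: integrating \<open>\<langle>\<mu>, h\<rangle> exp (- \<theta> \<langle>\<mu>, h\<rangle>)\<close>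
  over \<open>0 \<le> \<theta> \<le> 1\<close> gives the bounded \<open>1 - exp (- \<langle>\<mu>, h\<rangle>)\<close>, and \<open>exp (K(\<theta> h))\<close> cancels the
  contribution of the part of \<open>W\<^sub>0\<close> off the spine in the limit.\<close>

definition wt :: "locfin_measure \<Rightarrow> ennreal" where
  "wt \<mu> = (\<integral>\<^sup>+\<theta>. ennreal (exp (kum (\<lambda>x. \<theta> * h x))) * ex (\<lambda>x. \<theta> * h x) \<mu> * indicator {0..1} \<theta> \<partial>lborel)"

lemma measurable_wt [measurable]: "wt \<in> borel_measurable borel"
proof -
  note [measurable] = measurable_kum_scaled
  show ?thesis unfolding wt_def by measurable
qed

text \<open>Expectation of the sum of \<phi>(\<mu>) (1 - exp(-<\<mu>,h>)) over all 2^k nodes \<mu>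
  of depth \<open>k\<close>. For \<phi> = exp(-<.,f>) it tends to K(f + h) - K(f).\<close>

definition inc :: "nat \<Rightarrow> (locfin_measure \<Rightarrow> ennreal) \<Rightarrow> ennreal" where
  "inc k \<phi> = (\<integral>\<^sup>+\<mu>. 2 ^ k * \<phi> \<mu> * ennreal (1 - exp_neg (pairing \<mu> h)) \<partial>Lk k)"

text \<open>The variable \<open>\<theta>\<close> is integrated first: on [0, 1] the integral of
  <\<mu>,h> exp(-\<theta> <\<mu>,h>) is 1 - exp(-<\<mu>,h>), provided the pairing is finite, as it
  is almost surely.\<close>

lemma inc_eq:
  assumes [measurable]: "\<phi> \<in> borel_measurable borel"
  shows "(\<integral>\<^sup>+\<theta>. indicator {0..1} \<theta> * (\<integral>\<^sup>+\<mu>. ex (\<lambda>x. \<theta> * h x) \<mu> * (2 ^ k * pairing \<mu> h * \<phi> \<mu>) \<partial>Lk k) \<partial>lborel) = inc k \<phi>"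
proof -
  interpret l: prob_space "Lk k" by (rule prob_space_Lk)
  interpret ll: pair_sigma_finite "Lk k" lborel ..
  have "(\<integral>\<^sup>+\<theta>. indicator {0..1} \<theta> * (\<integral>\<^sup>+\<mu>. ex (\<lambda>x. \<theta> * h x) \<mu> * (2 ^ k * pairing \<mu> h * \<phi> \<mu>) \<partial>Lk k) \<partial>lborel) =
    (\<integral>\<^sup>+\<theta>. (\<integral>\<^sup>+\<mu>. indicator {0..1} \<theta> * (ex (\<lambda>x. \<theta> * h x) \<mu> * (2 ^ k * pairing \<mu> h * \<phi> \<mu>)) \<partial>Lk k) \<partial>lborel)"
    by (intro nn_integral_cong nn_integral_cmult[symmetric]) measurable
  also have "\<dots> = (\<integral>\<^sup>+\<mu>. (\<integral>\<^sup>+\<theta>. indicator {0..1} \<theta> * (ex (\<lambda>x. \<theta> * h x) \<mu> * (2 ^ k * pairing \<mu> h * \<phi> \<mu>)) \<partial>lborel) \<partial>Lk k)"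
    by (rule ll.Fubini') measurable
  also have "\<dots> = (\<integral>\<^sup>+\<mu>. 2 ^ k * \<phi> \<mu> * ennreal (1 - exp_neg (pairing \<mu> h)) \<partial>Lk k)"
  proof (rule nn_integral_cong_AE)
    show "AE \<mu> in Lk k. (\<integral>\<^sup>+\<theta>. indicator {0..1} \<theta> * (ex (\<lambda>x. \<theta> * h x) \<mu> * (2 ^ k * pairing \<mu> h * \<phi> \<mu>)) \<partial>lborel) =
      2 ^ k * \<phi> \<mu> * ennreal (1 - exp_neg (pairing \<mu> h))"
      using AE_Lk_finite[OF h]
    proof eventually_elim
      case (elim \<mu>)
      have "(\<integral>\<^sup>+\<theta>. indicator {0..1} \<theta> * (ex (\<lambda>x. \<theta> * h x) \<mu> * (2 ^ k * pairing \<mu> h * \<phi> \<mu>)) \<partial>lborel) =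
        (\<integral>\<^sup>+\<theta>. 2 ^ k * \<phi> \<mu> * (ennreal (exp_neg (ennreal \<theta> * pairing \<mu> h)) * pairing \<mu> h * indicator {0..1} \<theta>) \<partial>lborel)"
        by (intro nn_integral_cong) (auto simp: indicator_def scaled mult_ac)
      also have "\<dots> = 2 ^ k * \<phi> \<mu> * (\<integral>\<^sup>+\<theta>. ennreal (exp_neg (ennreal \<theta> * pairing \<mu> h)) * pairing \<mu> h * indicator {0..1} \<theta> \<partial>lborel)"
        by (rule nn_integral_cmult) measurable
      finally show ?case by (simp add: nn_integral_exp_Icc[OF elim])
    qed
  qed
  finally show ?thesis by (simp add: inc_def)
qed

text \<open>\<open>wt\<close> supplies exp(K(\<theta> h)), while the part of the root off the spine
  takes away exp(-(1 - 2^(-k)) K(\<theta> h)); only exp(K(\<theta> h) / 2^k) remains.\<close>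

lemma weighted_eq:
  assumes [measurable]: "\<phi> \<in> borel_measurable borel"
  shows "(\<integral>\<^sup>+s. wt (s 0) * (2 ^ k * pairing (s k) h) * \<phi> (s k) \<partial>spine k) =
    (\<integral>\<^sup>+\<theta>. ennreal (exp (kum (\<lambda>x. \<theta> * h x) / 2 ^ k)) * (indicator {0..1} \<theta> *
      (\<integral>\<^sup>+\<mu>. ex (\<lambda>x. \<theta> * h x) \<mu> * (2 ^ k * pairing \<mu> h * \<phi> \<mu>) \<partial>Lk k)) \<partial>lborel)"
proof -
  interpret l: prob_space "spine k" by (rule prob_space_spine)
  interpret ll: pair_sigma_finite "spine k" lborel ..
  note [measurable] = measurable_kum_scaled
  let ?g = "\<lambda>s. 2 ^ k * pairing (s k) h * \<phi> (s k)"
  let ?c = "\<lambda>\<theta>. ennreal (exp (kum (\<lambda>x. \<theta> * h x))) * indicator {0..1} \<theta> :: ennreal"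
  have "(\<integral>\<^sup>+s. wt (s 0) * (2 ^ k * pairing (s k) h) * \<phi> (s k) \<partial>spine k) =
    (\<integral>\<^sup>+s. (\<integral>\<^sup>+\<theta>. ?c \<theta> * (ex (\<lambda>x. \<theta> * h x) (s 0) * ?g s) \<partial>lborel) \<partial>spine k)"
    unfolding wt_def
    by (intro nn_integral_cong, subst mult.assoc, subst nn_integral_multc[symmetric])
      (auto intro!: nn_integral_cong simp: mult_ac)
  also have "\<dots> = (\<integral>\<^sup>+\<theta>. (\<integral>\<^sup>+s. ?c \<theta> * (ex (\<lambda>x. \<theta> * h x) (s 0) * ?g s) \<partial>spine k) \<partial>lborel)"
    by (rule ll.Fubini'[symmetric]) measurable
  also have "\<dots> = (\<integral>\<^sup>+\<theta>. ?c \<theta> * (\<integral>\<^sup>+s. ex (\<lambda>x. \<theta> * h x) (s 0) * ?g s \<partial>spine k) \<partial>lborel)"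
    by (intro nn_integral_cong nn_integral_cmult) measurable
  also have "\<dots> = (\<integral>\<^sup>+\<theta>. ennreal (exp (kum (\<lambda>x. \<theta> * h x) / 2 ^ k)) * (indicator {0..1} \<theta> *
      (\<integral>\<^sup>+\<mu>. ex (\<lambda>x. \<theta> * h x) \<mu> * (2 ^ k * pairing \<mu> h * \<phi> \<mu>) \<partial>Lk k)) \<partial>lborel)"
  proof (intro nn_integral_cong)
    fix \<theta> :: real
    show "?c \<theta> * (\<integral>\<^sup>+s. ex (\<lambda>x. \<theta> * h x) (s 0) * ?g s \<partial>spine k) =
      ennreal (exp (kum (\<lambda>x. \<theta> * h x) / 2 ^ k)) * (indicator {0..1} \<theta> *
      (\<integral>\<^sup>+\<mu>. ex (\<lambda>x. \<theta> * h x) \<mu> * (2 ^ k * pairing \<mu> h * \<phi> \<mu>) \<partial>Lk k))"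
    proof (cases "\<theta> \<in> {0..1}")
      case True
      then have a: "adm (\<lambda>x. \<theta> * h x)" by (intro adm_cmult h) auto
      have "(\<integral>\<^sup>+s. ex (\<lambda>x. \<theta> * h x) (s 0) * ?g s \<partial>spine k) =
        ennreal (exp (- (1 - 1 / 2 ^ k) * kum (\<lambda>x. \<theta> * h x))) *
          (\<integral>\<^sup>+\<mu>. ex (\<lambda>x. \<theta> * h x) \<mu> * (2 ^ k * pairing \<mu> h * \<phi> \<mu>) \<partial>Lk k)"
        by (rule spine_ends[OF admD(1)[OF a] lap_pos[OF a], where \<phi>="\<lambda>\<mu>. 2 ^ k * pairing \<mu> h * \<phi> \<mu>"]) measurable
      moreover have "exp (kum (\<lambda>x. \<theta> * h x)) * exp (- (1 - 1 / 2 ^ k) * kum (\<lambda>x. \<theta> * h x)) =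
        exp (kum (\<lambda>x. \<theta> * h x) / 2 ^ k)"
        unfolding exp_add[symmetric] by (simp add: field_simps)
      ultimately show ?thesis using True
        by (simp add: mult.assoc[symmetric] ennreal_mult[symmetric])
    qed simp
  qed
  finally show ?thesis .
qed

text \<open>The factor exp(K(\<theta> h) / 2^k) lies between 1 and exp(K(h) / 2^k). As the upper
  bound tends to 1, the biased expectation and \<open>inc\<close> have the same limit.\<close>

lemma weighted_bounds:
  assumes [measurable]: "\<phi> \<in> borel_measurable borel"
  shows "inc k \<phi> \<le> (\<integral>\<^sup>+s. wt (s 0) * (2 ^ k * pairing (s k) h) * \<phi> (s k) \<partial>spine k)"
    and "(\<integral>\<^sup>+s. wt (s 0) * (2 ^ k * pairing (s k) h) * \<phi> (s k) \<partial>spine k) \<le> ennreal (exp (kum h / 2 ^ k)) * inc k \<phi>"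
proof -
  interpret l: prob_space "Lk k" by (rule prob_space_Lk)
  let ?J = "\<lambda>\<theta>. indicator {0..1} \<theta> * (\<integral>\<^sup>+\<mu>. ex (\<lambda>x. \<theta> * h x) \<mu> * (2 ^ k * pairing \<mu> h * \<phi> \<mu>) \<partial>Lk k)"
  have J[measurable]: "?J \<in> borel_measurable borel" by measurable
  have kn: "0 \<le> kum (\<lambda>x. \<theta> * h x)" if "0 \<le> \<theta>" for \<theta> by (intro kum_nonneg adm_cmult h that)
  show "inc k \<phi> \<le> (\<integral>\<^sup>+s. wt (s 0) * (2 ^ k * pairing (s k) h) * \<phi> (s k) \<partial>spine k)"
    unfolding weighted_eq[OF assms] inc_eq[OF assms, symmetric]
  proof (intro nn_integral_mono)
    fix \<theta> :: real
    have "1 * ?J \<theta> \<le> ennreal (exp (kum (\<lambda>x. \<theta> * h x) / 2 ^ k)) * ?J \<theta>"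
    proof (cases "\<theta> \<in> {0..1}")
      case True
      then have "ennreal 1 \<le> ennreal (exp (kum (\<lambda>x. \<theta> * h x) / 2 ^ k))" using kn[of \<theta>] by (intro ennreal_leI) simp
      then show ?thesis by (intro mult_right_mono) auto
    qed simp
    then show "?J \<theta> \<le> ennreal (exp (kum (\<lambda>x. \<theta> * h x) / 2 ^ k)) * ?J \<theta>" by simp
  qed
  have "(\<integral>\<^sup>+\<theta>. ennreal (exp (kum (\<lambda>x. \<theta> * h x) / 2 ^ k)) * ?J \<theta> \<partial>lborel) \<le> (\<integral>\<^sup>+\<theta>. ennreal (exp (kum h / 2 ^ k)) * ?J \<theta> \<partial>lborel)"
  proof (intro nn_integral_mono)
    fix \<theta> :: real
    show "ennreal (exp (kum (\<lambda>x. \<theta> * h x) / 2 ^ k)) * ?J \<theta> \<le> ennreal (exp (kum h / 2 ^ k)) * ?J \<theta>"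
    proof (cases "\<theta> \<in> {0..1}")
      case True
      then have "exp (kum (\<lambda>x. \<theta> * h x) / 2 ^ k) \<le> exp (kum h / 2 ^ k)"
        using kum_scaled_le[of \<theta>] by (simp add: divide_right_mono)
      then show ?thesis by (intro mult_right_mono ennreal_leI) auto
    qed simp
  qed
  also have "\<dots> = ennreal (exp (kum h / 2 ^ k)) * inc k \<phi>"
    by (subst nn_integral_cmult) (use J inc_eq[OF assms] in auto)
  finally show "(\<integral>\<^sup>+s. wt (s 0) * (2 ^ k * pairing (s k) h) * \<phi> (s k) \<partial>spine k) \<le> ennreal (exp (kum h / 2 ^ k)) * inc k \<phi>"
    unfolding weighted_eq[OF assms] .
qed

lemma inc_ex:
  assumes "adm f"
  shows "inc k (ex f) = ennreal (2 ^ k * (exp (- (kum f / 2 ^ k)) - exp (- (kum (\<lambda>x. f x + h x) / 2 ^ k))))"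
proof -
  note [measurable] = admD(1)[OF assms]
  have "kum f / 2 ^ k \<le> kum (\<lambda>x. f x + h x) / 2 ^ k"
    using adm_kum_add_le[OF assms h] by (intro divide_right_mono) auto
  then have "0 \<le> exp (- (kum f / 2 ^ k)) - exp (- (kum (\<lambda>x. f x + h x) / 2 ^ k))" by simp
  moreover have "inc k (ex f) = 2 ^ k * (\<integral>\<^sup>+\<mu>. ex f \<mu> * ennreal (1 - exp_neg (pairing \<mu> h)) \<partial>Lk k)"
    unfolding inc_def by (subst nn_integral_cmult[symmetric]) (auto simp: mult.assoc)
  ultimately show ?thesis
    by (simp add: nn_integral_Lk_ex_diff[OF assms h] ennreal_mult ennreal_power[symmetric])
qed

text \<open>Mass of the biased law at depth \<open>k\<close>. It turns out to be the same for all
  \<open>k\<close>, so one normalisation serves the whole projective family.\<close>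

definition total :: "nat \<Rightarrow> ennreal" where
  "total k = (\<integral>\<^sup>+s. wt (s 0) * (2 ^ k * pairing (s k) h) \<partial>spine k)"

lemma consistent:
  assumes [measurable]: "G \<in> borel_measurable seqM" and G: "\<And>s. G (trunc k s) = G s"
  shows "(\<integral>\<^sup>+s. G s * (wt (s 0) * (2 ^ Suc k * pairing (s (Suc k)) h)) \<partial>spine (Suc k)) =
    (\<integral>\<^sup>+s. G s * (wt (s 0) * (2 ^ k * pairing (s k) h)) \<partial>spine k)"
proof -
  have "wt (trunc k s 0) = wt (s 0)" for s by (simp add: trunc_def)
  then have "(\<integral>\<^sup>+s. (G s * wt (s 0) * 2 ^ k) * (2 * pairing (s (Suc k)) h) \<partial>spine (Suc k)) =
    (\<integral>\<^sup>+s. (G s * wt (s 0) * 2 ^ k) * pairing (s k) h \<partial>spine k)"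
    by (intro spine_consistent) (auto simp: G)
  then show ?thesis by (simp add: mult_ac)
qed

lemma total_eq: "total k = total 0"
proof (induction k)
  case (Suc k)
  have "total (Suc k) = total k" using consistent[of "\<lambda>_. 1" k] by (simp add: total_def)
  with Suc show ?case by simp
qed simp

lemma total_bounds: "ennreal (1 - lap h) \<le> total 0" "total 0 < \<top>"
proof -
  have "ex (\<lambda>_. 0) = (\<lambda>_. 1)" by (simp add: pairing_def)
  then have i: "inc 0 (\<lambda>_. 1) = ennreal (1 - lap h)"
    using inc_ex[OF adm_0, of 0] lap_eq_exp_kum[OF lap_pos[OF h]] by simp
  show "ennreal (1 - lap h) \<le> total 0" using weighted_bounds(1)[of "\<lambda>_. 1" 0] i by (simp add: total_def)
  have "total 0 \<le> ennreal (exp (kum h)) * ennreal (1 - lap h)"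
    using weighted_bounds(2)[of "\<lambda>_. 1" 0] i by (simp add: total_def)
  also have "\<dots> < \<top>" by (simp add: ennreal_mult_less_top)
  finally show "total 0 < \<top>" .
qed

text \<open>The biased laws have a common finite mass; if it is positive they are normalised and
  extended to infinite branches. The law of the limit along the branch, with the mass restored, is
  the measure sought: its Laplace functional is the limit in \<open>k\<close> of biased
  expectations, which are squeezed between bounds tending to K(f + h) - K(f).\<close>

lemma increment_measure:
  "\<exists>\<nu>. finite_measure \<nu> \<and> sets \<nu> = sets (borel :: locfin_measure measure) \<and>
     (\<forall>f. adm f \<longrightarrow> (\<integral>\<^sup>+\<mu>. ex f \<mu> \<partial>\<nu>) = ennreal (kum (\<lambda>x. f x + h x) - kum f))"
proof (cases "total 0 = 0")
  \<comment> \<open>Here <Z,h> = 0 almost surely, adding \<open>h\<close> leaves the cumulant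
    unchanged, and the null measure serves.\<close>
  case True
  then have "lap h = 1" using total_bounds(1) lap_le_1[of h] by simp
  then have "(\<integral>\<mu>. 1 - exp_neg (pairing \<mu> h) \<partial>L) = 0"
    by (simp add: integrable_lap lap_def[symmetric])
  then have "AE \<mu> in L. 1 - exp_neg (pairing \<mu> h) = 0"
    by (subst (asm) integral_nonneg_eq_0_iff_AE) (auto intro!: Bochner_Integration.integrable_diff integrable_lap)
  then have z: "AE \<mu> in L. pairing \<mu> h = 0" by simp
  have "kum (\<lambda>x. f x + h x) = kum f" if f: "adm f" for f
  proof -
    note [measurable] = admD(1)[OF f]
    have "lap (\<lambda>x. f x + h x) = lap f" unfolding lap_def
    proof (rule integral_cong_AE)
      show "AE \<mu> in L. exp_neg (pairing \<mu> (\<lambda>x. f x + h x)) = exp_neg (pairing \<mu> f)"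
        using z by eventually_elim (use f h in \<open>simp add: pairing_add admD\<close>)
    qed auto
    then show ?thesis by (simp add: kum_def)
  qed
  then show ?thesis
    by (intro exI[of _ "null_measure borel"]) (auto simp: nn_integral_null_measure intro!: finite_measureI)
next
  case False
  define m where "m = total 0"
  have m: "m \<noteq> 0" "m \<noteq> \<top>" "m < \<top>" using False total_bounds(2) by (auto simp: m_def)
  have mi: "m * inverse m = 1" using ennreal_divide_self[of m] m by (simp add: divide_ennreal_def)
  define q where "q = (\<lambda>k s. inverse m * (wt (s 0) * (2 ^ k * pairing (s k) h)))"
  have [measurable]: "q k \<in> borel_measurable seqM" for k unfolding q_def by measurable
  have qi: "(\<integral>\<^sup>+s. q k s * g s \<partial>spine k) = inverse m * (\<integral>\<^sup>+s. wt (s 0) * (2 ^ k * pairing (s k) h) * g s \<partial>spine k)"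
    if [measurable]: "g \<in> borel_measurable seqM" for g k
    unfolding q_def by (subst nn_integral_cmult[symmetric]) (auto simp: mult.assoc)
  define Q where "Q = (\<lambda>k. density (spine k) (q k))"
  have setsQ [simp, measurable_cong]: "sets (Q k) = sets seqM" for k by (simp add: Q_def)
  have Q_int: "(\<integral>\<^sup>+s. g s \<partial>Q k) = inverse m * (\<integral>\<^sup>+s. wt (s 0) * (2 ^ k * pairing (s k) h) * g s \<partial>spine k)"
    if [measurable]: "g \<in> borel_measurable seqM" for g k
    unfolding Q_def by (subst nn_integral_density) (auto simp: qi)
  have prob: "prob_space (Q k)" for k
  proof
    have "emeasure (Q k) (space (Q k)) = (\<integral>\<^sup>+s. 1 \<partial>Q k)" by simp
    also have "\<dots> = inverse m * total k" by (subst Q_int) (auto simp: total_def)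
    finally show "emeasure (Q k) (space (Q k)) = 1" using mi by (simp add: total_eq[of k] m_def[symmetric] mult.commute)
  qed
  have "\<exists>R. prob_space R \<and> sets R = sets seqM \<and> (\<forall>k. distr R seqM (trunc k) = distr (Q k) seqM (trunc k))"
  proof (rule projective_limit_locfin[OF prob setsQ])
    fix k
    show "distr (Q (Suc k)) seqM (trunc k) = distr (Q k) seqM (trunc k)"
    proof (rule measure_eqI)
      fix A assume "A \<in> sets (distr (Q (Suc k)) seqM (trunc k))"
      then have [measurable]: "A \<in> sets seqM" by simp
      have *: "emeasure (distr (Q j) seqM (trunc k)) A =
        inverse m * (\<integral>\<^sup>+s. indicator A (trunc k s) * (wt (s 0) * (2 ^ j * pairing (s j) h)) \<partial>spine j)" for j
      proof -
        have "emeasure (distr (Q j) seqM (trunc k)) A = (\<integral>\<^sup>+s. indicator A s \<partial>distr (Q j) seqM (trunc k))" by simp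
        also have "\<dots> = (\<integral>\<^sup>+s. indicator A (trunc k s) \<partial>Q j)" by (subst nn_integral_distr) auto
        finally show ?thesis by (simp add: Q_int mult.commute)
      qed
      show "emeasure (distr (Q (Suc k)) seqM (trunc k)) A = emeasure (distr (Q k) seqM (trunc k)) A"
        unfolding * by (subst consistent) (auto simp: trunc_trunc)
    qed simp
  qed
  then obtain R where R: "prob_space R" "sets R = sets seqM" "\<And>k. distr R seqM (trunc k) = distr (Q k) seqM (trunc k)" by blast
  interpret R: prob_space R by (rule R)
  note [measurable_cong] = R(2)
  \<comment> \<open>Properties of the first \<open>k + 1\<close> coordinates pass from
    \<open>spine k\<close> to \<open>R\<close>: the biased law has a density, and \<open>R\<close>
    and \<open>Q k\<close> agree after truncation.\<close>
  have AE_R: "AE s in R. p s" if p: "AE s in spine k. p s" "Measurable.pred seqM p" "\<And>s. p (trunc k s) = p s" for p k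
  proof -
    note [measurable] = p(2)
    have "AE s in Q k. p s" unfolding Q_def by (subst AE_density) (use p(1) in auto)
    then have "AE s in distr (Q k) seqM (trunc k). p s" by (subst AE_distr_iff) (auto simp: p(3))
    then have "AE s in distr R seqM (trunc k). p s" by (subst R(3))
    then show ?thesis by (subst (asm) AE_distr_iff) (auto simp: p(3))
  qed
  have R_int: "(\<integral>\<^sup>+s. \<phi> (s k) \<partial>R) = (\<integral>\<^sup>+s. \<phi> (s k) \<partial>Q k)" if [measurable]: "\<phi> \<in> borel_measurable borel" for \<phi> :: "locfin_measure \<Rightarrow> ennreal" and k
  proof -
    have "(\<integral>\<^sup>+s. \<phi> (s k) \<partial>R) = (\<integral>\<^sup>+s. \<phi> (s k) \<partial>distr R seqM (trunc k))"
      by (subst nn_integral_distr) (auto simp: trunc_def)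
    also have "\<dots> = (\<integral>\<^sup>+s. \<phi> (s k) \<partial>Q k)"
      unfolding R(3) by (subst nn_integral_distr) (auto simp: trunc_def)
    finally show ?thesis .
  qed
  have dec: "AE s in R. \<forall>i. below (s (Suc i)) (s i)"
    unfolding AE_all_countable
  proof
    fix i
    have "AE s in spine (Suc i). below (s (Suc i)) (s i)" using spine_below by eventually_elim auto
    then show "AE s in R. below (s (Suc i)) (s i)"
      by (rule AE_R) (auto simp: trunc_def)
  qed
  \<comment> \<open>The constant density \<open>m\<close> undoes the normalisation.\<close>
  define \<nu> where "\<nu> = density (distr R borel lim_locfin) (\<lambda>_. m)"
  have int\<nu>: "(\<integral>\<^sup>+\<mu>. g \<mu> \<partial>\<nu>) = m * (\<integral>\<^sup>+s. g (lim_locfin s) \<partial>R)" if [measurable]: "g \<in> borel_measurable borel" for g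
    unfolding \<nu>_def by (subst nn_integral_density) (auto simp: nn_integral_distr nn_integral_cmult)
  have "(\<integral>\<^sup>+\<mu>. ex f \<mu> \<partial>\<nu>) = ennreal (kum (\<lambda>x. f x + h x) - kum f)" if f: "adm f" for f
  proof -
    note [measurable] = admD(1)[OF f]
    have "AE s in spine 0. pairing (s 0) f < \<top>"
      unfolding spine.simps using admD(3)[OF f] by (subst AE_distr_iff[OF measurable_const_seq]) auto
    then have fin: "AE s in R. pairing (s 0) f < \<top>"
      by (rule AE_R) (auto simp: trunc_def)
    have "(\<lambda>k. \<integral>\<^sup>+s. ex f (s k) \<partial>R) \<longlonglongrightarrow> (\<integral>\<^sup>+s. ex f (lim_locfin s) \<partial>R)"
    proof (rule nn_integral_dominated_convergence[where w="\<lambda>_. 1"])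
      show "AE s in R. (\<lambda>k. ex f (s k)) \<longlonglongrightarrow> ex f (lim_locfin s)"
        using dec fin
      proof eventually_elim
        case (elim s)
        then have "(\<lambda>k. pairing (s k) f) \<longlonglongrightarrow> pairing (lim_locfin s) f" by (intro tendsto_lim_locfin) auto
        then show ?case by (intro tendsto_ennrealI tendsto_exp_neg)
      qed
    qed (auto simp: ennreal_le_1 R.emeasure_space_1)
    then have "(\<lambda>k. m * (\<integral>\<^sup>+s. ex f (s k) \<partial>R)) \<longlonglongrightarrow> m * (\<integral>\<^sup>+s. ex f (lim_locfin s) \<partial>R)"
      using m by (intro ennreal_tendsto_cmult) auto
    moreover have "(\<lambda>k. m * (\<integral>\<^sup>+s. ex f (s k) \<partial>R)) \<longlonglongrightarrow> ennreal (kum (\<lambda>x. f x + h x) - kum f)"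
    proof -
      have eq: "m * (\<integral>\<^sup>+s. ex f (s k) \<partial>R) = (\<integral>\<^sup>+s. wt (s 0) * (2 ^ k * pairing (s k) h) * ex f (s k) \<partial>spine k)" for k
        by (subst R_int) (auto simp: Q_int mult.assoc[symmetric] mi)
      have lim1: "(\<lambda>k. inc k (ex f)) \<longlonglongrightarrow> ennreal (kum (\<lambda>x. f x + h x) - kum f)"
        unfolding inc_ex[OF f] by (intro tendsto_ennrealI tendsto_two_pow_exp)
      have "(\<lambda>k::nat. kum h * (1 / 2) ^ k) \<longlonglongrightarrow> kum h * 0"
        by (intro tendsto_intros LIMSEQ_realpow_zero) auto
      from tendsto_exp[OF this] have "(\<lambda>k. exp (kum h / 2 ^ k)) \<longlonglongrightarrow> exp 0"
        by (simp add: power_divide)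
      then have "(\<lambda>k. ennreal (exp (kum h / 2 ^ k)) * inc k (ex f)) \<longlonglongrightarrow> ennreal (exp 0) * ennreal (kum (\<lambda>x. f x + h x) - kum f)"
        using lim1 by (intro tendsto_mult_ennreal tendsto_ennrealI) auto
      then have lim2: "(\<lambda>k. ennreal (exp (kum h / 2 ^ k)) * inc k (ex f)) \<longlonglongrightarrow> ennreal (kum (\<lambda>x. f x + h x) - kum f)" by simp
      show ?thesis unfolding eq
        by (rule tendsto_sandwich[OF _ _ lim1 lim2]) (intro always_eventually allI weighted_bounds, measurable)+
    qed
    ultimately have "m * (\<integral>\<^sup>+s. ex f (lim_locfin s) \<partial>R) = ennreal (kum (\<lambda>x. f x + h x) - kum f)"
      by (rule LIMSEQ_unique)
    then show ?thesis by (subst int\<nu>) auto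
  qed
  moreover have "finite_measure \<nu>"
  proof
    have "emeasure \<nu> (space \<nu>) = (\<integral>\<^sup>+\<mu>. 1 \<partial>\<nu>)" by simp
    also have "\<dots> = m" by (subst int\<nu>) (auto simp: R.emeasure_space_1)
    finally show "emeasure \<nu> (space \<nu>) \<noteq> \<infinity>" using m by simp
  qed
  moreover have "sets \<nu> = sets borel" by (simp add: \<nu>_def)
  ultimately show ?thesis by blast
qed

end

theorem (in superposable_law) increment_measure_exists:
  assumes "adm h"
  shows "\<exists>\<nu>. finite_measure \<nu> \<and> sets \<nu> = sets (borel :: locfin_measure measure) \<and>
     (\<forall>f. adm f \<longrightarrow> (\<integral>\<^sup>+\<mu>. ex f \<mu> \<partial>\<nu>) = ennreal (kum (\<lambda>x. f x + h x) - kum f))"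
proof -
  interpret spine_weight L h by unfold_locales fact
  show ?thesis by (rule increment_measure)
qed

section \<open>Uniqueness for infinite measures through a finite weighting\<close>

lemma laplace_unique_nn_integral:
  assumes fin: "finite_measure \<nu>" "finite_measure \<nu>'"
    and sets: "sets \<nu> = sets (borel :: locfin_measure measure)" "sets \<nu>' = sets borel"
    and eq: "\<And>f. test_fun f \<Longrightarrow>
      (\<integral>\<^sup>+\<mu>. ennreal (exp_neg (pairing \<mu> f)) \<partial>\<nu>) = (\<integral>\<^sup>+\<mu>. ennreal (exp_neg (pairing \<mu> f)) \<partial>\<nu>')"
  shows "\<nu> = \<nu>'"
proof (rule laplace_functional_unique[OF fin sets])
  note [measurable_cong] = sets
  fix f assume f: "test_fun f"
  note [measurable] = test_funD(1)[OF f]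
  show "(\<integral>\<mu>. exp_neg (pairing \<mu> f) \<partial>\<nu>) = (\<integral>\<mu>. exp_neg (pairing \<mu> f) \<partial>\<nu>')"
    using eq[OF f] by (subst (1 2) integral_eq_nn_integral) auto
qed

text \<open>Multiplication by \<open>p\<close> makes both measures finite, so their Laplace
  functionals decide. As \<open>p\<close> is finite and vanishes at most at 0, which carries no
  mass, the multiplication can be inverted almost everywhere.\<close>

lemma weighted_laplace_unique:
  assumes sets: "sets \<Lambda> = sets (borel :: locfin_measure measure)" "sets \<Lambda>' = sets borel"
    and zero: "emeasure \<Lambda> {0} = 0" "emeasure \<Lambda>' {0} = 0"
    and p [measurable]: "p \<in> borel_measurable borel" and p0: "\<And>\<mu>. \<mu> \<noteq> 0 \<Longrightarrow> p \<mu> \<noteq> 0" "\<And>\<mu>. p \<mu> \<noteq> \<top>"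
    and eq: "\<And>f. test_fun f \<Longrightarrow> (\<integral>\<^sup>+\<mu>. ennreal (exp_neg (pairing \<mu> f)) * p \<mu> \<partial>\<Lambda>) =
      (\<integral>\<^sup>+\<mu>. ennreal (exp_neg (pairing \<mu> f)) * p \<mu> \<partial>\<Lambda>')"
    and fin: "(\<integral>\<^sup>+\<mu>. p \<mu> \<partial>\<Lambda>) < \<top>"
  shows "\<Lambda> = \<Lambda>'"
proof -
  note [measurable_cong] = sets
  have fin': "(\<integral>\<^sup>+\<mu>. p \<mu> \<partial>\<Lambda>') < \<top>"
    using eq[OF test_fun_0] fin by (simp add: pairing_def)
  have "density \<Lambda> p = density \<Lambda>' p"
  proof (rule laplace_unique_nn_integral)
    show "finite_measure (density \<Lambda> p)" "finite_measure (density \<Lambda>' p)"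
      using fin fin' by (auto intro!: finite_measureI simp: emeasure_density cong: nn_integral_cong)
    fix f assume f: "test_fun f"
    note [measurable] = test_funD(1)[OF f]
    show "(\<integral>\<^sup>+\<mu>. ennreal (exp_neg (pairing \<mu> f)) \<partial>density \<Lambda> p) = (\<integral>\<^sup>+\<mu>. ennreal (exp_neg (pairing \<mu> f)) \<partial>density \<Lambda>' p)"
      using eq[OF f] by (simp add: nn_integral_density mult.commute)
  qed (use sets in auto)
  moreover have "density (density M p) (\<lambda>\<mu>. inverse (p \<mu>)) = M"
    if M: "sets M = sets borel" "emeasure M {0} = 0" for M
  proof -
    note [measurable_cong] = M(1)
    have "{0} \<in> null_sets M" using M by (auto simp: null_sets_def)
    then have ae: "AE \<mu> in M. \<mu> \<noteq> 0" by (rule AE_I') auto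
    have "density (density M p) (\<lambda>\<mu>. inverse (p \<mu>)) = density M (\<lambda>\<mu>. p \<mu> * inverse (p \<mu>))"
      by (rule density_density_eq) auto
    also have "\<dots> = density M (\<lambda>_. 1)"
    proof (rule density_cong)
      show "AE \<mu> in M. p \<mu> * inverse (p \<mu>) = 1"
        using ae
      proof eventually_elim
        case (elim \<mu>)
        then show ?case using ennreal_divide_self[of "p \<mu>"] p0[of \<mu>]
          by (simp add: divide_ennreal_def top.not_eq_extremum)
      qed
    qed auto
    finally show ?thesis by (simp add: density_1)
  qed
  ultimately show ?thesis using sets zero by metis
qed

lemma ennreal_one_minus_mult:
  assumes "0 \<le> a" "a \<le> 1" "0 \<le> b" "b \<le> 1"
  shows "ennreal (1 - a) + ennreal a * ennreal (1 - b) = ennreal (1 - a * b)"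
proof -
  have "ennreal (1 - a) + ennreal a * ennreal (1 - b) = ennreal ((1 - a) + a * (1 - b))"
    using assms by (simp add: ennreal_mult ennreal_plus)
  then show ?thesis by (simp add: algebra_simps)
qed

text \<open>Stated as a sum and not as a difference: the integrals may be infinite, and subtraction
  in [0,\<infinity>] would lose information.\<close>

lemma nn_integral_exp_neg_diff:
  fixes \<Lambda> :: "locfin_measure measure"
  assumes sets: "sets \<Lambda> = sets borel"
    and f [measurable]: "f \<in> borel_measurable borel" "\<And>x. 0 \<le> f x"
    and g [measurable]: "g \<in> borel_measurable borel" "\<And>x. 0 \<le> g x"
    and p [measurable]: "p \<in> borel_measurable borel"
  shows "(\<integral>\<^sup>+\<mu>. ennreal (exp_neg (pairing \<mu> f)) * (ennreal (1 - exp_neg (pairing \<mu> g)) * p \<mu>) \<partial>\<Lambda>) +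
    (\<integral>\<^sup>+\<mu>. ennreal (exp_neg (pairing \<mu> (\<lambda>x. f x + g x))) * p \<mu> \<partial>\<Lambda>) =
    (\<integral>\<^sup>+\<mu>. ennreal (exp_neg (pairing \<mu> f)) * p \<mu> \<partial>\<Lambda>)"
proof -
  note [measurable_cong] = sets
  have "(\<integral>\<^sup>+\<mu>. ennreal (exp_neg (pairing \<mu> f)) * (ennreal (1 - exp_neg (pairing \<mu> g)) * p \<mu>) \<partial>\<Lambda>) +
    (\<integral>\<^sup>+\<mu>. ennreal (exp_neg (pairing \<mu> (\<lambda>x. f x + g x))) * p \<mu> \<partial>\<Lambda>) =
    (\<integral>\<^sup>+\<mu>. ennreal (exp_neg (pairing \<mu> f)) * (ennreal (1 - exp_neg (pairing \<mu> g)) * p \<mu>) +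
      ennreal (exp_neg (pairing \<mu> (\<lambda>x. f x + g x))) * p \<mu> \<partial>\<Lambda>)"
    by (rule nn_integral_add[symmetric]) measurable
  also have "\<dots> = (\<integral>\<^sup>+\<mu>. ennreal (exp_neg (pairing \<mu> f)) * p \<mu> \<partial>\<Lambda>)"
  proof (rule nn_integral_cong)
    fix \<mu>
    let ?a = "exp_neg (pairing \<mu> f)" and ?b = "exp_neg (pairing \<mu> g)"
    have "ennreal ?a * (ennreal (1 - ?b) * p \<mu>) + ennreal (?a * ?b) * p \<mu> =
      ennreal ?a * ((ennreal (1 - ?b) + ennreal ?b) * p \<mu>)"
      by (simp add: ennreal_mult distrib_left distrib_right mult.assoc)
    also have "ennreal (1 - ?b) + ennreal ?b = 1" by (simp add: ennreal_plus[symmetric] del: ennreal_plus)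
    finally show "ennreal (exp_neg (pairing \<mu> f)) * (ennreal (1 - exp_neg (pairing \<mu> g)) * p \<mu>) +
      ennreal (exp_neg (pairing \<mu> (\<lambda>x. f x + g x))) * p \<mu> = ennreal (exp_neg (pairing \<mu> f)) * p \<mu>"
      using f g by (simp add: pairing_add exp_neg_add)
  qed
  finally show ?thesis .
qed

section \<open>The Levy measure\<close>

context superposable_law
begin

text \<open>Expressed by first differences in strictly positive directions \<open>h\<close>, the
  form in which the increment measure delivers it. The constant \<open>c\<close> may depend on
  \<open>h\<close> but not on \<open>f\<close>; it will be the drift of \<open>h\<close>.\<close>

definition levy_measure :: "locfin_measure measure \<Rightarrow> bool" where
  "levy_measure \<Lambda> \<longleftrightarrow> sets \<Lambda> = sets borel \<and> emeasure \<Lambda> {0} = 0 \<and>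
    (\<forall>h. adm h \<and> (\<forall>x. 0 < h x) \<longrightarrow> (\<exists>c\<ge>0. \<forall>f. adm f \<longrightarrow>
      ennreal (kum (\<lambda>x. f x + h x) - kum f) =
      ennreal c + (\<integral>\<^sup>+\<mu>. ex f \<mu> * ennreal (1 - exp_neg (pairing \<mu> h)) \<partial>\<Lambda>)))"

text \<open>Comparing the first differences at \<open>f\<close> and at \<open>f + g\<close> cancels
  the unknown constant \<open>c\<close>, and what is left involves \<open>\<Lambda>\<close>
  alone.\<close>

lemma second_difference:
  assumes sets: "sets \<Lambda> = sets borel"
    and c: "0 \<le> c" "\<And>f. adm f \<Longrightarrow> ennreal (kum (\<lambda>x. f x + h x) - kum f) =
      ennreal c + (\<integral>\<^sup>+\<mu>. ex f \<mu> * ennreal (1 - exp_neg (pairing \<mu> h)) \<partial>\<Lambda>)"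
    and adm: "adm f" "adm g" "adm h"
  shows "(\<integral>\<^sup>+\<mu>. ex f \<mu> * (ennreal (1 - exp_neg (pairing \<mu> g)) * ennreal (1 - exp_neg (pairing \<mu> h))) \<partial>\<Lambda>) =
    ennreal (kum (\<lambda>x. f x + h x) + kum (\<lambda>x. f x + g x) - kum f - kum (\<lambda>x. f x + g x + h x))"
proof -
  note [measurable] = admD(1)[OF adm(3)]
  note fg = adm_add[OF adm(1,2)]
  let ?X = "\<integral>\<^sup>+\<mu>. ex f \<mu> * (ennreal (1 - exp_neg (pairing \<mu> g)) * ennreal (1 - exp_neg (pairing \<mu> h))) \<partial>\<Lambda>"
  have "?X + ennreal (kum (\<lambda>x. f x + g x + h x) - kum (\<lambda>x. f x + g x)) =
    ennreal c + (?X + (\<integral>\<^sup>+\<mu>. ex (\<lambda>x. f x + g x) \<mu> * ennreal (1 - exp_neg (pairing \<mu> h)) \<partial>\<Lambda>))"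
    unfolding c(2)[OF fg] by (simp add: add_ac)
  also have "\<dots> = ennreal c + (\<integral>\<^sup>+\<mu>. ex f \<mu> * ennreal (1 - exp_neg (pairing \<mu> h)) \<partial>\<Lambda>)"
    using adm by (subst nn_integral_exp_neg_diff[OF sets]) (auto simp: admD)
  also have "\<dots> = ennreal (kum (\<lambda>x. f x + h x) - kum f)" using c(2)[OF adm(1)] by simp
  finally have eq: "?X + ennreal (kum (\<lambda>x. f x + g x + h x) - kum (\<lambda>x. f x + g x)) = ennreal (kum (\<lambda>x. f x + h x) - kum f)" .
  have "?X \<le> ennreal (kum (\<lambda>x. f x + h x) - kum f)" unfolding eq[symmetric] by simp
  also have "\<dots> < \<top>" by simp
  finally have "?X < \<top>" .
  then obtain r where r: "0 \<le> r" "?X = ennreal r" by (cases ?X) auto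
  have d: "0 \<le> kum (\<lambda>x. f x + g x + h x) - kum (\<lambda>x. f x + g x)" "0 \<le> kum (\<lambda>x. f x + h x) - kum f"
    using adm_kum_add_le[OF fg adm(3)] adm_kum_add_le[OF adm(1,3)] by auto
  from eq have "ennreal (r + (kum (\<lambda>x. f x + g x + h x) - kum (\<lambda>x. f x + g x))) = ennreal (kum (\<lambda>x. f x + h x) - kum f)"
    using r d by (simp add: ennreal_plus)
  then have "r + (kum (\<lambda>x. f x + g x + h x) - kum (\<lambda>x. f x + g x)) = kum (\<lambda>x. f x + h x) - kum f"
    using r d by (subst (asm) ennreal_inj) auto
  then show ?thesis using r by (simp add: algebra_simps)
qed

text \<open>At the zero measure exp(-<\<mu>,f>) is 1 whatever \<open>f\<close> is, so the atom of
  the increment measure there is the constant \<open>c\<close>; everywhere else the weight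
  \<open>p\<close> is positive and can be divided out.\<close>

lemma levy_measure_local:
  assumes h: "adm h" "\<And>x. 0 < h x"
  shows "\<exists>\<Lambda> c. sets \<Lambda> = sets borel \<and> emeasure \<Lambda> {0} = 0 \<and> 0 \<le> c \<and> (\<forall>f. adm f \<longrightarrow>
      ennreal (kum (\<lambda>x. f x + h x) - kum f) =
      ennreal c + (\<integral>\<^sup>+\<mu>. ex f \<mu> * ennreal (1 - exp_neg (pairing \<mu> h)) \<partial>\<Lambda>))"
proof -
  obtain \<nu> where \<nu>: "finite_measure \<nu>" "sets \<nu> = sets borel"
    "\<And>f. adm f \<Longrightarrow> (\<integral>\<^sup>+\<mu>. ex f \<mu> \<partial>\<nu>) = ennreal (kum (\<lambda>x. f x + h x) - kum f)"
    using increment_measure_exists[OF h(1)] by blast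
  interpret \<nu>: finite_measure \<nu> by fact
  note [measurable_cong] = \<nu>(2)
  note [measurable] = admD(1)[OF h(1)]
  define p where "p = (\<lambda>\<mu>. ennreal (1 - exp_neg (pairing \<mu> h)))"
  have [measurable]: "p \<in> borel_measurable borel" unfolding p_def by measurable
  have p0: "p \<mu> \<noteq> 0" "p \<mu> < \<top>" if "\<mu> \<noteq> 0" for \<mu>
    using that exp_neg_less_1[of "pairing \<mu> h"] pairing_pos[of h \<mu>] h by (auto simp: p_def admD)
  define \<Lambda> where "\<Lambda> = density \<nu> (\<lambda>\<mu>. indicator (- {0}) \<mu> * inverse (p \<mu>))"
  have [measurable_cong]: "sets \<Lambda> = sets borel" by (simp add: \<Lambda>_def \<nu>)
  have [measurable]: "- {0 :: locfin_measure} \<in> sets borel" using sets_zero_locfin by (rule sets.compl_sets[of _ borel, unfolded space_borel, folded Compl_eq_Diff_UNIV])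
  have "emeasure \<Lambda> {0} = (\<integral>\<^sup>+\<mu>. indicator (- {0}) \<mu> * inverse (p \<mu>) * indicator {0} \<mu> \<partial>\<nu>)"
    unfolding \<Lambda>_def by (subst emeasure_density) auto
  also have "\<dots> = (\<integral>\<^sup>+\<mu>. 0 \<partial>\<nu>)" by (intro nn_integral_cong) (auto simp: indicator_def)
  finally have z: "emeasure \<Lambda> {0} = 0" by simp
  define c where "c = measure \<nu> {0}"
  have "ennreal (kum (\<lambda>x. f x + h x) - kum f) =
      ennreal c + (\<integral>\<^sup>+\<mu>. ex f \<mu> * ennreal (1 - exp_neg (pairing \<mu> h)) \<partial>\<Lambda>)" if f: "adm f" for f
  proof -
    note [measurable] = admD(1)[OF f]
    have "(\<integral>\<^sup>+\<mu>. ex f \<mu> * p \<mu> \<partial>\<Lambda>) = (\<integral>\<^sup>+\<mu>. indicator (- {0}) \<mu> * inverse (p \<mu>) * (ex f \<mu> * p \<mu>) \<partial>\<nu>)"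
      unfolding \<Lambda>_def by (subst nn_integral_density) auto
    also have "\<dots> = (\<integral>\<^sup>+\<mu>. ex f \<mu> * indicator (- {0}) \<mu> \<partial>\<nu>)"
    proof (intro nn_integral_cong)
      fix \<mu>
      show "indicator (- {0}) \<mu> * inverse (p \<mu>) * (ex f \<mu> * p \<mu>) = ex f \<mu> * indicator (- {0}) \<mu>"
      proof (cases "\<mu> = 0")
        case False
        then have "p \<mu> * inverse (p \<mu>) = 1"
          using ennreal_divide_self[of "p \<mu>"] p0[of \<mu>] by (simp add: divide_ennreal_def)
        then have "ex f \<mu> * (p \<mu> * inverse (p \<mu>)) = ex f \<mu>" by simp
        then show ?thesis using False by (simp add: mult_ac)
      qed simp
    qed
    finally have L: "(\<integral>\<^sup>+\<mu>. ex f \<mu> * p \<mu> \<partial>\<Lambda>) = (\<integral>\<^sup>+\<mu>. ex f \<mu> * indicator (- {0}) \<mu> \<partial>\<nu>)" .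
    have "ennreal (kum (\<lambda>x. f x + h x) - kum f) = (\<integral>\<^sup>+\<mu>. ex f \<mu> * indicator {0} \<mu> + ex f \<mu> * indicator (- {0}) \<mu> \<partial>\<nu>)"
      unfolding \<nu>(3)[OF f, symmetric] by (intro nn_integral_cong) (auto simp: indicator_def)
    also have "\<dots> = (\<integral>\<^sup>+\<mu>. ex f \<mu> * indicator {0} \<mu> \<partial>\<nu>) + (\<integral>\<^sup>+\<mu>. ex f \<mu> * indicator (- {0}) \<mu> \<partial>\<nu>)"
      by (rule nn_integral_add) auto
    also have "(\<integral>\<^sup>+\<mu>. ex f \<mu> * indicator {0} \<mu> \<partial>\<nu>) = (\<integral>\<^sup>+\<mu>. indicator {0} \<mu> \<partial>\<nu>)"
      by (intro nn_integral_cong) (auto simp: indicator_def)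
    also have "\<dots> = ennreal c" by (simp add: c_def \<nu>.emeasure_eq_measure \<nu>)
    finally show ?thesis unfolding p_def[symmetric] using L by (simp add: p_def)
  qed
  moreover have "sets \<Lambda> = sets borel" "0 \<le> c" by (auto simp: \<Lambda>_def \<nu> c_def)
  ultimately show ?thesis using z by blast
qed

text \<open>The second differences of the cumulant are symmetric in the two increments, so the measure
  found for one increment serves all of them.\<close>

theorem levy_measure_exists: "\<exists>\<Lambda>. levy_measure \<Lambda>"
proof -
  obtain h0 where h0: "adm h0" "\<And>x. 0 < h0 x" using ex_adm_pos by blast
  obtain \<Lambda> c where \<Lambda>: "sets \<Lambda> = sets borel" "emeasure \<Lambda> {0} = 0" "0 \<le> c"
    "\<And>f. adm f \<Longrightarrow> ennreal (kum (\<lambda>x. f x + h0 x) - kum f) =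
      ennreal c + (\<integral>\<^sup>+\<mu>. ex f \<mu> * ennreal (1 - exp_neg (pairing \<mu> h0)) \<partial>\<Lambda>)"
    using levy_measure_local[OF h0] by blast
  have "\<exists>c\<ge>0. \<forall>f. adm f \<longrightarrow> ennreal (kum (\<lambda>x. f x + h x) - kum f) =
      ennreal c + (\<integral>\<^sup>+\<mu>. ex f \<mu> * ennreal (1 - exp_neg (pairing \<mu> h)) \<partial>\<Lambda>)"
    if h: "adm h" "\<And>x. 0 < h x" for h
  proof -
    obtain \<Lambda>' c' where \<Lambda>': "sets \<Lambda>' = sets borel" "emeasure \<Lambda>' {0} = 0" "0 \<le> c'"
      "\<And>f. adm f \<Longrightarrow> ennreal (kum (\<lambda>x. f x + h x) - kum f) =
        ennreal c' + (\<integral>\<^sup>+\<mu>. ex f \<mu> * ennreal (1 - exp_neg (pairing \<mu> h)) \<partial>\<Lambda>')"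
      using levy_measure_local[OF h] by blast
    note [measurable] = admD(1)[OF h0(1)] admD(1)[OF h(1)]
    let ?p = "\<lambda>\<mu>. ennreal (1 - exp_neg (pairing \<mu> h)) * ennreal (1 - exp_neg (pairing \<mu> h0))"
    have "\<Lambda> = \<Lambda>'"
    proof (rule weighted_laplace_unique[where p="?p"])
      show "?p \<mu> \<noteq> 0" if "\<mu> \<noteq> 0" for \<mu>
        using that pairing_pos[of h \<mu>] pairing_pos[of h0 \<mu>] h h0 exp_neg_less_1
        by (auto simp: admD ennreal_eq_0_iff not_le)
      have eqs: "(\<integral>\<^sup>+\<mu>. ex f \<mu> * ?p \<mu> \<partial>\<Lambda>) =
        ennreal (kum (\<lambda>x. f x + h0 x) + kum (\<lambda>x. f x + h x) - kum f - kum (\<lambda>x. f x + h x + h0 x))" if "adm f" for f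
        by (rule second_difference[OF \<Lambda>(1,3,4) that h(1) h0(1)])
      show "(\<integral>\<^sup>+\<mu>. ex f \<mu> * ?p \<mu> \<partial>\<Lambda>) = (\<integral>\<^sup>+\<mu>. ex f \<mu> * ?p \<mu> \<partial>\<Lambda>')" if "test_fun f" for f
      proof -
        have f: "adm f" by (rule adm_test_fun[OF that])
        show ?thesis unfolding eqs[OF f]
          using second_difference[OF \<Lambda>'(1,3,4) f h0(1) h(1)] by (simp add: mult.commute add_ac)
      qed
      show "(\<integral>\<^sup>+\<mu>. ?p \<mu> \<partial>\<Lambda>) < \<top>" using eqs[OF adm_0] by (simp add: pairing_def)
      show "?p \<mu> \<noteq> \<top>" for \<mu> by (simp add: ennreal_mult_eq_top_iff)
    qed (use \<Lambda> \<Lambda>' in auto)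
    then show ?thesis using \<Lambda>' by blast
  qed
  then show ?thesis using \<Lambda> by (auto simp: levy_measure_def)
qed

end

locale levy_law = superposable_law +
  fixes \<Lambda> :: "locfin_measure measure"
  assumes levy: "levy_measure \<Lambda>"
begin

lemma sets_\<Lambda> [simp, measurable_cong]: "sets \<Lambda> = sets borel"
  using levy by (simp add: levy_measure_def)

lemma null_\<Lambda>: "emeasure \<Lambda> {0} = 0"
  using levy by (simp add: levy_measure_def)

lemma levyE:
  assumes "adm h" "\<And>x. 0 < h x"
  obtains c where "0 \<le> c" "\<And>f. adm f \<Longrightarrow> ennreal (kum (\<lambda>x. f x + h x) - kum f) =
      ennreal c + (\<integral>\<^sup>+\<mu>. ex f \<mu> * ennreal (1 - exp_neg (pairing \<mu> h)) \<partial>\<Lambda>)"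
  using levy assms unfolding levy_measure_def by blast

section \<open>Jump part, drift and their scaling\<close>

definition jump :: "(real \<Rightarrow> real) \<Rightarrow> ennreal" where
  "jump f = (\<integral>\<^sup>+\<mu>. ennreal (1 - exp_neg (pairing \<mu> f)) \<partial>\<Lambda>)"

lemma jump_mono: "(\<And>x. f x \<le> g x) \<Longrightarrow> jump f \<le> jump g"
  unfolding jump_def by (intro nn_integral_mono ennreal_leI diff_mono exp_neg_mono pairing_mono order_refl)

text \<open>\<open>f\<close> is enlarged to the strictly positive f + h, whose jump part is bounded
  by the first difference at 0.\<close>

lemma jump_finite:
  assumes f: "adm f"
  shows "jump f < \<top>"
proof -
  obtain h where h: "adm h" "\<And>x. 0 < h x" using ex_adm_pos by blast
  have fh: "adm (\<lambda>x. f x + h x)" "\<And>x. 0 < f x + h x"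
    using adm_add[OF f h(1)] h(2) admD(2)[OF f] by (auto intro: add_nonneg_pos)
  obtain c where c: "\<And>g. adm g \<Longrightarrow> ennreal (kum (\<lambda>x. g x + (f x + h x)) - kum g) =
      ennreal c + (\<integral>\<^sup>+\<mu>. ex g \<mu> * ennreal (1 - exp_neg (pairing \<mu> (\<lambda>x. f x + h x))) \<partial>\<Lambda>)"
    using levyE[OF fh] by blast
  have "jump f \<le> jump (\<lambda>x. f x + h x)" using h(2) by (intro jump_mono) (simp add: less_imp_le)
  also have "\<dots> \<le> ennreal (kum (\<lambda>x. f x + h x))" using c[OF adm_0] by (simp add: jump_def pairing_def)
  also have "\<dots> < \<top>" by simp
  finally show ?thesis .
qed

lemma jump_add:
  assumes f: "adm f" and g: "adm g"
  shows "jump (\<lambda>x. f x + g x) = jump f + (\<integral>\<^sup>+\<mu>. ex f \<mu> * ennreal (1 - exp_neg (pairing \<mu> g)) \<partial>\<Lambda>)"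
proof -
  note [measurable] = admD(1)[OF f] admD(1)[OF g]
  have "jump f + (\<integral>\<^sup>+\<mu>. ex f \<mu> * ennreal (1 - exp_neg (pairing \<mu> g)) \<partial>\<Lambda>) =
    (\<integral>\<^sup>+\<mu>. ennreal (1 - exp_neg (pairing \<mu> f)) + ex f \<mu> * ennreal (1 - exp_neg (pairing \<mu> g)) \<partial>\<Lambda>)"
    unfolding jump_def by (rule nn_integral_add[symmetric]) measurable
  also have "\<dots> = jump (\<lambda>x. f x + g x)"
    unfolding jump_def using f g
    by (intro nn_integral_cong) (simp add: pairing_add admD exp_neg_add ennreal_one_minus_mult)
  finally show ?thesis ..
qed

definition drift :: "(real \<Rightarrow> real) \<Rightarrow> real" where
  "drift f = kum f - enn2real (jump f)"

lemma drift_0: "drift (\<lambda>_. 0) = 0"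
  by (simp add: drift_def jump_def pairing_def)

text \<open>The constant in \<open>levyE\<close> does not depend on \<open>f\<close>; evaluated at f
  = 0 it is the drift of \<open>h\<close>.\<close>

lemma drift_add_pos:
  assumes f: "adm f" and h: "adm h" "\<And>x. 0 < h x"
  shows "drift (\<lambda>x. f x + h x) = drift f + drift h" "0 \<le> drift h"
proof -
  obtain c where c: "0 \<le> c" "\<And>f. adm f \<Longrightarrow> ennreal (kum (\<lambda>x. f x + h x) - kum f) =
      ennreal c + (\<integral>\<^sup>+\<mu>. ex f \<mu> * ennreal (1 - exp_neg (pairing \<mu> h)) \<partial>\<Lambda>)"
    using levyE[OF h] by blast
  have *: "drift (\<lambda>x. f x + h x) = drift f + c" if f: "adm f" for f
  proof -
    let ?I = "\<integral>\<^sup>+\<mu>. ex f \<mu> * ennreal (1 - exp_neg (pairing \<mu> h)) \<partial>\<Lambda>"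
    have I: "?I < \<top>" using jump_add[OF f h(1)] jump_finite[OF adm_add[OF f h(1)]] by (simp add: less_top[symmetric])
    then obtain r where r: "0 \<le> r" "?I = ennreal r" by (cases ?I) auto
    have "ennreal (kum (\<lambda>x. f x + h x) - kum f) = ennreal (c + r)" using c(2)[OF f] r c(1) by simp
    then have "kum (\<lambda>x. f x + h x) - kum f = c + r"
      using adm_kum_add_le[OF f h(1)] r c(1) by (subst (asm) ennreal_inj) auto
    moreover have "enn2real (jump (\<lambda>x. f x + h x)) = enn2real (jump f) + r"
      unfolding jump_add[OF f h(1)] using r jump_finite[OF f] by (simp add: enn2real_plus)
    ultimately show ?thesis by (simp add: drift_def)
  qed
  have "drift h = c" using *[OF adm_0] drift_0 by simp
  then show "drift (\<lambda>x. f x + h x) = drift f + drift h" "0 \<le> drift h" using *[OF f] c(1) by auto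
qed

text \<open>A strictly positive \<open>h\<close> is added to \<open>g\<close>, so that additivity in
  positive directions applies, and is cancelled afterwards.\<close>

lemma drift_add:
  assumes f: "adm f" and g: "adm g"
  shows "drift (\<lambda>x. f x + g x) = drift f + drift g"
proof -
  obtain h where h: "adm h" "\<And>x. 0 < h x" using ex_adm_pos by blast
  have gh: "adm (\<lambda>x. g x + h x)" "\<And>x. 0 < g x + h x"
    using adm_add[OF g h(1)] h(2) admD(2)[OF g] by (auto intro: add_nonneg_pos)
  have "drift (\<lambda>x. f x + (g x + h x)) = drift (\<lambda>x. (f x + g x) + h x)" by (simp add: add.assoc)
  then show ?thesis
    using drift_add_pos(1)[OF f gh] drift_add_pos(1)[OF g h] drift_add_pos(1)[OF adm_add[OF f g] h] by linarith
qed

text \<open>For each c > 0 the function f + c h is strictly positive, so its drift, which is the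
  drift of \<open>f\<close> plus \<open>c\<close> times that of \<open>h\<close>, is nonnegative;
  then c tends to 0.\<close>

lemma drift_nonneg:
  assumes f: "adm f"
  shows "0 \<le> drift f"
proof -
  obtain h where h: "adm h" "\<And>x. 0 < h x" using ex_adm_pos by blast
  have ch: "adm (\<lambda>x. c * h x)" "\<And>x. 0 < c * h x" if "0 < c" for c using adm_cmult[OF h(1)] h(2) that by auto
  have "drift (\<lambda>x. c * h x) = c * drift (\<lambda>x. 1 * h x)" if "0 < c" for c
  proof (rule additive_nonneg_imp_linear[OF _ _ that, where k="\<lambda>c. drift (\<lambda>x. c * h x)"])
    show "0 \<le> drift (\<lambda>x. t * h x)" if "0 < t" for t by (rule drift_add_pos(2)[OF adm_0 ch[OF that]])
    show "drift (\<lambda>x. (s + t) * h x) = drift (\<lambda>x. s * h x) + drift (\<lambda>x. t * h x)" if "0 < s" "0 < t" for s t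
      using drift_add_pos(1)[OF ch(1)[OF that(1)] ch[OF that(2)]] by (simp add: distrib_right)
  qed
  moreover have "0 \<le> drift f + drift (\<lambda>x. c * h x)" if "0 < c" for c
  proof -
    have "adm (\<lambda>x. f x + c * h x)" "\<And>x. 0 < f x + c * h x"
      using adm_add[OF f ch(1)[OF that]] ch(2)[OF that] admD(2)[OF f] by (auto intro: add_nonneg_pos)
    from drift_add_pos(2)[OF adm_0 this] show ?thesis using drift_add_pos(1)[OF f ch[OF that]] by simp
  qed
  ultimately have *: "- drift f \<le> c * drift h" if "0 < c" for c using that by fastforce
  have "- drift f \<le> 0"
  proof (rule field_le_epsilon)
    fix e :: real assume "0 < e"
    show "- drift f \<le> 0 + e"
    proof (cases "drift h \<le> 0")
      case True then show ?thesis using *[of 1] \<open>0 < e\<close> by simp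
    next
      case False then show ?thesis using *[of "e / drift h"] \<open>0 < e\<close> by simp
    qed
  qed
  then show ?thesis by simp
qed

lemma drift_cmult:
  assumes f: "adm f" and c: "0 \<le> c"
  shows "drift (\<lambda>x. c * f x) = c * drift f"
proof (cases "c = 0")
  case False
  then have "drift (\<lambda>x. c * f x) = c * drift (\<lambda>x. 1 * f x)"
  proof (intro additive_nonneg_imp_linear[where k="\<lambda>c. drift (\<lambda>x. c * f x)"])
    show "0 \<le> drift (\<lambda>x. t * f x)" if "0 < t" for t using that by (intro drift_nonneg adm_cmult f) auto
    show "drift (\<lambda>x. (s + t) * f x) = drift (\<lambda>x. s * f x) + drift (\<lambda>x. t * f x)" if "0 < s" "0 < t" for s t
      using drift_add[OF adm_cmult[OF f, of s] adm_cmult[OF f, of t]] that by (simp add: distrib_right)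
  qed (use c in auto)
  then show ?thesis by simp
qed (simp add: drift_0)

text \<open>For a <= 0 the multiple of \<open>\<Lambda>\<close> by e^a and its image under
  translation have the same second differences, because shifting the argument by \<open>a\<close>
  multiplies K by e^a and preserves admissibility. For a > 0 the identity at -a is inverted.\<close>

lemma levy_scaling:
  assumes [measurable]: "\<phi> \<in> borel_measurable borel"
  shows "(\<integral>\<^sup>+\<mu>. \<phi> (translate a \<mu>) \<partial>\<Lambda>) = ennreal (exp a) * (\<integral>\<^sup>+\<mu>. \<phi> \<mu> \<partial>\<Lambda>)"
proof -
  have neg: "(\<integral>\<^sup>+\<mu>. \<phi> (translate a \<mu>) \<partial>\<Lambda>) = ennreal (exp a) * (\<integral>\<^sup>+\<mu>. \<phi> \<mu> \<partial>\<Lambda>)"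
    if a: "a \<le> 0" and [measurable]: "\<phi> \<in> borel_measurable borel" for a \<phi>
  proof -
    obtain h where h: "adm h" "\<And>x. 0 < h x" using ex_adm_pos by blast
    note [measurable] = admD(1)[OF h(1)]
    let ?h = "\<lambda>x. h (x + a)"
    have sh: "adm (\<lambda>x. f (x + a))" if "adm f" for f using adm_shift[OF that, of "exp a"] a by simp
    have ksh: "kum (\<lambda>x. f (x + a)) = exp a * kum f" if "adm f" for f
      using kum_shift[OF admD(1)[OF that] lap_pos[OF that], of "exp a"] by simp
    let ?p = "\<lambda>\<mu>. ennreal (1 - exp_neg (pairing \<mu> h)) * ennreal (1 - exp_neg (pairing \<mu> h))"
    have sd: "(\<integral>\<^sup>+\<mu>. ex f \<mu> * (ennreal (1 - exp_neg (pairing \<mu> g)) * ennreal (1 - exp_neg (pairing \<mu> g))) \<partial>\<Lambda>) =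
      ennreal (kum (\<lambda>x. f x + g x) + kum (\<lambda>x. f x + g x) - kum f - kum (\<lambda>x. f x + g x + g x))"
      if "adm f" "adm g" "\<And>x. 0 < g x" for f g
      using levyE[OF that(2,3)] second_difference[OF sets_\<Lambda> _ _ that(1,2,2)] by metis
    have "density \<Lambda> (\<lambda>_. ennreal (exp a)) = distr \<Lambda> borel (translate a)"
    proof (rule weighted_laplace_unique[where p="?p"])
      show "emeasure (density \<Lambda> (\<lambda>_. ennreal (exp a))) {0} = 0"
        using null_\<Lambda> by (subst emeasure_density) (auto simp: nn_integral_cmult)
      have "translate a -` {0} \<inter> space \<Lambda> = {0}" using sets_eq_imp_space_eq[OF sets_\<Lambda>] by auto
      then show "emeasure (distr \<Lambda> borel (translate a)) {0} = 0"
        using null_\<Lambda> by (subst emeasure_distr) auto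
      show "?p \<mu> \<noteq> 0" if "\<mu> \<noteq> 0" for \<mu>
        using that exp_neg_less_1[of "pairing \<mu> h"] pairing_pos[of h \<mu>] h by (auto simp: admD)
      show "?p \<mu> \<noteq> \<top>" for \<mu> by (simp add: ennreal_mult_eq_top_iff)
      have dens: "(\<integral>\<^sup>+\<mu>. g \<mu> \<partial>density \<Lambda> (\<lambda>_. ennreal (exp a))) = ennreal (exp a) * (\<integral>\<^sup>+\<mu>. g \<mu> \<partial>\<Lambda>)"
        if [measurable]: "g \<in> borel_measurable borel" for g
        by (subst nn_integral_density) (auto simp: nn_integral_cmult)
      show "(\<integral>\<^sup>+\<mu>. ex f \<mu> * ?p \<mu> \<partial>density \<Lambda> (\<lambda>_. ennreal (exp a))) = (\<integral>\<^sup>+\<mu>. ex f \<mu> * ?p \<mu> \<partial>distr \<Lambda> borel (translate a))"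
        if "test_fun f" for f
      proof -
        have f: "adm f" by (rule adm_test_fun[OF that])
        note [measurable] = admD(1)[OF f]
        have "(\<integral>\<^sup>+\<mu>. ex f \<mu> * ?p \<mu> \<partial>distr \<Lambda> borel (translate a)) =
          (\<integral>\<^sup>+\<mu>. ex (\<lambda>x. f (x + a)) \<mu> * (ennreal (1 - exp_neg (pairing \<mu> ?h)) * ennreal (1 - exp_neg (pairing \<mu> ?h))) \<partial>\<Lambda>)"
          by (subst nn_integral_distr) (auto simp: pairing_translate)
        also have "\<dots> = ennreal (exp a * (kum (\<lambda>x. f x + h x) + kum (\<lambda>x. f x + h x) - kum f - kum (\<lambda>x. f x + h x + h x)))"
          using ksh[OF adm_add[OF f h(1)]] ksh[OF f] ksh[OF adm_add[OF adm_add[OF f h(1)] h(1)]]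
          by (subst sd[OF sh[OF f] sh[OF h(1)] h(2)]) (simp add: algebra_simps)
        also have "\<dots> = ennreal (exp a) * (\<integral>\<^sup>+\<mu>. ex f \<mu> * ?p \<mu> \<partial>\<Lambda>)"
          by (subst sd[OF f h]) (simp add: ennreal_mult')
        finally show ?thesis by (subst dens) auto
      qed
      show "(\<integral>\<^sup>+\<mu>. ?p \<mu> \<partial>density \<Lambda> (\<lambda>_. ennreal (exp a))) < \<top>"
        using sd[OF adm_0 h] by (subst dens) (auto simp: pairing_def ennreal_mult_less_top)
    qed auto
    then have "(\<integral>\<^sup>+\<mu>. \<phi> \<mu> \<partial>distr \<Lambda> borel (translate a)) = (\<integral>\<^sup>+\<mu>. \<phi> \<mu> \<partial>density \<Lambda> (\<lambda>_. ennreal (exp a)))" by simp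
    then show ?thesis
      by (subst (asm) nn_integral_distr, simp, simp, subst (asm) nn_integral_density) (auto simp: nn_integral_cmult)
  qed
  show ?thesis
  proof (cases "a \<le> 0")
    case True then show ?thesis by (rule neg) measurable
  next
    case False
    have "(\<integral>\<^sup>+\<mu>. \<phi> \<mu> \<partial>\<Lambda>) = (\<integral>\<^sup>+\<mu>. \<phi> (translate a (translate (- a) \<mu>)) \<partial>\<Lambda>)"
      by (simp add: translate_translate)
    also have "\<dots> = ennreal (exp (- a)) * (\<integral>\<^sup>+\<mu>. \<phi> (translate a \<mu>) \<partial>\<Lambda>)"
      using False by (intro neg[of "- a" "\<lambda>\<mu>. \<phi> (translate a \<mu>)"]) auto
    finally have "ennreal (exp a) * (\<integral>\<^sup>+\<mu>. \<phi> \<mu> \<partial>\<Lambda>) = ennreal (exp a) * ennreal (exp (- a)) * (\<integral>\<^sup>+\<mu>. \<phi> (translate a \<mu>) \<partial>\<Lambda>)"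
      by (simp add: mult.assoc)
    also have "ennreal (exp a) * ennreal (exp (- a)) = 1" by (simp add: ennreal_mult[symmetric] exp_minus)
    finally show ?thesis by simp
  qed
qed

lemma jump_shift:
  assumes [measurable]: "f \<in> borel_measurable borel"
  shows "jump (\<lambda>x. f (x + a)) = ennreal (exp a) * jump f"
  unfolding jump_def by (subst levy_scaling[symmetric]) (auto simp: pairing_translate)

lemma drift_shift:
  assumes "adm f"
  shows "drift (\<lambda>x. f (x + a)) = exp a * drift f"
  using kum_shift[OF admD(1)[OF assms] lap_pos[OF assms], of "exp a"]
  unfolding drift_def jump_shift[OF admD(1)[OF assms], of a] by (simp add: enn2real_mult right_diff_distrib)

end

section \<open>The Levy--Khinchin formula\<close>

lemma neg_log_0 [simp]: "neg_log 0 = \<top>"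
  by (simp add: neg_log_def)

lemma neg_log_exp [simp]: "neg_log (exp (- x)) = ennreal x"
  by (simp add: neg_log_def)

text \<open>Including the limit 0, with value infinity, lets the formula pass from test functions to
  functions with infinite cumulant.\<close>

lemma tendsto_neg_log:
  assumes lim: "(X \<longlongrightarrow> x) F" and nn: "\<And>n. 0 \<le> X n" "0 \<le> x"
  shows "((\<lambda>n. neg_log (X n)) \<longlongrightarrow> neg_log x) F"
proof (cases "x = 0")
  case False
  with nn have "0 < x" by simp
  have "((\<lambda>n. ennreal (- ln (X n))) \<longlongrightarrow> ennreal (- ln x)) F"
    using lim \<open>0 < x\<close> by (intro tendsto_intros tendsto_ennrealI) auto
  moreover have "\<forall>\<^sub>F n in F. ennreal (- ln (X n)) = neg_log (X n)"
    using order_tendstoD(1)[OF lim \<open>0 < x\<close>] by eventually_elim (simp add: neg_log_def)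
  ultimately show ?thesis using \<open>0 < x\<close> by (auto simp: neg_log_def[of x] intro: Lim_transform_eventually)
next
  case True
  show ?thesis
  proof (rule order_tendstoI)
    fix a assume "a < neg_log x"
    then obtain r where r: "0 \<le> r" "a = ennreal r" using True by (cases a) auto
    have "\<forall>\<^sub>F n in F. X n < exp (- r)" using lim True by (auto elim: order_tendstoD)
    then show "\<forall>\<^sub>F n in F. a < neg_log (X n)"
    proof eventually_elim
      case (elim n)
      show ?case
      proof (cases "X n = 0")
        case False
        then have "ln (X n) < - r" using elim nn(1)[of n] by (metis ln_exp ln_less_cancel_iff exp_gt_zero order_le_less)
        then show ?thesis using False r by (simp add: neg_log_def ennreal_less_iff)
      qed (use r in simp)
    qed
  qed (use True in \<open>simp\<close>)
qed

lemma exp_density_Ioc: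
  assumes "0 \<le> c" "a \<le> b"
  shows "emeasure (density lborel (\<lambda>x. ennreal (c * exp (- x)))) {a<..b} = ennreal (c * (exp (- a) - exp (- b)))"
proof -
  have "emeasure (density lborel (\<lambda>x. ennreal (c * exp (- x)))) {a<..b} =
    (\<integral>\<^sup>+x. ennreal (c * exp (- x)) * indicator {a<..b} x \<partial>lborel)"
    by (rule emeasure_density) auto
  also have "\<dots> = (\<integral>\<^sup>+x. ennreal (c * exp (- x)) * indicator {a..b} x \<partial>lborel)"
  proof (rule nn_integral_cong_AE)
    show "AE x in lborel. ennreal (c * exp (- x)) * indicator {a<..b} x = ennreal (c * exp (- x)) * indicator {a..b} x"
      using AE_lborel_singleton[of a] by eventually_elim (auto simp: indicator_def)
  qed
  also have "\<dots> = ennreal ((- c * exp (- b)) - (- c * exp (- a)))"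
    using assms by (intro nn_integral_FTC_Icc) (auto intro!: derivative_eq_intros)
  finally show ?thesis by (simp add: algebra_simps)
qed

lemma test_fun_mono:
  assumes "test_fun g" "f \<in> borel_measurable borel" "\<And>x. 0 \<le> f x" "\<And>x. f x \<le> g x"
  shows "test_fun f"
proof -
  obtain R B where g: "\<And>x. g x \<le> B" "\<And>x. R < \<bar>x\<bar> \<Longrightarrow> g x = 0" using assms(1) by (rule test_funE) blast
  have "f x \<le> B" for x using assms(4)[of x] g(1)[of x] by linarith
  moreover have "f x = 0" if "R < \<bar>x\<bar>" for x using assms(3,4)[of x] g(2)[OF that] by simp
  ultimately show ?thesis using assms(2,3) by (intro test_funI)
qed

text \<open>Summability forces 1 - exp(-a_j) below 1/2 for all but finitely many \<open>j\<close>,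
  and there a_j is at most twice that term; the remaining a_j are finite by assumption.\<close>

lemma finite_suminf_exp_neg:
  assumes fin: "\<And>j::nat. a j < \<top>" and sum: "(\<Sum>j. ennreal (1 - exp_neg (a j))) < \<top>"
  shows "(\<Sum>j. a j) < \<top>"
proof -
  define r where "r = (\<lambda>j. 1 - exp_neg (a j))"
  have r: "0 \<le> r j" for j by (simp add: r_def)
  have sr: "summable r" 
    by (rule summable_suminf_not_top[OF r]) (use sum in \<open>unfold r_def, rule less_imp_neq\<close>)
  have "\<forall>\<^sub>F j in sequentially. r j < 1 / 2"
    using order_tendstoD(2)[OF summable_LIMSEQ_zero[OF sr], of "1 / 2"] by simp
  then obtain k where k: "\<And>j. k \<le> j \<Longrightarrow> r j < 1 / 2" by (auto simp: eventually_sequentially)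
  have le: "a j \<le> ennreal (2 * r j)" if "k \<le> j" for j
  proof -
    obtain x where x: "0 \<le> x" "a j = ennreal x" using fin[of j] by (cases "a j") auto
    have e: "exp (- x) = 1 - r j" using x by (simp add: r_def exp_neg_ennreal)
    have "x \<le> exp x - 1" using exp_ge_add_one_self[of x] by linarith
    also have "exp x = 1 / (1 - r j)" unfolding e[symmetric] by (simp add: exp_minus inverse_eq_divide)
    also have "1 / (1 - r j) - 1 = r j / (1 - r j)" using k[OF that] by (simp add: field_simps)
    also have "\<dots> \<le> r j / (1 / 2)" using k[OF that] r[of j] by (intro divide_left_mono) auto
    finally show ?thesis unfolding x by (intro ennreal_leI) simp
  qed
  have "(\<Sum>j. a (j + k)) \<le> (\<Sum>j. ennreal (2 * r (j + k)))" by (intro suminf_le le) auto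
  also have "\<dots> < \<top>"
    using r summable_ignore_initial_segment[OF sr, of k] by (subst suminf_ennreal2) (auto intro!: summable_mult)
  finally show ?thesis
    using fin by (subst suminf_offset[where i=k]) auto
qed

context levy_law
begin

text \<open>Drift is a difference, to which monotone convergence does not apply directly; the two
  parts converge separately by dominated convergence, and their limits are finite.\<close>

lemma drift_tendsto:
  assumes f: "\<And>n. adm (f n)" "incseq f" "\<And>x. (\<lambda>n. f n x) \<longlonglongrightarrow> g x" and g: "adm g"
  shows "(\<lambda>n. drift (f n)) \<longlonglongrightarrow> drift g"
proof -
  have meas: "(\<lambda>\<mu>. 1 - exp_neg (pairing \<mu> k)) \<in> borel_measurable \<Lambda>" if "k \<in> borel_measurable borel" for k :: "real \<Rightarrow> real"
    using that by measurable
  have p: "(\<lambda>n. pairing \<mu> (f n)) \<longlonglongrightarrow> pairing \<mu> g" for \<mu>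
    using f admD(1,2)[OF f(1)] by (intro pairing_SUP) auto
  have le: "f n x \<le> g x" for n x
    using f(2,3) by (intro incseq_le[of "\<lambda>n. f n x"]) (auto simp: incseq_def le_fun_def)
  have "(\<lambda>n. lap (f n)) \<longlonglongrightarrow> lap g" using p admD(1)[OF f(1)] admD(1)[OF g] by (intro tendsto_lap) auto
  then have k: "(\<lambda>n. kum (f n)) \<longlonglongrightarrow> kum g"
    unfolding kum_def using lap_pos[OF g] by (intro tendsto_intros) auto
  have "(\<lambda>n. jump (f n)) \<longlonglongrightarrow> jump g"
    unfolding jump_def
  proof (rule nn_integral_dominated_convergence[where w="\<lambda>\<mu>. ennreal (1 - exp_neg (pairing \<mu> g))"])
    show "AE \<mu> in \<Lambda>. ennreal (1 - exp_neg (pairing \<mu> (f j))) \<le> ennreal (1 - exp_neg (pairing \<mu> g))" for j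
      by (intro AE_I2 ennreal_leI diff_mono exp_neg_mono pairing_mono le order_refl)
    show "(\<integral>\<^sup>+\<mu>. ennreal (1 - exp_neg (pairing \<mu> g)) \<partial>\<Lambda>) < \<infinity>"
      using jump_finite[OF g] by (simp add: jump_def)
    show "AE \<mu> in \<Lambda>. (\<lambda>i. ennreal (1 - exp_neg (pairing \<mu> (f i)))) \<longlonglongrightarrow> ennreal (1 - exp_neg (pairing \<mu> g))"
      using p by (intro AE_I2 tendsto_ennrealI tendsto_intros tendsto_exp_neg)
  qed (use admD(1)[OF f(1)] admD(1)[OF g] in \<open>auto intro!: meas\<close>)
  then have "(\<lambda>n. jump (f n)) \<longlonglongrightarrow> ennreal (enn2real (jump g))"
    using jump_finite[OF g] by (simp add: ennreal_enn2real)
  then have "(\<lambda>n. enn2real (jump (f n))) \<longlonglongrightarrow> enn2real (jump g)"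
    by (rule tendsto_enn2real) simp
  with k show ?thesis unfolding drift_def by (intro tendsto_diff)
qed

text \<open>By additivity and scaling, the drift u(t) of the indicator of (0, t] satisfies u(s + t)
  = u(s) + e^(-s) u(t); a further shift moves the left end from 0 to any point.\<close>

lemma drift_Ioc: "\<exists>c\<ge>0. \<forall>a b. a \<le> b \<longrightarrow> drift (indicator {a<..b}) = c * (exp (- a) - exp (- b))"
proof -
  define G where "G = (\<lambda>a b. drift (indicator {a<..b}))"
  have adm: "adm (indicator {a<..b})" for a b :: real by (intro adm_test_fun test_fun_indicator) auto
  have shift: "G (a - s) (b - s) = exp s * G a b" for a b s
  proof -
    have "(\<lambda>x. indicat_real {a<..b} (x + s)) = indicator {a - s<..b - s}" by (auto simp: indicator_def fun_eq_iff)
    then show ?thesis using drift_shift[OF adm, of a b s] by (simp add: G_def)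
  qed
  have split: "G a c = G a b + G b c" if "a \<le> b" "b \<le> c" for a b c
  proof -
    have "indicat_real {a<..c} = (\<lambda>x. indicator {a<..b} x + indicator {b<..c} x)"
      using that by (auto simp: indicator_def fun_eq_iff)
    then show ?thesis using drift_add[OF adm adm, of a b b c] by (simp add: G_def)
  qed
  define u where "u = G 0"
  have u_add: "u (s + t) = u s + exp (- s) * u t" if "0 \<le> s" "0 \<le> t" for s t
    using split[of 0 s "s + t"] shift[of 0 "- s" t] that by (simp add: u_def add.commute)
  define c where "c = u 1 / (1 - exp (- 1))"
  have e1: "exp (- 1) < (1 :: real)" by simp
  \<comment> \<open>Expanding u(1 + t) in both orders gives (1 - e^(-1)) u(t) = (1 - e^(-t)) u(1),
    with no regularity of \<open>u\<close>.\<close>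
  have u_eq: "u t = c * (1 - exp (- t))" if "0 \<le> t" for t
    using u_add[of 1 t] u_add[of t 1] that e1 by (simp add: c_def field_simps)
  have "0 \<le> u 1" unfolding u_def G_def by (rule drift_nonneg[OF adm])
  then have "0 \<le> c" using e1 by (simp add: c_def)
  moreover have "G a b = c * (exp (- a) - exp (- b))" if "a \<le> b" for a b
  proof -
    have "G a b = exp (- a) * u (b - a)" using shift[of 0 "- a" "b - a"] by (simp add: u_def)
    also have "\<dots> = c * (exp (- a) - exp (- b))"
      using that by (simp add: u_eq right_diff_distrib exp_add[symmetric] mult.left_commute)
    finally show ?thesis .
  qed
  ultimately show ?thesis by (auto simp: G_def)
qed

text \<open>Drift and the measure \<open>m\<close> agree on intervals. Additivity and continuity
  along increasing sequences carry this to bounded Borel sets by a Dynkin argument in windows, and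
  then to test functions by simple approximation.\<close>

lemma drift_eq:
  "\<exists>c\<ge>0. \<forall>f. test_fun f \<longrightarrow> ennreal (drift f) = ennreal c * (\<integral>\<^sup>+x. ennreal (exp (- x) * f x) \<partial>lborel)"
proof -
  obtain c where c: "0 \<le> c" "\<And>a b. a \<le> b \<Longrightarrow> drift (indicator {a<..b}) = c * (exp (- a) - exp (- b))"
    using drift_Ioc by blast
  define m where "m = density lborel (\<lambda>x. ennreal (c * exp (- x)))"
  have [measurable_cong, simp]: "sets m = sets borel" by (simp add: m_def)
  have [simp]: "borel_measurable m = borel_measurable borel" by (rule measurable_cong_sets) auto
  have drift_0 [simp]: "drift (\<lambda>_. 0) = 0" using drift_cmult[OF adm_0, of 0] by simp
  have m_Ioc: "emeasure m {a<..b} = ennreal (c * (exp (- a) - exp (- b)))" if "a \<le> b" for a b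
    unfolding m_def by (rule exp_density_Ioc[OF c(1) that])
  have ind: "ennreal (drift (indicator (A \<inter> {-N<..N}))) = emeasure m (A \<inter> {-N<..N})"
    if A: "A \<in> sets borel" and N: "0 \<le> N" for A and N :: real
  proof -
    let ?I = "{-N<..N}"
    have Ioc: "sets (borel :: real measure) = sigma_sets UNIV (range (\<lambda>(a, b). {a<..b}))"
      by (simp add: borel_sigma_sets_Ioc)
    have adm: "adm (indicator (X \<inter> ?I))" if "X \<in> sets borel" for X
      using that by (intro adm_test_fun test_fun_indicator) (auto intro: bounded_subset[of ?I])
    have mfin: "emeasure m (X \<inter> ?I) \<noteq> \<top>" for X
      using emeasure_mono[of "X \<inter> ?I" ?I m] N m_Ioc[of "-N" N] by (auto simp: top_unique)
    have "Int_stable (range (\<lambda>(a, b). {a<..b::real}))" "range (\<lambda>(a, b). {a<..b::real}) \<subseteq> Pow UNIV"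
      "A \<in> sigma_sets UNIV (range (\<lambda>(a, b). {a<..b::real}))"
      using A unfolding Ioc by (auto simp: Int_stable_def)
    then show ?thesis
    proof (induction rule: sigma_sets_induct_disjoint)
      case (basic A)
      then obtain a b where "A = {a<..b}" by (auto simp: image_iff)
      then have A: "A \<inter> ?I = {max a (- N)<..min b N}" by auto
      show ?case
      proof (cases "max a (- N) \<le> min b N")
        case True then show ?thesis unfolding A using c(2) m_Ioc by simp
      next
        case False
        then have "{max a (- N)<..min b N} = {}" by auto
        then have "A \<inter> ?I = {0<..0::real}" unfolding A by simp
        then show ?thesis using c(2)[of 0 0] by simp
      qed
    next
      case empty
      then show ?case using c(2)[of 0 0] by simp
    next
      case (compl A)
      have A: "A \<in> sets borel" using compl(1) unfolding Ioc .
      have "indicat_real ?I = (\<lambda>x. indicator ((UNIV - A) \<inter> ?I) x + indicator (A \<inter> ?I) x)"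
        by (auto simp: indicator_def fun_eq_iff)
      then have "drift (indicator ?I) = drift (indicator ((UNIV - A) \<inter> ?I)) + drift (indicator (A \<inter> ?I))"
        using drift_add[OF adm adm, of "UNIV - A" A] A by simp
      moreover have "0 \<le> drift (indicator ((UNIV - A) \<inter> ?I))" "0 \<le> drift (indicator (A \<inter> ?I))"
        using A by (auto intro!: drift_nonneg adm)
      ultimately have "ennreal (drift (indicator ?I)) = ennreal (drift (indicator ((UNIV - A) \<inter> ?I))) + emeasure m (A \<inter> ?I)"
        using compl by simp
      moreover have "ennreal (drift (indicator ?I)) = emeasure m ?I" using c(2) m_Ioc N by simp
      moreover have "emeasure m ?I = emeasure m ((UNIV - A) \<inter> ?I) + emeasure m (A \<inter> ?I)"
        using A by (subst plus_emeasure) (auto intro!: arg_cong[where f="emeasure m"])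
      ultimately have "emeasure m (A \<inter> ?I) + ennreal (drift (indicator ((UNIV - A) \<inter> ?I))) =
        emeasure m (A \<inter> ?I) + emeasure m ((UNIV - A) \<inter> ?I)" by (simp only: add.commute)
      then show ?case using mfin[of A] by (simp add: ennreal_add_left_cancel)
    next
      case (union A)
      have A: "A i \<in> sets borel" for i using union(2) unfolding Ioc by blast
      define B where "B = (\<lambda>n. \<Union>i<n. A i)"
      have B: "B n \<in> sets borel" for n using A by (auto simp: B_def)
      have Beq: "ennreal (drift (indicator (B n \<inter> ?I))) = emeasure m (B n \<inter> ?I)" for n
      proof (induction n)
        case 0
        then show ?case using c(2)[of 0 0] by (simp add: B_def)
      next
        case (Suc n)
        have disj: "A n \<inter> B n = {}" using disjoint_family_onD[OF union(1), of n] by (fastforce simp: B_def)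
        have Bs: "B (Suc n) = A n \<union> B n" by (auto simp: B_def less_Suc_eq)
        have "indicat_real (B (Suc n) \<inter> ?I) = (\<lambda>x. indicator (A n \<inter> ?I) x + indicator (B n \<inter> ?I) x)"
          using disj by (auto simp: Bs indicator_def fun_eq_iff)
        then have "drift (indicator (B (Suc n) \<inter> ?I)) = drift (indicator (A n \<inter> ?I)) + drift (indicator (B n \<inter> ?I))"
          using drift_add[OF adm adm, of "A n" "B n"] A B by simp
        moreover have "emeasure m (B (Suc n) \<inter> ?I) = emeasure m (A n \<inter> ?I) + emeasure m (B n \<inter> ?I)"
          using A B disj by (subst plus_emeasure) (auto simp: Bs intro!: arg_cong[where f="emeasure m"])
        moreover have "0 \<le> drift (indicator (A n \<inter> ?I))" "0 \<le> drift (indicator (B n \<inter> ?I))"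
          using A B by (auto intro!: drift_nonneg adm)
        ultimately show ?case using union(3)[of n] Suc by simp
      qed
      have Bl: "\<Union>(range A) \<inter> ?I = (\<Union>n. B n \<inter> ?I)" by (auto simp: B_def)
      have Bmono: "B i \<subseteq> B j" if "i \<le> j" for i j
        unfolding B_def using that by (intro UN_mono) auto
      then have incB: "incseq (\<lambda>n. B n \<inter> ?I)" unfolding incseq_def by blast
      have "(\<lambda>n. drift (indicator (B n \<inter> ?I))) \<longlonglongrightarrow> drift (indicator (\<Union>(range A) \<inter> ?I))"
      proof (rule drift_tendsto)
        show "incseq (\<lambda>n. indicat_real (B n \<inter> ?I))"
          using Bmono by (auto simp: incseq_def le_fun_def indicator_def)
        show "(\<lambda>n. indicat_real (B n \<inter> ?I) x) \<longlonglongrightarrow> indicator (\<Union>(range A) \<inter> ?I) x" for x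
          unfolding Bl by (rule LIMSEQ_indicator_incseq[OF incB])
        show "adm (indicator (\<Union>(range A) \<inter> ?I))" using A by (intro adm) auto
      qed (intro adm B)
      then have "(\<lambda>n. ennreal (drift (indicator (B n \<inter> ?I)))) \<longlonglongrightarrow> ennreal (drift (indicator (\<Union>(range A) \<inter> ?I)))"
        by (rule tendsto_ennrealI)
      moreover have "(\<lambda>n. emeasure m (B n \<inter> ?I)) \<longlonglongrightarrow> emeasure m (\<Union>(range A) \<inter> ?I)"
        unfolding Bl by (rule Lim_emeasure_incseq) (use B incB in auto)
      ultimately show ?case unfolding Beq by (rule LIMSEQ_unique)
    qed
  qed
  \<comment> \<open>\<open>test_fun f\<close> stays a premise inside the induction. It passes to the
    pieces, which are dominated by the whole or, for a positive multiple, recovered by dividing by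
    the factor.\<close>
  have gen: "test_fun f \<Longrightarrow> ennreal (drift f) = (\<integral>\<^sup>+x. ennreal (f x) \<partial>m)"
    if "f \<in> borel_measurable borel" "\<And>x. 0 \<le> f x" for f
    using that
  proof (induction rule: borel_measurable_induct_real)
    case (set A)
    obtain R B where "\<And>x. R < \<bar>x\<bar> \<Longrightarrow> indicat_real A x = 0" using set(2) by (rule test_funE) blast
    then have "x \<in> A \<Longrightarrow> \<bar>x\<bar> \<le> R" for x by (force simp: indicator_def)
    then have "x \<in> A \<Longrightarrow> x \<in> {- (\<bar>R\<bar> + 1)<..\<bar>R\<bar> + 1}" for x by fastforce
    then have "A \<inter> {- (\<bar>R\<bar> + 1)<..\<bar>R\<bar> + 1} = A" by auto
    then show ?case using ind[OF set(1), of "\<bar>R\<bar> + 1"] set(1) by (simp add: ennreal_indicator)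
  next
    case (mult u c)
    show ?case
    proof (cases "c = 0")
      case True
      then show ?thesis using drift_cmult[OF adm_0, of 0] by simp
    next
      case False
      have "test_fun (\<lambda>x. inverse c * (c * u x))" using mult by (intro test_fun_cmult[OF mult.prems]) auto
      moreover have "(\<lambda>x. inverse c * (c * u x)) = u" using False by (simp add: fun_eq_iff field_simps)
      ultimately have u: "test_fun u" by simp
      then show ?thesis using mult drift_cmult[OF adm_test_fun[OF u] \<open>0 \<le> c\<close>]
        by (simp add: ennreal_mult' nn_integral_cmult)
    qed
  next
    case (add u v)
    have u: "test_fun u" "test_fun v"
      using add by (auto intro!: test_fun_mono[OF add.prems])
    then show ?case
      using drift_add[OF adm_test_fun[OF u(2)] adm_test_fun[OF u(1)]] add
        drift_nonneg[OF adm_test_fun[OF u(1)]] drift_nonneg[OF adm_test_fun[OF u(2)]]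
      by (simp add: nn_integral_add ennreal_plus)
  next
    case (seq U)
    have le: "U i x \<le> f x" for i x
      using seq by (intro incseq_le[of "\<lambda>n. U n x"]) (auto simp: incseq_def le_fun_def)
    have U: "test_fun (U i)" for i using seq le by (intro test_fun_mono[OF seq.prems]) auto
    have "(\<lambda>n. drift (U n)) \<longlonglongrightarrow> drift f"
      using seq U by (intro drift_tendsto adm_test_fun) auto
    then have "(\<lambda>n. ennreal (drift (U n))) \<longlonglongrightarrow> ennreal (drift f)" by (rule tendsto_ennrealI)
    moreover have "(\<lambda>n. \<integral>\<^sup>+x. ennreal (U n x) \<partial>m) \<longlonglongrightarrow> (\<integral>\<^sup>+x. ennreal (f x) \<partial>m)"
    proof (rule nn_integral_LIMSEQ)
      show "incseq (\<lambda>n x. ennreal (U n x))" using seq by (auto simp: incseq_def le_fun_def intro: ennreal_leI)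
      show "(\<lambda>n. ennreal (U n x)) \<longlonglongrightarrow> ennreal (f x)" for x using seq by (intro tendsto_ennrealI) auto
    qed (use seq in auto)
    ultimately show ?case using seq U by (auto intro: LIMSEQ_unique)
  qed
  have "ennreal (drift f) = ennreal c * (\<integral>\<^sup>+x. ennreal (exp (- x) * f x) \<partial>lborel)" if f: "test_fun f" for f
  proof -
    note [measurable] = test_funD(1)[OF f]
    have "ennreal (drift f) = (\<integral>\<^sup>+x. ennreal (f x) \<partial>m)" using f by (intro gen) (auto simp: test_funD)
    also have "\<dots> = (\<integral>\<^sup>+x. ennreal c * ennreal (exp (- x) * f x) \<partial>lborel)"
      unfolding m_def using c(1) test_funD(2)[OF f]
      by (subst nn_integral_density) (auto intro!: nn_integral_cong simp: ennreal_mult mult_ac)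
    finally show ?thesis by (simp add: nn_integral_cmult)
  qed
  then show ?thesis using c(1) by blast
qed

text \<open>On test functions the formula is the definition of drift. A general \<open>f\<close> is
  the increasing limit of min(f, n) cut off outside [-n, n], along which every term converges in
  [0,\<infinity>].\<close>

theorem levy_khinchin:
  "\<exists>c\<ge>0. \<forall>f\<in>borel_measurable borel. (\<forall>x. 0 \<le> f x) \<longrightarrow> neg_log (lap f) =
     ennreal c * (\<integral>\<^sup>+x. ennreal (exp (- x) * f x) \<partial>lborel) + jump f"
proof -
  obtain c where c: "0 \<le> c"
    "\<And>f. test_fun f \<Longrightarrow> ennreal (drift f) = ennreal c * (\<integral>\<^sup>+x. ennreal (exp (- x) * f x) \<partial>lborel)"
    using drift_eq by blast
  have test: "neg_log (lap f) = ennreal c * (\<integral>\<^sup>+x. ennreal (exp (- x) * f x) \<partial>lborel) + jump f"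
    if f: "test_fun f" for f
  proof -
    have a: "adm f" by (rule adm_test_fun[OF f])
    obtain r where r: "0 \<le> r" "jump f = ennreal r" using jump_finite[OF a] by (cases "jump f") auto
    have "neg_log (lap f) = ennreal (kum f)" using lap_eq_exp_kum[OF lap_pos[OF a]] by simp
    also have "kum f = drift f + r" by (simp add: drift_def r)
    also have "ennreal \<dots> = ennreal (drift f) + ennreal r"
      using drift_nonneg[OF a] r by (intro ennreal_plus) auto
    finally show ?thesis using c(2)[OF f] r by simp
  qed
  have "neg_log (lap f) = ennreal c * (\<integral>\<^sup>+x. ennreal (exp (- x) * f x) \<partial>lborel) + jump f"
    if [measurable]: "f \<in> borel_measurable borel" and nn: "\<And>x. 0 \<le> f x" for f
  proof -
    define g where "g = (\<lambda>n x. min (f x) (real n) * indicator {-real n..real n} x)"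
    have [measurable]: "g n \<in> borel_measurable borel" for n unfolding g_def by measurable
    have g: "test_fun (g n)" for n
      by (rule test_funI[where B="real n" and R="real n"]) (use nn in \<open>auto simp: g_def indicator_def\<close>)
    have g_inc: "g i x \<le> g j x" if "i \<le> j" for i j x
      using that nn[of x] by (auto simp: g_def indicator_def min_def)
    have g_lim: "(\<lambda>n. g n x) \<longlonglongrightarrow> f x" for x
    proof -
      obtain k :: nat where k: "max (f x) \<bar>x\<bar> < k" using reals_Archimedean2 by blast
      have "g n x = f x" if "k \<le> n" for n
        using that k by (auto simp: g_def indicator_def min_def)
      then show ?thesis by (intro tendsto_eventually) (auto simp: eventually_sequentially)
    qed
    have p: "(\<lambda>n. pairing \<mu> (g n)) \<longlonglongrightarrow> pairing \<mu> f" for \<mu>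
      by (intro pairing_SUP g_lim) (auto simp: incseq_def le_fun_def g_inc test_funD(2)[OF g])
    have "(\<lambda>n. neg_log (lap (g n))) \<longlonglongrightarrow> neg_log (lap f)"
      using p by (intro tendsto_neg_log tendsto_lap lap_nonneg) auto
    moreover have "(\<lambda>n. neg_log (lap (g n))) \<longlonglongrightarrow> ennreal c * (\<integral>\<^sup>+x. ennreal (exp (- x) * f x) \<partial>lborel) + jump f"
      unfolding test[OF g]
    proof (intro tendsto_add ennreal_tendsto_cmult)
      show "(\<lambda>n. \<integral>\<^sup>+x. ennreal (exp (- x) * g n x) \<partial>lborel) \<longlonglongrightarrow> (\<integral>\<^sup>+x. ennreal (exp (- x) * f x) \<partial>lborel)"
      proof (rule nn_integral_LIMSEQ)
        show "incseq (\<lambda>n x. ennreal (exp (- x) * g n x))"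
          by (auto simp: incseq_def le_fun_def g_inc intro!: ennreal_leI mult_left_mono)
        show "(\<lambda>n. ennreal (exp (- x) * g n x)) \<longlonglongrightarrow> ennreal (exp (- x) * f x)" for x
          by (intro tendsto_ennrealI tendsto_mult tendsto_const g_lim)
      qed auto
      show "(\<lambda>n. jump (g n)) \<longlonglongrightarrow> jump f"
        unfolding jump_def
      proof (rule nn_integral_LIMSEQ)
        show "incseq (\<lambda>n \<mu>. ennreal (1 - exp_neg (pairing \<mu> (g n))))"
          by (auto simp: incseq_def le_fun_def g_inc intro!: ennreal_leI diff_mono exp_neg_mono pairing_mono)
        show "(\<lambda>n. ennreal (1 - exp_neg (pairing \<mu> (g n)))) \<longlonglongrightarrow> ennreal (1 - exp_neg (pairing \<mu> f))" for \<mu>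
          by (intro tendsto_ennrealI tendsto_intros tendsto_exp_neg p)
      qed auto
    qed auto
    ultimately show ?thesis by (rule LIMSEQ_unique)
  qed
  then show ?thesis using c(1) by blast
qed

text \<open>By scaling the jump part of (j, j + 1] is e^(-j) times that of (0, 1], so the sum over
  \<open>j\<close> of 1 - exp(-\<mu>((j, j + 1])) has a finite integral and is finite almost
  everywhere; hence so is the sum of the masses.\<close>

lemma levy_finite_right_tail: "AE \<mu> in \<Lambda>. emeasure (to_measure \<mu>) {0<..} < \<top>"
proof -
  let ?I = "\<lambda>j::nat. {real j<..real j + 1}"
  have adm: "adm (indicator (?I j))" for j by (intro adm_test_fun test_fun_indicator) auto
  have j_eq: "jump (indicator (?I j)) = ennreal (exp (- real j)) * jump (indicator {0<..1})" for j
  proof -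
    have "(\<lambda>x. indicat_real {0<..1} (x + - real j)) = indicator (?I j)"
      by (auto simp: indicator_def fun_eq_iff)
    then show ?thesis using jump_shift[of "indicator {0<..1}" "- real j"] by simp
  qed
  have "(\<integral>\<^sup>+\<mu>. (\<Sum>j. ennreal (1 - exp_neg (emeasure (to_measure \<mu>) (?I j)))) \<partial>\<Lambda>) = (\<Sum>j. jump (indicator (?I j)))"
    unfolding jump_def by (subst nn_integral_suminf) (auto simp: pairing_indicator)
  also have "\<dots> = (\<Sum>j. ennreal (exp (- real j))) * jump (indicator {0<..1})"
    unfolding j_eq by simp
  also have "\<dots> < \<top>"
  proof -
    have "exp (- real j) = exp (- 1) ^ j" for j using exp_of_nat_mult[of j "- 1 :: real"] by simp
    then have "summable (\<lambda>j. exp (- real j))" by (simp add: summable_geometric)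
    then have "(\<Sum>j. ennreal (exp (- real j))) < \<top>" by (subst suminf_ennreal2) auto
    moreover have "jump (indicator {0<..1}) < \<top>" using jump_finite[OF adm[of 0]] by simp
    ultimately show ?thesis by (simp add: ennreal_mult_less_top)
  qed
  finally have "AE \<mu> in \<Lambda>. (\<Sum>j. ennreal (1 - exp_neg (emeasure (to_measure \<mu>) (?I j)))) \<noteq> \<infinity>"
    by (intro nn_integral_PInf_AE) auto
  then show ?thesis
  proof eventually_elim
    case (elim \<mu>)
    have "(\<Sum>j. emeasure (to_measure \<mu>) (?I j)) < \<top>"
    proof (rule finite_suminf_exp_neg)
      show "emeasure (to_measure \<mu>) (?I j) < \<top>" for j
        by (rule top.not_eq_extremum[THEN iffD1, OF emeasure_Ioc_finite])
      show "(\<Sum>j. ennreal (1 - exp_neg (emeasure (to_measure \<mu>) (?I j)))) < \<top>"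
        using elim unfolding infinity_ennreal_def by (rule top.not_eq_extremum[THEN iffD1])
    qed
    also have "(\<Sum>j. emeasure (to_measure \<mu>) (?I j)) = emeasure (to_measure \<mu>) (\<Union>j. ?I j)"
    proof (rule suminf_emeasure)
      show "disjoint_family ?I"
        unfolding disjoint_family_on_def
      proof (intro ballI impI)
        fix m n :: nat assume "m \<noteq> n"
        then have "real m + 1 \<le> real n \<or> real n + 1 \<le> real m" by linarith
        then show "?I m \<inter> ?I n = {}" by auto
      qed
    qed auto
    also have "(\<Union>j. ?I j) = {0<..}"
    proof (intro equalityI subsetI)
      fix x :: real assume "x \<in> {0<..}"
      then have x: "0 < x" by simp
      define j where "j = nat (\<lceil>x\<rceil> - 1)"
      have "real j = real_of_int \<lceil>x\<rceil> - 1" using x by (simp add: j_def)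
      then have "x \<in> ?I j" by (simp) linarith
      then show "x \<in> (\<Union>j. ?I j)" by blast
    qed auto
    finally show ?case .
  qed
qed

end

section \<open>Disintegration along the position\<close>

text \<open>One inequality, valid for all shifts and measures, suffices: applied to the translated
  measure and -a it yields the other. Infinite positions are included.\<close>

lemma M_pos_translate: "M_pos (translate a \<mu>) = M_pos \<mu> + ereal a"
proof -
  have tail: "emeasure (to_measure (translate a \<mu>)) {x<..} = emeasure (to_measure \<mu>) {x - a<..}" for a x \<mu>
  proof -
    have "(\<lambda>y. y - a) ` {x<..} = {x - a<..}" by (auto simp: image_iff intro!: bexI[of _ "_ + a"])
    then show ?thesis by (simp add: emeasure_translate)
  qed
  have total: "emeasure (to_measure (translate a \<mu>)) UNIV = emeasure (to_measure \<mu>) UNIV" for a \<mu>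
  proof -
    have "(\<lambda>y. y - a) ` UNIV = (UNIV :: real set)" by (auto simp: image_iff intro!: exI[of _ "_ + a"])
    then show ?thesis by (simp add: emeasure_translate)
  qed
  have le: "M_pos \<mu> + ereal a \<le> M_pos (translate a \<mu>)" for a \<mu>
    unfolding M_pos_def[of "translate a \<mu>"]
  proof (rule Inf_greatest)
    fix z assume "z \<in> ereal ` {x. emeasure (to_measure (translate a \<mu>)) {x<..} < min 1 (emeasure (to_measure (translate a \<mu>)) UNIV / 2)}"
    then obtain x where x: "z = ereal x" "emeasure (to_measure \<mu>) {x - a<..} < min 1 (emeasure (to_measure \<mu>) UNIV / 2)"
      by (auto simp: tail total)
    then have "M_pos \<mu> \<le> ereal (x - a)" unfolding M_pos_def by (intro Inf_lower) auto
    then show "M_pos \<mu> + ereal a \<le> z" unfolding x by (cases "M_pos \<mu>") auto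
  qed
  have "M_pos (translate a \<mu>) + ereal (- a) \<le> M_pos \<mu>"
    using le[of "translate a \<mu>" "- a"] by (simp add: translate_translate)
  then have "M_pos (translate a \<mu>) \<le> M_pos \<mu> + ereal a"
    by (cases "M_pos (translate a \<mu>)"; cases "M_pos \<mu>") auto
  with le show ?thesis by (intro antisym) auto
qed

text \<open>The tail mass decreases in \<open>x\<close>, so every rational to the right of a point
  of the set belongs to it as well; the infimum becomes countable and hence measurable.\<close>

lemma M_pos_rat:
  "M_pos \<mu> = (INF q::rat. if emeasure (to_measure \<mu>) {of_rat q<..} < min 1 (emeasure (to_measure \<mu>) UNIV / 2)
     then ereal (of_rat q) else \<infinity>)" (is "_ = (INF q. ?g q)")
proof (rule antisym)
  show "M_pos \<mu> \<le> (INF q. ?g q)"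
    unfolding M_pos_def by (intro INF_greatest) (auto intro!: Inf_lower)
  show "(INF q. ?g q) \<le> M_pos \<mu>"
    unfolding M_pos_def
  proof (rule Inf_greatest)
    fix z assume "z \<in> ereal ` {x. emeasure (to_measure \<mu>) {x<..} < min 1 (emeasure (to_measure \<mu>) UNIV / 2)}"
    then obtain x where z: "z = ereal x" and x: "emeasure (to_measure \<mu>) {x<..} < min 1 (emeasure (to_measure \<mu>) UNIV / 2)" by auto
    show "(INF q. ?g q) \<le> z"
    proof (rule ereal_le_epsilon2)
      fix e :: real assume "0 < e"
      then obtain q where q: "x < of_rat q" "of_rat q < x + e" using of_rat_dense[of x "x + e"] by auto
      have "emeasure (to_measure \<mu>) {of_rat q<..} \<le> emeasure (to_measure \<mu>) {x<..}"
        using q by (intro emeasure_mono) auto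
      then have g: "?g q = ereal (of_rat q)" using x by (auto intro: le_less_trans)
      have "(INF q. ?g q) \<le> ?g q" by (rule INF_lower) simp
      also note g
      also have "ereal (of_rat q) \<le> z + ereal e" using q z by simp
      finally show "(INF q. ?g q) \<le> z + ereal e" .
    qed
  qed
qed

lemma measurable_M_pos [measurable]: "M_pos \<in> borel_measurable borel"
  unfolding M_pos_rat[abs_def] by measurable

text \<open>The tail masses tend to 0 on the right, by finiteness, and to the total mass on the
  left; the threshold lies strictly between these two limits.\<close>

lemma M_pos_finite:
  assumes nz: "\<mu> \<noteq> 0" and tail: "emeasure (to_measure \<mu>) {0<..} < \<top>"
  shows "\<bar>M_pos \<mu>\<bar> \<noteq> \<infinity>"
proof -
  let ?U = "emeasure (to_measure \<mu>) UNIV"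
  let ?c = "min 1 (?U / 2)"
  have U: "?U \<noteq> 0" using nz by (simp add: locfin_eq_0_iff)
  then have c: "0 < ?c" by (simp add: ennreal_zero_less_divide zero_less_iff_neq_zero)
  have "(\<lambda>n. emeasure (to_measure \<mu>) {real n<..}) \<longlonglongrightarrow> emeasure (to_measure \<mu>) (\<Inter>n. {real n<..})"
  proof (rule Lim_emeasure_decseq)
    show "decseq (\<lambda>n. {real n<..})" by (auto simp: decseq_def)
    show "emeasure (to_measure \<mu>) {real n<..} \<noteq> \<infinity>" for n
    proof -
      have "emeasure (to_measure \<mu>) {real n<..} \<le> emeasure (to_measure \<mu>) {0<..}" by (intro emeasure_mono) auto
      then show ?thesis using tail by (auto simp: top_unique)
    qed
  qed auto
  moreover have "(\<Inter>n. {real n<..}) = {}"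
  proof -
    have "x \<notin> (\<Inter>n. {real n<..})" for x
    proof -
      obtain n :: nat where "x < n" using reals_Archimedean2 by blast
      then show ?thesis by (auto intro!: exI[of _ n])
    qed
    then show ?thesis by blast
  qed
  ultimately have "(\<lambda>n. emeasure (to_measure \<mu>) {real n<..}) \<longlonglongrightarrow> 0" by simp
  from order_tendstoD(2)[OF this c] obtain n where "emeasure (to_measure \<mu>) {real n<..} < ?c"
    by (auto simp: eventually_sequentially)
  then have "M_pos \<mu> \<le> ereal (real n)" unfolding M_pos_def by (intro Inf_lower) auto
  moreover have "\<exists>n::nat. \<not> emeasure (to_measure \<mu>) {- real n<..} < ?c"
  proof (rule ccontr)
    assume "\<not> ?thesis"
    then have all: "emeasure (to_measure \<mu>) {- real n<..} \<le> ?c" for n :: nat by (auto simp: less_imp_le)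
    have "(\<lambda>n. emeasure (to_measure \<mu>) {- real n<..}) \<longlonglongrightarrow> emeasure (to_measure \<mu>) (\<Union>n. {- real n<..})"
      by (rule Lim_emeasure_incseq) (auto simp: incseq_def)
    moreover have "(\<Union>n. {- real n<..}) = UNIV"
    proof safe
      fix x :: real
      obtain n :: nat where "- x < n" using reals_Archimedean2 by blast
      then show "x \<in> (\<Union>n. {- real n<..})" by (auto intro!: exI[of _ n])
    qed simp
    ultimately have "(\<lambda>n. emeasure (to_measure \<mu>) {- real n<..}) \<longlonglongrightarrow> ?U" by simp
    \<comment> \<open>The minimum with 1 rules out infinite mass here; for finite U, U <= U / 2
      contradicts U > 0.\<close>
    then have le: "?U \<le> ?c" by (rule LIMSEQ_le_const2) (use all in auto)
    then have "?U \<le> 1" by simp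
    then obtain u where u: "0 \<le> u" "?U = ennreal u" by (cases ?U) (auto simp: top_unique)
    have "ennreal u \<le> ennreal (u / 2)" using le u by (simp add: ennreal_divide_numeral)
    then show False using u U by (simp add: ennreal_le_iff2)
  qed
  then obtain n :: nat where n: "\<not> emeasure (to_measure \<mu>) {- real n<..} < ?c" by blast
  have "ereal (- real n) \<le> M_pos \<mu>" unfolding M_pos_def
  proof (rule Inf_greatest)
    fix z assume "z \<in> ereal ` {x. emeasure (to_measure \<mu>) {x<..} < ?c}"
    then obtain x where x: "z = ereal x" "emeasure (to_measure \<mu>) {x<..} < ?c" by auto
    have "\<not> x < - real n"
    proof
      assume "x < - real n"
      then have "emeasure (to_measure \<mu>) {- real n<..} \<le> emeasure (to_measure \<mu>) {x<..}" by (intro emeasure_mono) auto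
      with x(2) n show False by (metis le_less_trans)
    qed
    then show "ereal (- real n) \<le> z" by (simp add: x)
  qed
  ultimately show ?thesis by (cases "M_pos \<mu>") auto
qed

text \<open>The sets where n g_k is at least 1 have finite measure by Markov's inequality; they
  cover the space since at each point some g_k is positive.\<close>

lemma sigma_finite_measure_positive:
  fixes g :: "'i::countable \<Rightarrow> 'a \<Rightarrow> ennreal"
  assumes [measurable]: "\<And>k. g k \<in> borel_measurable M" and fin: "\<And>k. (\<integral>\<^sup>+x. g k x \<partial>M) < \<top>"
    and pos: "\<And>x. x \<in> space M \<Longrightarrow> \<exists>k. g k x \<noteq> 0"
  shows "sigma_finite_measure M"
proof
  define A where "A = (\<lambda>(k, n::nat). {x \<in> space M. 1 \<le> of_nat n * g k x})"
  have [measurable]: "A p \<in> sets M" for p unfolding A_def by (cases p) simp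
  show "\<exists>A. countable A \<and> A \<subseteq> sets M \<and> \<Union>A = space M \<and> (\<forall>a\<in>A. emeasure M a \<noteq> \<infinity>)"
  proof (intro exI[of _ "range A"] conjI ballI)
    show "\<Union>(range A) = space M"
    proof (intro equalityI subsetI)
      fix x assume x: "x \<in> space M"
      then obtain k where k: "g k x \<noteq> 0" using pos by blast
      have "\<exists>n. 1 \<le> of_nat n * g k x"
      proof (cases "g k x")
        case (real r)
        then have "0 < r" using k by (cases "r = 0") auto
        obtain n :: nat where "1 / r < n" using reals_Archimedean2 by blast
        then have "1 \<le> real n * r" using \<open>0 < r\<close> by (simp add: field_simps)
        then have "ennreal 1 \<le> ennreal (real n) * ennreal r" using \<open>0 < r\<close> by (subst ennreal_mult[symmetric]) (auto intro: ennreal_leI)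
        then show ?thesis using real by (auto simp: ennreal_of_nat_eq_real_of_nat)
      next
        case top then show ?thesis by (intro exI[of _ 1]) simp
      qed
      then obtain n where "x \<in> A (k, n)" using x by (auto simp: A_def)
      then show "x \<in> \<Union>(range A)" by blast
    qed (auto simp: A_def)
    fix a assume "a \<in> range A"
    then obtain k n where a: "a = A (k, n)" by auto
    have "emeasure M a \<le> (\<integral>\<^sup>+x. of_nat n * g k x \<partial>M)"
    proof -
      have "emeasure M a = (\<integral>\<^sup>+x. indicator a x \<partial>M)" unfolding a by simp
      also have "\<dots> \<le> (\<integral>\<^sup>+x. of_nat n * g k x \<partial>M)"
        unfolding a by (intro nn_integral_mono) (auto simp: A_def indicator_def)
      finally show ?thesis .
    qed
    also have "\<dots> < \<top>" using fin[of k] by (simp add: nn_integral_cmult ennreal_mult_less_top of_nat_less_top)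
    finally show "emeasure M a \<noteq> \<infinity>" by simp
  qed auto
qed

lemma space_borel_nonzero [simp]: "space borel_nonzero = - {0}"
  by (simp add: borel_nonzero_def space_restrict_space)

lemma sets_Compl_zero [measurable]: "- {0 :: locfin_measure} \<in> sets borel"
  using sets.compl_sets[OF sets_zero_locfin] by (simp add: Compl_eq_Diff_UNIV)

lemma sets_borel_nonzero: "A \<in> sets borel_nonzero \<longleftrightarrow> A \<in> sets borel \<and> 0 \<notin> A"
  unfolding borel_nonzero_def by (subst sets_restrict_space_iff) auto

lemma measurable_borel_nonzero: "g \<in> measurable borel N \<Longrightarrow> g \<in> measurable borel_nonzero N"
  unfolding borel_nonzero_def by (rule measurable_restrict_space1)

lemma measurable_translate_nonzero: "translate x \<in> measurable borel_nonzero borel_nonzero"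
  unfolding borel_nonzero_def
  by (intro measurable_restrict_space3) auto

lemma nn_integral_translate_law:
  assumes s: "sets \<Delta> = sets borel_nonzero" and G: "G \<in> borel_measurable borel"
  shows "(\<integral>\<^sup>+\<mu>. G \<mu> \<partial>translate_law x \<Delta>) = (\<integral>\<^sup>+\<mu>. G (translate x \<mu>) \<partial>\<Delta>)"
  unfolding translate_law_def
  using measurable_translate_nonzero[of x] measurable_borel_nonzero[OF G] measurable_cong_sets[OF s refl]
  by (subst nn_integral_distr) auto

lemma image_plus_eq_vimage: "(\<lambda>a. a + x) ` A = (\<lambda>y. y - x) -` (A :: real set)"
  by (force simp: image_iff)

text \<open>\<mu>(A + x) is the mass of \<open>A\<close> under the translate by -x, finite because
  \<open>A\<close> is bounded; so the condition becomes one on the integrals of 1 - exp(-<\<mu>,f>)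
  used everywhere else.\<close>

lemma integrability_inner:
  assumes s: "sets \<Delta> = sets borel_nonzero" and A: "A \<in> sets borel" "bounded A"
  shows "(\<integral>\<^sup>+y\<in>{0..}. ennreal (1 - exp (- y)) \<partial>distr \<Delta> borel (\<lambda>\<mu>. measure (to_measure \<mu>) ((\<lambda>a. a + x) ` A))) =
    (\<integral>\<^sup>+\<mu>. ennreal (1 - exp_neg (pairing (translate (- x) \<mu>) (indicator A))) \<partial>\<Delta>)"
proof -
  let ?B = "(\<lambda>a. a + x) ` A"
  have B: "?B \<in> sets borel"
    unfolding image_plus_eq_vimage using measurable_sets[of "\<lambda>y. y - x" borel borel A] A by simp
  have "bounded ?B" using bounded_translation[OF A(2), of x] by (simp add: add.commute)
  then have fin: "emeasure (to_measure \<mu>) ?B < \<top>" for \<mu> using emeasure_to_measure_bounded[OF B] by simp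
  have "(\<lambda>\<mu>. measure (to_measure \<mu>) ?B) \<in> borel_measurable borel" using B unfolding measure_def by measurable
  then have m: "(\<lambda>\<mu>. measure (to_measure \<mu>) ?B) \<in> borel_measurable \<Delta>"
    using measurable_borel_nonzero measurable_cong_sets[OF s refl] by blast
  have "(\<integral>\<^sup>+y\<in>{0..}. ennreal (1 - exp (- y)) \<partial>distr \<Delta> borel (\<lambda>\<mu>. measure (to_measure \<mu>) ?B)) =
    (\<integral>\<^sup>+\<mu>. ennreal (1 - exp (- measure (to_measure \<mu>) ?B)) * indicator {0..} (measure (to_measure \<mu>) ?B) \<partial>\<Delta>)"
    by (subst nn_integral_distr[OF m]) auto
  also have "\<dots> = (\<integral>\<^sup>+\<mu>. ennreal (1 - exp_neg (pairing (translate (- x) \<mu>) (indicator A))) \<partial>\<Delta>)"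
  proof (intro nn_integral_cong)
    fix \<mu>
    have "pairing (translate (- x) \<mu>) (indicator A) = emeasure (to_measure \<mu>) ?B"
      using A(1) by (simp add: pairing_indicator emeasure_translate)
    also have "\<dots> = ennreal (measure (to_measure \<mu>) ?B)" using fin[of \<mu>] by (simp add: emeasure_eq_ennreal_measure)
    finally show "ennreal (1 - exp (- measure (to_measure \<mu>) ?B)) * indicator {0..} (measure (to_measure \<mu>) ?B) =
      ennreal (1 - exp_neg (pairing (translate (- x) \<mu>) (indicator A)))"
      by (simp add: exp_neg_ennreal)
  qed
  finally show ?thesis .
qed

lemma nn_integral_exp_Ioc_01: "(\<integral>\<^sup>+u. ennreal (exp (- u)) * indicator {0<..1} u \<partial>lborel) = ennreal (1 - exp (- 1))"
proof -
  have "(\<integral>\<^sup>+u. ennreal (exp (- u)) * indicator {0<..1} u \<partial>lborel) =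
    emeasure (density lborel (\<lambda>x. ennreal (1 * exp (- x)))) {0<..1}"
    by (subst emeasure_density) auto
  then show ?thesis by (simp only: exp_density_Ioc) simp
qed

definition M_real :: "locfin_measure \<Rightarrow> real" where
  "M_real \<mu> = real_of_ereal (M_pos \<mu>)"

text \<open>At infinite positions \<open>M_real\<close> has the default value 0 and does not follow
  translations; on this set it does.\<close>

definition located :: "locfin_measure set" where
  "located = {\<mu>. \<mu> \<noteq> 0 \<and> \<bar>M_pos \<mu>\<bar> \<noteq> \<infinity>}"

lemma measurable_M_real [measurable]: "M_real \<in> borel_measurable borel"
  unfolding M_real_def by measurable

lemma sets_located [measurable]: "located \<in> sets borel"
proof -
  have "located = {\<mu> \<in> space borel. \<mu> \<in> - {0} \<and> \<bar>M_pos \<mu>\<bar> \<noteq> \<infinity>}" by (auto simp: located_def)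
  also have "\<dots> \<in> sets borel" by measurable
  finally show ?thesis .
qed

lemma located_translate: "translate a \<mu> \<in> located \<longleftrightarrow> \<mu> \<in> located"
  by (cases "M_pos \<mu>") (auto simp: located_def M_pos_translate)

lemma M_real_translate: "\<mu> \<in> located \<Longrightarrow> M_real (translate a \<mu>) = M_real \<mu> + a"
  by (cases "M_pos \<mu>") (auto simp: located_def M_pos_translate M_real_def)

context levy_law
begin

text \<open>The weight of a strictly positive \<open>h\<close> is integrable and covers all nonzero
  measures; the null set of the zero measure is covered by its own indicator, the Boolean index
  distinguishing the two.\<close>

lemma sigma_finite_\<Lambda>: "sigma_finite_measure \<Lambda>"
proof -
  obtain h where h: "adm h" "\<And>x. 0 < h x" using ex_adm_pos by blast
  note [measurable] = admD(1)[OF h(1)]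
  show ?thesis
  proof (rule sigma_finite_measure_positive[where g="\<lambda>k \<mu>. if k then ennreal (1 - exp_neg (pairing \<mu> h)) else indicator {0} \<mu>"])
    show "(\<integral>\<^sup>+\<mu>. (if k then ennreal (1 - exp_neg (pairing \<mu> h)) else indicator {0} \<mu>) \<partial>\<Lambda>) < \<top>" for k
      using jump_finite[OF h(1)] null_\<Lambda> by (cases k) (simp_all add: jump_def)
    show "\<exists>k. (if k then ennreal (1 - exp_neg (pairing \<mu> h)) else indicator {0} \<mu>) \<noteq> 0" for \<mu>
    proof (cases "\<mu> = 0")
      case True then show ?thesis by (intro exI[of _ False]) simp
    next
      case False
      then have "pairing \<mu> h \<noteq> 0" using pairing_pos[of h \<mu>] h by (auto simp: admD)
      then have "pairing \<mu> h \<noteq> 0 \<and> exp_neg (pairing \<mu> h) < 1" using exp_neg_less_1 by simp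
      then show ?thesis by (intro exI[of _ True]) simp
    qed
  qed auto
qed

lemma AE_located: "AE \<mu> in \<Lambda>. \<mu> \<in> located"
proof -
  have "{0} \<in> null_sets \<Lambda>" using null_\<Lambda> by (auto simp: null_sets_def)
  then have "AE \<mu> in \<Lambda>. \<mu> \<noteq> 0" by (rule AE_I') auto
  with levy_finite_right_tail show ?thesis
    by eventually_elim (simp add: located_def M_pos_finite)
qed

text \<open>The constant normalises \<open>exp (- x) dx\<close> on \<open>(0, 1]\<close>.\<close>

definition wgt :: "locfin_measure \<Rightarrow> ennreal" where
  "wgt \<mu> = ennreal (1 / (1 - exp (- 1))) * indicator {0<..1} (M_real \<mu>) * indicator located \<mu>"

lemma measurable_wgt [measurable]: "wgt \<in> borel_measurable borel"
  unfolding wgt_def by measurable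

text \<open>By scaling, the clusters with position in (0, 1] represent all others; they are moved
  back to position 0. The restriction to nonzero measures gives the sigma-field required of
  \<open>\<Delta>\<close>.\<close>

definition centred :: "locfin_measure measure" where
  "centred = restrict_space (distr (density \<Lambda> wgt) borel (\<lambda>\<mu>. translate (- M_real \<mu>) \<mu>)) (- {0})"

lemma sets_centred: "sets centred = sets borel_nonzero"
  unfolding centred_def borel_nonzero_def by (rule sets_restrict_space_cong) simp

lemma nn_integral_centred:
  assumes [measurable]: "G \<in> borel_measurable borel"
  shows "(\<integral>\<^sup>+\<mu>. G \<mu> \<partial>centred) = (\<integral>\<^sup>+\<mu>. wgt \<mu> * G (translate (- M_real \<mu>) \<mu>) \<partial>\<Lambda>)"
proof -
  have "(\<integral>\<^sup>+\<mu>. G \<mu> \<partial>centred) =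
    (\<integral>\<^sup>+\<mu>. G \<mu> * indicator (- {0}) \<mu> \<partial>distr (density \<Lambda> wgt) borel (\<lambda>\<mu>. translate (- M_real \<mu>) \<mu>))"
    unfolding centred_def by (subst nn_integral_restrict_space) auto
  also have "\<dots> = (\<integral>\<^sup>+\<mu>. wgt \<mu> * (G (translate (- M_real \<mu>) \<mu>) * indicator (- {0}) (translate (- M_real \<mu>) \<mu>)) \<partial>\<Lambda>)"
    by (subst nn_integral_distr, simp, simp, subst nn_integral_density) auto
  also have "\<dots> = (\<integral>\<^sup>+\<mu>. wgt \<mu> * G (translate (- M_real \<mu>) \<mu>) \<partial>\<Lambda>)"
    by (intro nn_integral_cong) (auto simp: indicator_def wgt_def located_def)
  finally show ?thesis .
qed

lemma AE_centred: "AE \<mu> in centred. M_pos \<mu> = 0"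
proof -
  define N where "N = {\<mu> \<in> space centred. M_pos \<mu> \<noteq> 0}"
  have "{\<mu> \<in> space borel. \<mu> \<in> - {0} \<and> M_pos \<mu> \<noteq> 0} \<in> sets borel" by measurable
  then have N: "N \<in> sets centred"
    unfolding N_def sets_centred sets_borel_nonzero by (auto simp: sets_eq_imp_space_eq[OF sets_centred])
  then have "emeasure centred N = (\<integral>\<^sup>+\<mu>. indicator N \<mu> \<partial>centred)" by simp
  also have "\<dots> = (\<integral>\<^sup>+\<mu>. indicator {\<mu>. M_pos \<mu> \<noteq> 0} \<mu> \<partial>centred)"
    by (intro nn_integral_cong) (auto simp: N_def indicator_def)
  also have "\<dots> = (\<integral>\<^sup>+\<mu>. wgt \<mu> * indicator {\<mu>. M_pos \<mu> \<noteq> 0} (translate (- M_real \<mu>) \<mu>) \<partial>\<Lambda>)"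
  proof (rule nn_integral_centred)
    have "{\<mu> \<in> space borel. M_pos \<mu> \<noteq> 0} \<in> sets borel" by measurable
    then show "indicator {\<mu>. M_pos \<mu> \<noteq> 0} \<in> borel_measurable borel" by simp
  qed
  also have "\<dots> = (\<integral>\<^sup>+\<mu>. 0 \<partial>\<Lambda>)"
  proof (intro nn_integral_cong)
    fix \<mu>
    show "wgt \<mu> * indicator {\<mu>. M_pos \<mu> \<noteq> 0} (translate (- M_real \<mu>) \<mu>) = 0"
      by (cases "M_pos \<mu>") (auto simp: wgt_def located_def indicator_def M_pos_translate M_real_def)
  qed
  finally have "emeasure centred N = 0" by simp
  with N show ?thesis by (intro AE_I[where N=N]) (auto simp: N_def)
qed

text \<open>Each cluster is reached from its centred version by a shift; the scaling of the Levy measure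
  under translations makes the position of the cluster exponentially distributed.\<close>

lemma disintegration:
  assumes [measurable]: "F \<in> borel_measurable borel"
  shows "(\<integral>\<^sup>+x. ennreal (exp (- x)) * (\<integral>\<^sup>+\<mu>. F (translate x \<mu>) \<partial>centred) \<partial>lborel) = (\<integral>\<^sup>+\<mu>. F \<mu> \<partial>\<Lambda>)"
proof -
  interpret \<Lambda>: sigma_finite_measure \<Lambda> by (rule sigma_finite_\<Lambda>)
  interpret pair_sigma_finite \<Lambda> lborel ..
  define \<kappa> where "\<kappa> = ennreal (1 / (1 - exp (- 1)))"
  have "(\<integral>\<^sup>+x. ennreal (exp (- x)) * (\<integral>\<^sup>+\<mu>. F (translate x \<mu>) \<partial>centred) \<partial>lborel) =
    (\<integral>\<^sup>+x. (\<integral>\<^sup>+\<mu>. ennreal (exp (- x)) * (wgt \<mu> * F (translate (x - M_real \<mu>) \<mu>)) \<partial>\<Lambda>) \<partial>lborel)"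
    by (intro nn_integral_cong, subst nn_integral_centred)
      (auto simp: translate_translate nn_integral_cmult)
  also have "\<dots> = (\<integral>\<^sup>+\<mu>. (\<integral>\<^sup>+x. ennreal (exp (- x)) * (wgt \<mu> * F (translate (x - M_real \<mu>) \<mu>)) \<partial>lborel) \<partial>\<Lambda>)"
    by (rule Fubini') measurable
  \<comment> \<open>The substitution x = M + z, with M the position of \<open>\<mu>\<close>, makes
    the translation independent of \<open>\<mu>\<close>, so that scaling can be applied under the
    integral over \<open>\<mu>\<close>.\<close>
  also have "\<dots> = (\<integral>\<^sup>+\<mu>. (\<integral>\<^sup>+z. ennreal (exp (- (M_real \<mu> + z))) * (wgt \<mu> * F (translate z \<mu>)) \<partial>lborel) \<partial>\<Lambda>)"
  proof (rule nn_integral_cong)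
    fix \<mu>
    show "(\<integral>\<^sup>+x. ennreal (exp (- x)) * (wgt \<mu> * F (translate (x - M_real \<mu>) \<mu>)) \<partial>lborel) =
      (\<integral>\<^sup>+z. ennreal (exp (- (M_real \<mu> + z))) * (wgt \<mu> * F (translate z \<mu>)) \<partial>lborel)"
      by (subst nn_integral_real_affine[where c=1 and t="M_real \<mu>"]) auto
  qed
  also have "\<dots> = (\<integral>\<^sup>+z. (\<integral>\<^sup>+\<mu>. ennreal (exp (- (M_real \<mu> + z))) * (wgt \<mu> * F (translate z \<mu>)) \<partial>\<Lambda>) \<partial>lborel)"
    by (rule Fubini'[symmetric]) measurable
  also have "\<dots> = (\<integral>\<^sup>+z. (\<integral>\<^sup>+\<mu>. \<kappa> * indicator located \<mu> * F \<mu> * (ennreal (exp (- (M_real \<mu> - z))) * indicator {0<..1} (M_real \<mu> - z)) \<partial>\<Lambda>) \<partial>lborel)"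
  proof (rule nn_integral_cong)
    fix z :: real
    \<comment> \<open>Chosen so that the integrand is e^(-z) times \<open>\<phi>\<close> of the
      translate by \<open>z\<close>; the scaling factor e^z then cancels.\<close>
    define \<phi> where "\<phi> = (\<lambda>\<mu>. \<kappa> * indicator located \<mu> * F \<mu> * (ennreal (exp (- (M_real \<mu> - z))) * indicator {0<..1} (M_real \<mu> - z)))"
    have [measurable]: "\<phi> \<in> borel_measurable borel" unfolding \<phi>_def by measurable
    have "ennreal (exp (- (M_real \<mu> + z))) * (wgt \<mu> * F (translate z \<mu>)) = ennreal (exp (- z)) * \<phi> (translate z \<mu>)" for \<mu>
    proof (cases "\<mu> \<in> located")
      case True
      have "exp (- (M_real \<mu> + z)) = exp (- z) * exp (- M_real \<mu>)" by (simp add: exp_add[symmetric])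
      then show ?thesis using True
        by (simp add: \<phi>_def wgt_def located_translate M_real_translate \<kappa>_def ennreal_mult mult_ac)
    qed (simp add: \<phi>_def wgt_def located_translate)
    then have "(\<integral>\<^sup>+\<mu>. ennreal (exp (- (M_real \<mu> + z))) * (wgt \<mu> * F (translate z \<mu>)) \<partial>\<Lambda>) =
      ennreal (exp (- z)) * (\<integral>\<^sup>+\<mu>. \<phi> (translate z \<mu>) \<partial>\<Lambda>)" by (simp add: nn_integral_cmult)
    also have "\<dots> = ennreal (exp (- z)) * ennreal (exp z) * (\<integral>\<^sup>+\<mu>. \<phi> \<mu> \<partial>\<Lambda>)"
      by (simp add: levy_scaling mult.assoc)
    also have "ennreal (exp (- z)) * ennreal (exp z) = 1" by (simp add: ennreal_mult[symmetric] exp_minus)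
    finally show "(\<integral>\<^sup>+\<mu>. ennreal (exp (- (M_real \<mu> + z))) * (wgt \<mu> * F (translate z \<mu>)) \<partial>\<Lambda>) =
      (\<integral>\<^sup>+\<mu>. \<kappa> * indicator located \<mu> * F \<mu> * (ennreal (exp (- (M_real \<mu> - z))) * indicator {0<..1} (M_real \<mu> - z)) \<partial>\<Lambda>)"
      by (simp add: \<phi>_def)
  qed
  also have "\<dots> = (\<integral>\<^sup>+\<mu>. (\<integral>\<^sup>+z. \<kappa> * indicator located \<mu> * F \<mu> * (ennreal (exp (- (M_real \<mu> - z))) * indicator {0<..1} (M_real \<mu> - z)) \<partial>lborel) \<partial>\<Lambda>)"
    by (rule Fubini') measurable
  also have "\<dots> = (\<integral>\<^sup>+\<mu>. F \<mu> \<partial>\<Lambda>)"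
  proof (rule nn_integral_cong_AE)
    show "AE \<mu> in \<Lambda>. (\<integral>\<^sup>+z. \<kappa> * indicator located \<mu> * F \<mu> * (ennreal (exp (- (M_real \<mu> - z))) * indicator {0<..1} (M_real \<mu> - z)) \<partial>lborel) = F \<mu>"
      using AE_located
    proof eventually_elim
      case (elim \<mu>)
      \<comment> \<open>With u = M - z the window (0, 1] has mass 1 - e^(-1), the reciprocal of
        \<open>\<kappa>\<close>.\<close>
      have "(\<integral>\<^sup>+z. ennreal (exp (- (M_real \<mu> - z))) * indicator {0<..1} (M_real \<mu> - z) \<partial>lborel) =
        (\<integral>\<^sup>+u. ennreal (exp (- u)) * indicator {0<..1} u \<partial>lborel)"
        by (subst nn_integral_real_affine[where c="-1" and t="M_real \<mu>"]) auto
      also have "\<dots> = ennreal (1 - exp (- 1))" by (rule nn_integral_exp_Ioc_01)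
      finally have "(\<integral>\<^sup>+z. \<kappa> * indicator located \<mu> * F \<mu> * (ennreal (exp (- (M_real \<mu> - z))) * indicator {0<..1} (M_real \<mu> - z)) \<partial>lborel) =
        (\<kappa> * ennreal (1 - exp (- 1))) * F \<mu>"
        using elim by (subst nn_integral_cmult) (auto simp: mult_ac)
      also have "\<kappa> * ennreal (1 - exp (- 1)) = 1" unfolding \<kappa>_def by (subst ennreal_mult[symmetric]) auto
      finally show ?case by simp
    qed
  qed
  finally show ?thesis .
qed

text \<open>After x is replaced by -x, the disintegration identifies the integral with the jump part
  of the indicator of \<open>A\<close>, which is finite.\<close>

lemma centred_integrable: "integrability_condition centred"
  unfolding integrability_condition_def
proof (intro ballI impI)
  interpret \<Lambda>: sigma_finite_measure \<Lambda> by (rule sigma_finite_\<Lambda>)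
  fix A :: "real set" assume A0[measurable]: "A \<in> sets borel" and A1: "bounded A"
  note A = A0 A1
  define F where "F = (\<lambda>\<mu>. ennreal (1 - exp_neg (pairing \<mu> (indicator A))))"
  have [measurable]: "F \<in> borel_measurable borel" unfolding F_def by measurable
  have "(\<lambda>x. \<integral>\<^sup>+\<mu>. F (translate x \<mu>) \<partial>centred) = (\<lambda>x. \<integral>\<^sup>+\<mu>. wgt \<mu> * F (translate x (translate (- M_real \<mu>) \<mu>)) \<partial>\<Lambda>)"
    by (intro ext nn_integral_centred) measurable
  then have [measurable]: "(\<lambda>x. \<integral>\<^sup>+\<mu>. F (translate x \<mu>) \<partial>centred) \<in> borel_measurable borel" by simp
  have "(\<integral>\<^sup>+x. ennreal (exp x) * (\<integral>\<^sup>+\<mu>. F (translate (- x) \<mu>) \<partial>centred) \<partial>lborel) =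
    (\<integral>\<^sup>+x. ennreal (exp (- x)) * (\<integral>\<^sup>+\<mu>. F (translate x \<mu>) \<partial>centred) \<partial>lborel)"
    by (subst nn_integral_real_affine[where c="-1" and t=0]) auto
  also have "\<dots> = jump (indicator A)" by (subst disintegration) (auto simp: F_def jump_def)
  also have "\<dots> < \<top>" by (intro jump_finite adm_test_fun test_fun_indicator A)
  finally show "(\<integral>\<^sup>+ x. ennreal (exp x) * (\<integral>\<^sup>+ y\<in>{0..}. ennreal (1 - exp (- y))
           \<partial>distr centred borel (\<lambda>\<mu>. measure (to_measure \<mu>) ((\<lambda>a. a + x) ` A))) \<partial>lborel) < \<infinity>"
    by (simp add: integrability_inner[OF sets_centred A] F_def)
qed

end

lemma nn_integral_exp_shift:
  assumes [measurable]: "g \<in> borel_measurable borel"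
  shows "(\<integral>\<^sup>+x. ennreal (exp (- x)) * g (x + a) \<partial>lborel) = ennreal (exp a) * (\<integral>\<^sup>+x. ennreal (exp (- x)) * g x \<partial>lborel)"
proof -
  have "ennreal (exp a) * (\<integral>\<^sup>+x. ennreal (exp (- x)) * g x \<partial>lborel) = (\<integral>\<^sup>+x. ennreal (exp (a - x)) * g x \<partial>lborel)"
    by (subst nn_integral_cmult[symmetric])
      (auto intro!: nn_integral_cong simp: mult.assoc[symmetric] ennreal_mult[symmetric] exp_add[symmetric])
  also have "\<dots> = (\<integral>\<^sup>+x. ennreal (exp (- x)) * g (x + a) \<partial>lborel)"
    by (subst nn_integral_real_affine[where c=1 and t=a]) (auto simp: add.commute)
  finally show ?thesis ..
qed

section \<open>Converse and uniqueness\<close>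

locale cluster_law =
  fixes \<Delta> :: "locfin_measure measure"
  assumes sets_\<Delta>: "sets \<Delta> = sets borel_nonzero"
    and integrable_\<Delta>: "integrability_condition \<Delta>"
begin

lemma space_\<Delta>: "space \<Delta> = - {0}"
  using sets_eq_imp_space_eq[OF sets_\<Delta>] by simp

lemma measurable_\<Delta>: "g \<in> measurable borel N \<Longrightarrow> g \<in> measurable \<Delta> N"
  using measurable_borel_nonzero measurable_cong_sets[OF sets_\<Delta> refl] by blast

text \<open>No measurability of the inner integral is needed here: if it were infinite throughout
  \<open>(k, k + 1)\<close>, so would be the outer integral.\<close>

lemma ex_integrable_shift:
  "\<exists>x. real_of_int k < x \<and> x < real_of_int k + 1 \<and>
     (\<integral>\<^sup>+\<mu>. ennreal (1 - exp_neg (pairing (translate (- x) \<mu>) (indicator {-2<..<2}))) \<partial>\<Delta>) < \<top>"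
proof (rule ccontr)
  let ?g = "\<lambda>x. \<integral>\<^sup>+\<mu>. ennreal (1 - exp_neg (pairing (translate (- x) \<mu>) (indicator {-2<..<2}))) \<partial>\<Delta>"
  assume "\<not> ?thesis"
  then have top: "?g x = \<top>" if "real_of_int k < x" "x < real_of_int k + 1" for x
    using that by (auto simp: less_top[symmetric])
  have "\<top> = (\<integral>\<^sup>+x. \<top> * indicator {real_of_int k<..<real_of_int k + 1} x \<partial>lborel)"
    by (subst nn_integral_cmult_indicator) auto
  also have "\<dots> \<le> (\<integral>\<^sup>+x. ennreal (exp x) * ?g x \<partial>lborel)"
    by (intro nn_integral_mono) (auto simp: indicator_def top ennreal_mult_top)
  also have "\<dots> < \<top>"
    using integrable_\<Delta>[unfolded integrability_condition_def, rule_format, of "{-2<..<2}"]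
    by (simp add: integrability_inner[OF sets_\<Delta>])
  finally show False by simp
qed

text \<open>One good shift X k is chosen in each (k, k + 1). A nonzero measure charges some (k, k +
  1], whose points lie within distance 1 of X k, and so charges the window (-2, 2) around X
  k.\<close>

lemma sigma_finite_\<Delta>: "sigma_finite_measure \<Delta>"
proof -
  have "\<exists>X. \<forall>k. real_of_int k < X k \<and> X k < real_of_int k + 1 \<and>
     (\<integral>\<^sup>+\<mu>. ennreal (1 - exp_neg (pairing (translate (- X k) \<mu>) (indicator {-2<..<2}))) \<partial>\<Delta>) < \<top>"
    by (intro choice allI ex_integrable_shift)
  then obtain X where X: "\<And>k. real_of_int k < X k" "\<And>k. X k < real_of_int k + 1"
    "\<And>k. (\<integral>\<^sup>+\<mu>. ennreal (1 - exp_neg (pairing (translate (- X k) \<mu>) (indicator {-2<..<2}))) \<partial>\<Delta>) < \<top>" by blast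
  show ?thesis
  proof (rule sigma_finite_measure_positive[where g="\<lambda>k \<mu>. ennreal (1 - exp_neg (pairing (translate (- X k) \<mu>) (indicator {-2<..<2})))"])
    show "(\<lambda>\<mu>. ennreal (1 - exp_neg (pairing (translate (- X k) \<mu>) (indicator {-2<..<2})))) \<in> borel_measurable \<Delta>" for k
      by (rule measurable_\<Delta>) measurable
    show "\<exists>k. ennreal (1 - exp_neg (pairing (translate (- X k) \<mu>) (indicator {-2<..<2}))) \<noteq> 0" if "\<mu> \<in> space \<Delta>" for \<mu>
    proof (rule ccontr)
      assume "\<not> ?thesis"
      then have z: "ennreal (1 - exp_neg (pairing (translate (- X k) \<mu>) (indicator {-2<..<2}))) = 0" for k by blast
      have "emeasure (to_measure \<mu>) {real_of_int k<..real_of_int k + 1} = 0" for k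
      proof -
        have "pairing (translate (- X k) \<mu>) (indicator {-2<..<2}) = 0"
          using z[of k] exp_neg_less_1[of "pairing (translate (- X k) \<mu>) (indicator {-2<..<2})"]
          by (auto simp: ennreal_eq_0_iff)
        then have "pairing \<mu> (\<lambda>y. indicator {-2<..<2} (y + - X k)) = 0"
          by (subst (asm) pairing_translate) auto
        moreover have "pairing \<mu> (indicator {real_of_int k<..real_of_int k + 1}) \<le> pairing \<mu> (\<lambda>y. indicator {-2<..<2} (y + - X k))"
          using X(1,2)[of k] by (intro pairing_mono) (auto simp: indicator_def)
        ultimately show ?thesis by (simp add: pairing_indicator)
      qed
      then have "(\<Union>k::int. {real_of_int k<..real_of_int k + 1}) \<in> null_sets (to_measure \<mu>)"
        by (intro null_sets_UN) (auto simp: null_sets_def)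
      moreover have "(\<Union>k::int. {real_of_int k<..real_of_int k + 1}) = UNIV"
      proof (safe; simp)
        fix x :: real
        show "\<exists>k. real_of_int k < x \<and> x \<le> real_of_int k + 1"
          by (rule exI[of _ "\<lceil>x\<rceil> - 1"]) (simp, linarith)
      qed
      ultimately show False using that by (simp add: space_\<Delta> locfin_eq_0_iff null_sets_def)
    qed
  qed (rule X(3))
qed

text \<open>The Levy measure produced by clusters \<open>\<Delta>\<close> that are shifted with
  intensity exp(-x) dx.\<close>

definition spread :: "locfin_measure measure" where
  "spread = distr (density lborel (\<lambda>x. ennreal (exp (- x))) \<Otimes>\<^sub>M \<Delta>) borel (\<lambda>(x, \<mu>). translate x \<mu>)"

lemma sets_spread [simp]: "sets spread = sets borel"
  by (simp add: spread_def)

lemma measurable_pair_\<Delta>: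
  assumes "H \<in> measurable (borel \<Otimes>\<^sub>M borel) N" "sets M = sets borel"
  shows "H \<in> measurable (M \<Otimes>\<^sub>M \<Delta>) N"
proof -
  have "(\<lambda>p. (fst p, snd p)) \<in> measurable (M \<Otimes>\<^sub>M \<Delta>) (borel \<Otimes>\<^sub>M borel)"
  proof (rule measurable_Pair)
    show "fst \<in> measurable (M \<Otimes>\<^sub>M \<Delta>) borel"
      using measurable_fst[of M \<Delta>] measurable_cong_sets[OF refl assms(2)] by blast
    have "(\<lambda>\<mu>. \<mu>) \<in> measurable \<Delta> borel" by (rule measurable_\<Delta>) simp
    from measurable_compose[OF measurable_snd[of M \<Delta>] this] show "snd \<in> measurable (M \<Otimes>\<^sub>M \<Delta>) borel" by simp
  qed
  from measurable_compose[OF this assms(1)] show ?thesis by simp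
qed

lemma measurable_shift_integral:
  assumes "G \<in> borel_measurable borel"
  shows "(\<lambda>x. \<integral>\<^sup>+\<mu>. G (translate x \<mu>) \<partial>\<Delta>) \<in> borel_measurable borel"
proof -
  interpret sigma_finite_measure \<Delta> by (rule sigma_finite_\<Delta>)
  note [measurable] = assms
  have "(\<lambda>p. G (translate (fst p) (snd p))) \<in> borel_measurable (borel \<Otimes>\<^sub>M \<Delta>)"
    by (rule measurable_pair_\<Delta>) simp_all
  then show ?thesis by (intro borel_measurable_nn_integral) (simp add: case_prod_beta)
qed

lemma nn_integral_spread:
  assumes [measurable]: "G \<in> borel_measurable borel"
  shows "(\<integral>\<^sup>+\<mu>. G \<mu> \<partial>spread) = (\<integral>\<^sup>+x. ennreal (exp (- x)) * (\<integral>\<^sup>+\<mu>. G (translate x \<mu>) \<partial>\<Delta>) \<partial>lborel)"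
proof -
  interpret sigma_finite_measure \<Delta> by (rule sigma_finite_\<Delta>)
  let ?E = "density lborel (\<lambda>x. ennreal (exp (- x)))"
  have t: "(\<lambda>(x, \<mu>). translate x \<mu>) \<in> measurable (?E \<Otimes>\<^sub>M \<Delta>) borel"
    by (rule measurable_pair_\<Delta>) (simp_all add: case_prod_beta)
  have "(\<lambda>p. G (translate (fst p) (snd p))) \<in> borel_measurable (?E \<Otimes>\<^sub>M \<Delta>)"
    by (rule measurable_pair_\<Delta>) simp_all
  from nn_integral_fst[OF this]
  have "(\<integral>\<^sup>+\<mu>. G \<mu> \<partial>spread) = (\<integral>\<^sup>+x. (\<integral>\<^sup>+\<mu>. G (translate x \<mu>) \<partial>\<Delta>) \<partial>?E)"
    unfolding spread_def by (subst nn_integral_distr[OF t]) (auto simp: case_prod_beta)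
  also have "\<dots> = (\<integral>\<^sup>+x. ennreal (exp (- x)) * (\<integral>\<^sup>+\<mu>. G (translate x \<mu>) \<partial>\<Delta>) \<partial>lborel)"
    using measurable_shift_integral[OF assms] by (subst nn_integral_density) auto
  finally show ?thesis .
qed

lemma spread_zero: "emeasure spread {0} = 0"
proof -
  have inner: "(\<integral>\<^sup>+\<mu>. indicator {0} (translate x \<mu>) \<partial>\<Delta>) = 0" for x
  proof -
    have "(\<integral>\<^sup>+\<mu>. indicator {0} (translate x \<mu>) \<partial>\<Delta>) = (\<integral>\<^sup>+\<mu>. 0 \<partial>\<Delta>)"
      by (intro nn_integral_cong) (auto simp: space_\<Delta> indicator_def)
    then show ?thesis by simp
  qed
  have "emeasure spread {0} = (\<integral>\<^sup>+\<mu>. indicator {0} \<mu> \<partial>spread)" by simp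
  also have "\<dots> = (\<integral>\<^sup>+x. ennreal (exp (- x)) * (\<integral>\<^sup>+\<mu>. indicator {0} (translate x \<mu>) \<partial>\<Delta>) \<partial>lborel)"
    by (rule nn_integral_spread) simp
  also have "\<dots> = 0" unfolding inner by simp
  finally show ?thesis .
qed

lemma spread_scaling:
  assumes [measurable]: "G \<in> borel_measurable borel"
  shows "(\<integral>\<^sup>+\<mu>. G (translate a \<mu>) \<partial>spread) = ennreal (exp a) * (\<integral>\<^sup>+\<mu>. G \<mu> \<partial>spread)"
proof -
  have "(\<integral>\<^sup>+\<mu>. G (translate a \<mu>) \<partial>spread) =
    (\<integral>\<^sup>+x. ennreal (exp (- x)) * (\<integral>\<^sup>+\<mu>. G (translate (x + a) \<mu>) \<partial>\<Delta>) \<partial>lborel)"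
    by (subst nn_integral_spread) (auto simp: translate_translate add.commute)
  also have "\<dots> = ennreal (exp a) * (\<integral>\<^sup>+x. ennreal (exp (- x)) * (\<integral>\<^sup>+\<mu>. G (translate x \<mu>) \<partial>\<Delta>) \<partial>lborel)"
    by (rule nn_integral_exp_shift[OF measurable_shift_integral[OF assms]])
  finally show ?thesis by (simp add: nn_integral_spread)
qed

text \<open>A cluster of position 0 translated by \<open>x\<close> has position \<open>x\<close>, so
  recentring undoes the translation, and the window (0, 1] has mass 1 - e^(-1) under exp(-x) dx.
  Thus \<open>\<Delta>\<close> can be read off from \<open>spread\<close>.\<close>

lemma spread_centre:
  assumes M0: "AE \<mu> in \<Delta>. M_pos \<mu> = 0" and B [measurable]: "B \<in> sets borel"
  shows "(\<integral>\<^sup>+\<mu>. indicator located \<mu> * indicator {0<..1} (M_real \<mu>) * indicator B (translate (- M_real \<mu>) \<mu>) \<partial>spread) =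
    ennreal (1 - exp (- 1)) * (\<integral>\<^sup>+\<mu>. indicator B \<mu> \<partial>\<Delta>)"
proof -
  have inner: "(\<integral>\<^sup>+\<mu>. indicator located (translate x \<mu>) * indicator {0<..1} (M_real (translate x \<mu>)) *
      indicator B (translate (- M_real (translate x \<mu>)) (translate x \<mu>)) \<partial>\<Delta>) =
    indicator {0<..1} x * (\<integral>\<^sup>+\<mu>. indicator B \<mu> \<partial>\<Delta>)" for x
  proof -
    have "(\<lambda>\<mu>. indicator B \<mu> :: ennreal) \<in> borel_measurable \<Delta>" by (rule measurable_\<Delta>) simp
    then have "indicator {0<..1} x * (\<integral>\<^sup>+\<mu>. indicator B \<mu> \<partial>\<Delta>) = (\<integral>\<^sup>+\<mu>. indicator {0<..1} x * indicator B \<mu> \<partial>\<Delta>)"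
      by (rule nn_integral_cmult[symmetric])
    also have "\<dots> = (\<integral>\<^sup>+\<mu>. indicator located (translate x \<mu>) * indicator {0<..1} (M_real (translate x \<mu>)) *
      indicator B (translate (- M_real (translate x \<mu>)) (translate x \<mu>)) \<partial>\<Delta>)"
    proof (rule nn_integral_cong_AE)
      have "AE \<mu> in \<Delta>. \<mu> \<noteq> 0" by (rule AE_I2) (simp add: space_\<Delta>)
      with M0 show "AE \<mu> in \<Delta>. indicator {0<..1} x * indicator B \<mu> = (indicator located (translate x \<mu>) * indicator {0<..1} (M_real (translate x \<mu>)) *
        indicator B (translate (- M_real (translate x \<mu>)) (translate x \<mu>)) :: ennreal)"
      proof eventually_elim
        case (elim \<mu>)
        then have "\<mu> \<in> located" "M_real \<mu> = 0" by (auto simp: located_def M_real_def)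
        then show ?case by (simp add: located_translate M_real_translate translate_translate)
      qed
    qed
    finally show ?thesis ..
  qed
  have "(\<integral>\<^sup>+\<mu>. indicator located \<mu> * indicator {0<..1} (M_real \<mu>) * indicator B (translate (- M_real \<mu>) \<mu>) \<partial>spread) =
    (\<integral>\<^sup>+x. ennreal (exp (- x)) * (indicator {0<..1} x * (\<integral>\<^sup>+\<mu>. indicator B \<mu> \<partial>\<Delta>)) \<partial>lborel)"
    unfolding inner[symmetric] by (rule nn_integral_spread) measurable
  also have "\<dots> = (\<integral>\<^sup>+x. ennreal (exp (- x)) * indicator {0<..1} x \<partial>lborel) * (\<integral>\<^sup>+\<mu>. indicator B \<mu> \<partial>\<Delta>)"
    by (subst nn_integral_multc[symmetric]) (auto simp: mult.assoc)
  finally show ?thesis by (simp only: nn_integral_exp_Ioc_01)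
qed

end

section \<open>Uniqueness of the Levy measure and superposability from scaling\<close>

context locfin_law
begin

definition khinchin :: "real \<Rightarrow> locfin_measure measure \<Rightarrow> bool" where
  "khinchin c \<Lambda> \<longleftrightarrow> 0 \<le> c \<and> sets \<Lambda> = sets borel \<and> emeasure \<Lambda> {0} = 0 \<and>
    (\<forall>f\<in>borel_measurable borel. (\<forall>x. 0 \<le> f x) \<longrightarrow> neg_log (lap f) =
       ennreal c * (\<integral>\<^sup>+x. ennreal (exp (- x) * f x) \<partial>lborel) + (\<integral>\<^sup>+\<mu>. ennreal (1 - exp_neg (pairing \<mu> f)) \<partial>\<Lambda>))"

lemma neg_log_lap: "adm f \<Longrightarrow> neg_log (lap f) = ennreal (kum f)"
  using lap_eq_exp_kum[OF lap_pos] by simp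

text \<open>The linear term satisfies d(f) + d(f + 2h) = 2 d(f + h) and drops out. Here the starting
  point is only the formula for the cumulant, so that it serves for representations by an arbitrary
  \<open>\<Delta>\<close>.\<close>

lemma khinchin_second_difference:
  assumes K: "khinchin c \<Lambda>" and f: "adm f" and h: "adm h"
  shows "(ennreal (kum f) + ennreal (kum (\<lambda>x. f x + h x + h x))) +
    (\<integral>\<^sup>+\<mu>. ennreal (exp_neg (pairing \<mu> f)) * (ennreal (1 - exp_neg (pairing \<mu> h)) * ennreal (1 - exp_neg (pairing \<mu> h))) \<partial>\<Lambda>) =
    ennreal (kum (\<lambda>x. f x + h x)) + ennreal (kum (\<lambda>x. f x + h x))"
proof -
  note [measurable] = admD(1)[OF f] admD(1)[OF h]
  have [measurable_cong]: "sets \<Lambda> = sets borel" using K by (simp add: khinchin_def)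
  let ?d = "\<lambda>f. ennreal c * (\<integral>\<^sup>+x. ennreal (exp (- x) * f x) \<partial>lborel)"
  let ?J = "\<lambda>f. \<integral>\<^sup>+\<mu>. ennreal (1 - exp_neg (pairing \<mu> f)) \<partial>\<Lambda>"
  let ?X = "\<integral>\<^sup>+\<mu>. ennreal (exp_neg (pairing \<mu> f)) * (ennreal (1 - exp_neg (pairing \<mu> h)) * ennreal (1 - exp_neg (pairing \<mu> h))) \<partial>\<Lambda>"
  note fh = adm_add[OF f h] adm_add[OF adm_add[OF f h] h]
  have k: "ennreal (kum g) = ?d g + ?J g" if "adm g" for g
    using K neg_log_lap[OF that] admD[OF that] by (simp add: khinchin_def)
  have d: "?d (\<lambda>x. f x + h x) + ?d (\<lambda>x. f x + h x) = ?d f + ?d (\<lambda>x. f x + h x + h x)"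
  proof -
    have "(\<integral>\<^sup>+x. ennreal (exp (- x) * (f x + h x)) \<partial>lborel) + (\<integral>\<^sup>+x. ennreal (exp (- x) * (f x + h x)) \<partial>lborel) =
      (\<integral>\<^sup>+x. ennreal (exp (- x) * f x) \<partial>lborel) + (\<integral>\<^sup>+x. ennreal (exp (- x) * (f x + h x + h x)) \<partial>lborel)"
      using admD(2)[OF f] admD(2)[OF h]
      by (subst (1 2) nn_integral_add[symmetric]) (auto intro!: nn_integral_cong simp: ennreal_plus[symmetric] algebra_simps simp del: ennreal_plus)
    then show ?thesis by (simp add: distrib_left[symmetric])
  qed
  have J: "?J (\<lambda>x. f x + h x) + ?J (\<lambda>x. f x + h x) = ?X + (?J f + ?J (\<lambda>x. f x + h x + h x))"
  proof -
    \<comment> \<open>With a = exp(-<\<mu>,f>) and b = exp(-<\<mu>,h>) this is the second difference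
      of 1 - exp(-<\<mu>,.>) in the direction \<open>h\<close>.\<close>
    have pt: "ennreal (1 - a * b) + ennreal (1 - a * b) =
      ennreal a * (ennreal (1 - b) * ennreal (1 - b)) + (ennreal (1 - a) + ennreal (1 - a * b * b))"
      if ab: "0 \<le> a" "a \<le> 1" "0 \<le> b" "b \<le> 1" for a b :: real
    proof -
      have "a * b \<le> 1" "a * b * b \<le> 1" using ab by (auto intro: mult_le_one)
      then have "ennreal a * (ennreal (1 - b) * ennreal (1 - b)) + (ennreal (1 - a) + ennreal (1 - a * b * b)) =
        ennreal (a * ((1 - b) * (1 - b)) + ((1 - a) + (1 - a * b * b)))"
      proof -
        have "ennreal a * (ennreal (1 - b) * ennreal (1 - b)) = ennreal (a * ((1 - b) * (1 - b)))"
          using ab by (simp add: ennreal_mult)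
        moreover have "ennreal (1 - a) + ennreal (1 - a * b * b) = ennreal ((1 - a) + (1 - a * b * b))"
          using ab \<open>a * b * b \<le> 1\<close> by (intro ennreal_plus[symmetric]) auto
        moreover have "0 \<le> a * ((1 - b) * (1 - b))" "0 \<le> (1 - a) + (1 - a * b * b)"
          using ab \<open>a * b * b \<le> 1\<close> by auto
        ultimately show ?thesis by (simp only: ennreal_plus)
      qed
      also have "a * ((1 - b) * (1 - b)) + ((1 - a) + (1 - a * b * b)) = (1 - a * b) + (1 - a * b)"
        by (simp add: algebra_simps)
      also have "ennreal \<dots> = ennreal (1 - a * b) + ennreal (1 - a * b)"
        using \<open>a * b \<le> 1\<close> by (intro ennreal_plus) auto
      finally show ?thesis ..
    qed
    have "?J (\<lambda>x. f x + h x) + ?J (\<lambda>x. f x + h x) =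
      (\<integral>\<^sup>+\<mu>. ennreal (1 - exp_neg (pairing \<mu> (\<lambda>x. f x + h x))) + ennreal (1 - exp_neg (pairing \<mu> (\<lambda>x. f x + h x))) \<partial>\<Lambda>)"
      by (rule nn_integral_add[symmetric]) measurable
    also have "\<dots> = (\<integral>\<^sup>+\<mu>. ennreal (exp_neg (pairing \<mu> f)) * (ennreal (1 - exp_neg (pairing \<mu> h)) * ennreal (1 - exp_neg (pairing \<mu> h))) +
      (ennreal (1 - exp_neg (pairing \<mu> f)) + ennreal (1 - exp_neg (pairing \<mu> (\<lambda>x. f x + h x + h x)))) \<partial>\<Lambda>)"
    proof (rule nn_integral_cong)
      fix \<mu>
      have 1: "exp_neg (pairing \<mu> (\<lambda>x. f x + h x)) = exp_neg (pairing \<mu> f) * exp_neg (pairing \<mu> h)"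
        using f h by (simp add: pairing_add admD exp_neg_add)
      have "pairing \<mu> (\<lambda>x. (f x + h x) + h x) = pairing \<mu> (\<lambda>x. f x + h x) + pairing \<mu> h"
        using admD[OF fh(1)] admD[OF h] by (intro pairing_add)
      then have 2: "exp_neg (pairing \<mu> (\<lambda>x. f x + h x + h x)) = exp_neg (pairing \<mu> f) * exp_neg (pairing \<mu> h) * exp_neg (pairing \<mu> h)"
        by (simp add: exp_neg_add 1)
      show "ennreal (1 - exp_neg (pairing \<mu> (\<lambda>x. f x + h x))) + ennreal (1 - exp_neg (pairing \<mu> (\<lambda>x. f x + h x))) =
        ennreal (exp_neg (pairing \<mu> f)) * (ennreal (1 - exp_neg (pairing \<mu> h)) * ennreal (1 - exp_neg (pairing \<mu> h))) +
        (ennreal (1 - exp_neg (pairing \<mu> f)) + ennreal (1 - exp_neg (pairing \<mu> (\<lambda>x. f x + h x + h x))))"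
        unfolding 1 2 by (rule pt) auto
    qed
    also have "\<dots> = ?X + (\<integral>\<^sup>+\<mu>. ennreal (1 - exp_neg (pairing \<mu> f)) + ennreal (1 - exp_neg (pairing \<mu> (\<lambda>x. f x + h x + h x))) \<partial>\<Lambda>)"
      by (rule nn_integral_add) measurable
    also have "\<dots> = ?X + (?J f + ?J (\<lambda>x. f x + h x + h x))"
      by (subst nn_integral_add) measurable
    finally show ?thesis .
  qed
  have "ennreal (kum (\<lambda>x. f x + h x)) + ennreal (kum (\<lambda>x. f x + h x)) =
    (?d (\<lambda>x. f x + h x) + ?d (\<lambda>x. f x + h x)) + (?J (\<lambda>x. f x + h x) + ?J (\<lambda>x. f x + h x))"
    unfolding k[OF fh(1)] by (simp only: add_ac)
  also have "\<dots> = (?d f + ?J f) + (?d (\<lambda>x. f x + h x + h x) + ?J (\<lambda>x. f x + h x + h x)) + ?X"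
    unfolding d J by (simp only: add_ac)
  finally show ?thesis unfolding k[OF f, symmetric] k[OF fh(2), symmetric] by simp
qed

text \<open>The linear drift cancels in second differences, so they determine the Levy measure.\<close>

lemma khinchin_unique:
  assumes K: "khinchin c \<Lambda>" "khinchin c' \<Lambda>'"
  shows "\<Lambda> = \<Lambda>'"
proof -
  obtain h where h: "adm h" "\<And>x. 0 < h x" using ex_adm_pos by blast
  note [measurable] = admD(1)[OF h(1)]
  let ?p = "\<lambda>\<mu>. ennreal (1 - exp_neg (pairing \<mu> h)) * ennreal (1 - exp_neg (pairing \<mu> h))"
  show ?thesis
  proof (rule weighted_laplace_unique[where p="?p"])
    show "?p \<mu> \<noteq> 0" if "\<mu> \<noteq> 0" for \<mu>
      using that exp_neg_less_1[of "pairing \<mu> h"] pairing_pos[of h \<mu>] h by (auto simp: admD)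
    show "?p \<mu> \<noteq> \<top>" for \<mu> by (simp add: ennreal_mult_eq_top_iff)
    show "(\<integral>\<^sup>+\<mu>. ennreal (exp_neg (pairing \<mu> f)) * ?p \<mu> \<partial>\<Lambda>) = (\<integral>\<^sup>+\<mu>. ennreal (exp_neg (pairing \<mu> f)) * ?p \<mu> \<partial>\<Lambda>')"
      if "test_fun f" for f
    proof -
      have f: "adm f" by (rule adm_test_fun[OF that])
      let ?s = "ennreal (kum f) + ennreal (kum (\<lambda>x. f x + h x + h x))"
      have "?s + (\<integral>\<^sup>+\<mu>. ennreal (exp_neg (pairing \<mu> f)) * ?p \<mu> \<partial>\<Lambda>) =
        ?s + (\<integral>\<^sup>+\<mu>. ennreal (exp_neg (pairing \<mu> f)) * ?p \<mu> \<partial>\<Lambda>')"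
        by (rule trans[OF khinchin_second_difference[OF K(1) f h(1)] khinchin_second_difference[OF K(2) f h(1), symmetric]])
      moreover have "?s \<noteq> \<infinity>" by simp
      ultimately show ?thesis by (simp only: ennreal_add_left_cancel simp_thms)
    qed
    have "(\<integral>\<^sup>+\<mu>. ?p \<mu> \<partial>\<Lambda>) \<le> (ennreal (kum (\<lambda>_. 0)) + ennreal (kum (\<lambda>x. 0 + h x + h x))) +
      (\<integral>\<^sup>+\<mu>. ennreal (exp_neg (pairing \<mu> (\<lambda>_. 0))) * ?p \<mu> \<partial>\<Lambda>)" by (simp add: pairing_def)
    also have "\<dots> = ennreal (kum (\<lambda>x. 0 + h x)) + ennreal (kum (\<lambda>x. 0 + h x))"
      by (rule khinchin_second_difference[OF K(1) adm_0 h(1)])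
    also have "\<dots> < \<top>" by simp
    finally show "(\<integral>\<^sup>+\<mu>. ?p \<mu> \<partial>\<Lambda>) < \<top>" .
  qed (use K in \<open>auto simp: khinchin_def\<close>)
qed

text \<open>Laplace functionals of test functions determine a law, and e^\<alpha> + e^\<beta> = 1
  turns the scaling of the exponent into the product formula for two independent translates.\<close>

lemma superposable_law_of_scaling:
  assumes "\<And>f a. test_fun f \<Longrightarrow> kum (\<lambda>x. f (x + a)) = exp a * kum f"
  shows "superposable_law L"
proof
  fix \<alpha> \<beta> :: real assume ab: "exp \<alpha> + exp \<beta> = 1"
  interpret LL: pair_prob_space L L ..
  let ?D = "distr (L \<Otimes>\<^sub>M L) borel (\<lambda>(\<mu>, \<nu>). translate \<alpha> \<mu> + translate \<beta> \<nu>)"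
  have "prob_space ?D" by (rule LL.prob_space_distr) (simp add: case_prod_beta)
  then show "L = ?D"
  proof (intro laplace_functional_unique)
    show "finite_measure L" by unfold_locales
    show "finite_measure ?D" if "prob_space ?D" using that by (rule prob_space.finite_measure)
    fix f assume f: "test_fun f"
    have e: "lap (\<lambda>x. f (x + a)) = exp (- (exp a * kum f))" for a
      using lap_eq_exp_kum[OF lap_pos[OF adm_test_fun[OF test_fun_shift[OF f]]]] assms[OF f] by simp
    have "lap (\<lambda>x. f (x + \<alpha>)) * lap (\<lambda>x. f (x + \<beta>)) = exp (- ((exp \<alpha> + exp \<beta>) * kum f))"
      unfolding e by (simp add: exp_add[symmetric] algebra_simps)
    also have "\<dots> = lap f" using lap_eq_exp_kum[OF lap_pos[OF adm_test_fun[OF f]]] ab by simp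
    finally show "(\<integral>\<mu>. exp_neg (pairing \<mu> f) \<partial>L) = (\<integral>\<mu>. exp_neg (pairing \<mu> f) \<partial>?D)"
      using test_funD(1)[OF f] by (simp add: lap_superposed lap_def)
  qed auto
qed

end

text \<open>A shift of \<open>f\<close> by \<open>a\<close> multiplies both the drift term and the
  jump term by e^a, since exp(-x) dx acquires this factor; so the cumulant scales, which is enough
  for superposability.\<close>

lemma cluster_representation:
  assumes L: "locfin_law L" and c: "0 \<le> c" and D: "cluster_law \<Delta>"
    and K: "\<And>f. f \<in> borel_measurable borel \<Longrightarrow> (\<And>x. 0 \<le> f x) \<Longrightarrow> neg_log (locfin_law.lap L f) =
      ennreal c * (\<integral>\<^sup>+x. ennreal (exp (- x) * f x) \<partial>lborel) +
      (\<integral>\<^sup>+x. ennreal (exp (- x)) * (\<integral>\<^sup>+\<mu>. ennreal (1 - exp_neg (pairing \<mu> f)) \<partial>translate_law x \<Delta>) \<partial>lborel)"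
  shows "locfin_law.khinchin L c (cluster_law.spread \<Delta>)" and "superposable_law L"
proof -
  interpret locfin_law L by fact
  interpret cluster_law \<Delta> by fact
  have J: "(\<integral>\<^sup>+x. ennreal (exp (- x)) * (\<integral>\<^sup>+\<mu>. ennreal (1 - exp_neg (pairing \<mu> f)) \<partial>translate_law x \<Delta>) \<partial>lborel) =
    (\<integral>\<^sup>+\<mu>. ennreal (1 - exp_neg (pairing \<mu> f)) \<partial>spread)" if [measurable]: "f \<in> borel_measurable borel" for f
    by (subst nn_integral_translate_law[OF sets_\<Delta>]) (simp_all add: nn_integral_spread)
  have K': "neg_log (lap f) = ennreal c * (\<integral>\<^sup>+x. ennreal (exp (- x) * f x) \<partial>lborel) +
      (\<integral>\<^sup>+\<mu>. ennreal (1 - exp_neg (pairing \<mu> f)) \<partial>spread)" if "f \<in> borel_measurable borel" "\<And>x. 0 \<le> f x" for f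
    using K[OF that] J[OF that(1)] by simp
  then show "khinchin c spread" using c by (simp add: khinchin_def spread_zero)
  show "superposable_law L"
  proof (rule superposable_law_of_scaling)
    fix f :: "real \<Rightarrow> real" and a :: real assume f: "test_fun f"
    note [measurable] = test_funD(1)[OF f]
    have d: "(\<integral>\<^sup>+x. ennreal (exp (- x) * f (x + a)) \<partial>lborel) = ennreal (exp a) * (\<integral>\<^sup>+x. ennreal (exp (- x) * f x) \<partial>lborel)"
      using nn_integral_exp_shift[of "\<lambda>x. ennreal (f x)" a] by (simp add: ennreal_mult')
    have j: "(\<integral>\<^sup>+\<mu>. ennreal (1 - exp_neg (pairing \<mu> (\<lambda>x. f (x + a)))) \<partial>spread) =
      ennreal (exp a) * (\<integral>\<^sup>+\<mu>. ennreal (1 - exp_neg (pairing \<mu> f)) \<partial>spread)"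
      by (subst spread_scaling[symmetric]) (auto simp: pairing_translate)
    have "ennreal (kum (\<lambda>x. f (x + a))) = neg_log (lap (\<lambda>x. f (x + a)))"
      by (rule neg_log_lap[symmetric, OF adm_test_fun[OF test_fun_shift[OF f]]])
    also have "\<dots> = ennreal (exp a) * neg_log (lap f)"
      using test_funD(2)[OF f] by (simp add: K' d j distrib_left mult.left_commute)
    also have "\<dots> = ennreal (exp a * kum f)"
      using kum_nonneg[OF adm_test_fun[OF f]] by (simp add: neg_log_lap[OF adm_test_fun[OF f]] ennreal_mult)
    finally show "kum (\<lambda>x. f (x + a)) = exp a * kum f"
      using kum_nonneg[OF adm_test_fun[OF f]] kum_nonneg[OF adm_test_fun[OF test_fun_shift[OF f]]]
      by (subst (asm) ennreal_inj) auto
  qed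
qed

section \<open>From laws back to random measures\<close>

lemma superposable_iff_law:
  assumes P: "prob_space P" and Z: "Z \<in> borel_measurable P"
  shows "superposable P Z \<longleftrightarrow> superposable_law (distr P borel Z)"
proof -
  interpret P: prob_space P by fact
  interpret L: prob_space "distr P borel Z" by (rule P.prob_space_distr[OF Z])
  interpret LL: locfin_law "distr P borel Z" by unfold_locales simp
  have "distr (distr P borel Z \<Otimes>\<^sub>M distr P borel Z) borel (\<lambda>(\<mu>, \<nu>). translate \<alpha> \<mu> + translate \<beta> \<nu>) =
    distr (P \<Otimes>\<^sub>M P) borel (\<lambda>(\<omega>, \<omega>'). translate \<alpha> (Z \<omega>) + translate \<beta> (Z \<omega>'))" for \<alpha> \<beta>
  proof -
    note [measurable] = Z
    have "distr P borel Z \<Otimes>\<^sub>M distr P borel Z = distr (P \<Otimes>\<^sub>M P) (borel \<Otimes>\<^sub>M borel) (\<lambda>(x, y). (Z x, Z y))"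
      by (rule pair_measure_distr[OF Z Z]) unfold_locales
    then show ?thesis by (simp add: distr_distr comp_def split_beta')
  qed
  then show ?thesis
    unfolding superposable_def superposable_law_def superposable_law_axioms_def
    using LL.locfin_law_axioms by simp
qed

lemma cumulant_eq_neg_log_lap:
  assumes P: "prob_space P" and Z: "Z \<in> borel_measurable P" and f: "f \<in> borel_measurable borel"
  shows "cumulant P Z f = neg_log (locfin_law.lap (distr P borel Z) f)"
proof -
  interpret P: prob_space P by fact
  interpret L: prob_space "distr P borel Z" by (rule P.prob_space_distr[OF Z])
  interpret LL: locfin_law "distr P borel Z" by unfold_locales simp
  note [measurable] = Z f
  show ?thesis unfolding cumulant_def LL.lap_def by (subst integral_distr) auto
qed

lemma superposable_law_representation:
  assumes P: "prob_space P" and Z: "Z \<in> borel_measurable P" and S: "superposable P Z"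
  shows "\<exists>c \<Delta>. represents c \<Delta> P Z \<and> (AE \<mu> in \<Delta>. M_pos \<mu> = 0)"
proof -
  interpret superposable_law "distr P borel Z" using S superposable_iff_law[OF P Z] by simp
  obtain \<Lambda> where "levy_measure \<Lambda>" using levy_measure_exists by blast
  then interpret levy_law "distr P borel Z" \<Lambda> by unfold_locales
  obtain c where c: "0 \<le> c" "\<And>f. f \<in> borel_measurable borel \<Longrightarrow> (\<forall>x. 0 \<le> f x) \<Longrightarrow> neg_log (lap f) =
     ennreal c * (\<integral>\<^sup>+x. ennreal (exp (- x) * f x) \<partial>lborel) + jump f"
    using levy_khinchin by blast
  have "represents c centred P Z"
    unfolding represents_def
  proof (intro conjI ballI impI)
    fix f :: "real \<Rightarrow> real" assume f[measurable]: "f \<in> borel_measurable borel" and nn: "\<forall>x. 0 \<le> f x"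
    have "(\<integral>\<^sup>+ x. ennreal (exp (- x)) * (\<integral>\<^sup>+ \<mu>. ennreal (1 - exp_neg (pairing \<mu> f)) \<partial>translate_law x centred) \<partial>lborel) =
      (\<integral>\<^sup>+ x. ennreal (exp (- x)) * (\<integral>\<^sup>+ \<mu>. ennreal (1 - exp_neg (pairing (translate x \<mu>) f)) \<partial>centred) \<partial>lborel)"
      by (subst nn_integral_translate_law[OF sets_centred]) simp_all
    also have "\<dots> = jump f" unfolding jump_def by (rule disintegration) measurable
    finally show "cumulant P Z f = ennreal c * (\<integral>\<^sup>+ x. ennreal (exp (- x) * f x) \<partial>lborel) +
      (\<integral>\<^sup>+ x. ennreal (exp (- x)) * (\<integral>\<^sup>+ \<mu>. ennreal (1 - exp_neg (pairing \<mu> f)) \<partial>translate_law x centred) \<partial>lborel)"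
      using c(2)[OF f nn] by (simp add: cumulant_eq_neg_log_lap[OF P Z f])
  qed (use c(1) sets_centred centred_integrable in auto)
  then show ?thesis using AE_centred by blast
qed

lemma represents_khinchin:
  assumes P: "prob_space P" and Z: "Z \<in> borel_measurable P" and R: "represents c \<Delta> P Z"
  shows "cluster_law \<Delta>" "locfin_law.khinchin (distr P borel Z) c (cluster_law.spread \<Delta>)" "superposable P Z"
proof -
  interpret P: prob_space P by fact
  interpret L: prob_space "distr P borel Z" by (rule P.prob_space_distr[OF Z])
  have L: "locfin_law (distr P borel Z)" by unfold_locales simp
  show D: "cluster_law \<Delta>" using R by unfold_locales (auto simp: represents_def)
  have K: "neg_log (locfin_law.lap (distr P borel Z) f) =
      ennreal c * (\<integral>\<^sup>+x. ennreal (exp (- x) * f x) \<partial>lborel) +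
      (\<integral>\<^sup>+x. ennreal (exp (- x)) * (\<integral>\<^sup>+\<mu>. ennreal (1 - exp_neg (pairing \<mu> f)) \<partial>translate_law x \<Delta>) \<partial>lborel)"
    if "f \<in> borel_measurable borel" "\<And>x. 0 \<le> f x" for f
    using R that by (simp add: represents_def cumulant_eq_neg_log_lap[OF P Z, symmetric])
  have c: "0 \<le> c" using R by (simp add: represents_def)
  show "locfin_law.khinchin (distr P borel Z) c (cluster_law.spread \<Delta>)"
    by (rule cluster_representation(1)[OF L c D K])
  show "superposable P Z"
    unfolding superposable_iff_law[OF P Z] by (rule cluster_representation(2)[OF L c D K])
qed

text \<open>Both cluster measures have the same \<open>spread\<close>, as second differences
  determine it. With all positions 0, recentring returns each of them up to the common positive
  factor 1 - e^(-1).\<close>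

lemma represents_unique:
  assumes P: "prob_space P" and Z: "Z \<in> borel_measurable P"
    and R: "represents c \<Delta> P Z" "AE \<mu> in \<Delta>. M_pos \<mu> = 0"
    and R': "represents c' \<Delta>' P Z" "AE \<mu> in \<Delta>'. M_pos \<mu> = 0"
  shows "\<Delta> = \<Delta>'"
proof -
  interpret P: prob_space P by fact
  interpret L: prob_space "distr P borel Z" by (rule P.prob_space_distr[OF Z])
  interpret LL: locfin_law "distr P borel Z" by unfold_locales simp
  note K = represents_khinchin[OF P Z R(1)] and K' = represents_khinchin[OF P Z R'(1)]
  interpret D: cluster_law \<Delta> by (rule K)
  interpret D': cluster_law \<Delta>' by (rule K')
  have spread: "D.spread = D'.spread" by (rule LL.khinchin_unique[OF K(2) K'(2)])
  show ?thesis
  proof (rule measure_eqI)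
    show s: "sets \<Delta> = sets \<Delta>'" by (simp add: D.sets_\<Delta> D'.sets_\<Delta>)
    fix A assume A: "A \<in> sets \<Delta>"
    then have B: "A \<in> sets borel" by (simp add: D.sets_\<Delta> sets_borel_nonzero)
    have "ennreal (1 - exp (- 1)) * emeasure \<Delta> A = ennreal (1 - exp (- 1)) * emeasure \<Delta>' A"
      using D.spread_centre[OF R(2) B] D'.spread_centre[OF R'(2) B] A s spread by simp
    moreover have "(0::real) < 1 - exp (- 1)" by simp
    ultimately show "emeasure \<Delta> A = emeasure \<Delta>' A"
      by (subst (asm) ennreal_mult_cancel_left) auto
  qed
qed

theorem theorem3p3p1:
  fixes P :: "'a measure" and Z :: "'a \<Rightarrow> locfin_measure"
  assumes "prob_space P"
    and "Z \<in> borel_measurable P"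
  shows "(superposable P Z \<longleftrightarrow> (\<exists>c \<Delta>. represents c \<Delta> P Z)) \<and>
    (superposable P Z \<longrightarrow>
       (\<exists>c \<Delta>. represents c \<Delta> P Z \<and> (AE \<mu> in \<Delta>. M_pos \<mu> = 0)) \<and>
       (\<not> (AE \<omega> in P. Z \<omega> = 0) \<longrightarrow>
          (\<forall>c \<Delta> c' \<Delta>'.
             represents c \<Delta> P Z \<and> (AE \<mu> in \<Delta>. M_pos \<mu> = 0) \<and>
             represents c' \<Delta>' P Z \<and> (AE \<mu> in \<Delta>'. M_pos \<mu> = 0) \<longrightarrow>
             \<Delta> = \<Delta>')))"
proof (intro conjI impI allI)
  show "superposable P Z \<longleftrightarrow> (\<exists>c \<Delta>. represents c \<Delta> P Z)"
  proof
    assume "superposable P Z"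
    from superposable_law_representation[OF assms this] show "\<exists>c \<Delta>. represents c \<Delta> P Z" by blast
  next
    assume "\<exists>c \<Delta>. represents c \<Delta> P Z"
    then obtain c \<Delta> where "represents c \<Delta> P Z" by blast
    then show "superposable P Z" by (rule represents_khinchin(3)[OF assms])
  qed
  show "\<exists>c \<Delta>. represents c \<Delta> P Z \<and> (AE \<mu> in \<Delta>. M_pos \<mu> = 0)" if "superposable P Z"
    by (rule superposable_law_representation[OF assms that])
  fix c c' \<Delta> \<Delta>'
  assume *: "represents c \<Delta> P Z \<and> (AE \<mu> in \<Delta>. M_pos \<mu> = 0) \<and>
    represents c' \<Delta>' P Z \<and> (AE \<mu> in \<Delta>'. M_pos \<mu> = 0)"
  show "\<Delta> = \<Delta>'"
    by (rule represents_unique[OF assms, where c=c and c'=c']) (use * in simp_all)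
qed

end
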